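(* Suppose $u\in C\big([0,T_{max});\dot H^{\frac{\log 3}{2\log 2}}_{\mathcal M}\big)$ is an odd, permutation symmetric, $\sigma$-mirror symmetric solution of the Fourier-restricted Euler equation or of the Fourier-restricted hypodissipative Navier--Stokes equation (with $\nu>0$, $\alpha>0$), with $T_{max}$ its maximal time of existence, and let $\psi(t)=(\psi_n(t))_{n\ge0}$ be its Fourier coefficients, with $\psi^0=\psi(0)$. Then for all $0\le t<T_{max}$, $$\|\psi(t)\|_{\mathcal H^1}^2\le\|\psi^0\|_{\mathcal H^1}^2\exp\left(4\sqrt2\,\pi\int_0^t\sup_{n\ge0}(\sqrt3)^n\psi_n(\tau)\,d\tau\right).$$ In particular, if $T_{max}<+\infty$, then $$\int_0^{T_{max}}\sup_{n\ge0}(\sqrt3)^n\psi_n(t)\,dt=+\infty.$$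
   Context: Function spaces: $\mathbb T^3=\mathbb R^3/\mathbb Z^3$, $\hat u(k)=\int_{\mathbb T^3}u(x)e^{-2\pi i k\cdot x}\,dx$ for $k\in\mathbb Z^3$. For $s\ge0$, $\dot H^s=\dot H^s(\mathbb T^3;\mathbb R^3)$ is the space of mean-zero $L^2$ vector fields with $\|u\|_{\dot H^s}^2=\sum_{k\ne0}(4\pi^2|k|^2)^s|\hat u(k)|^2<\infty$. $(-\Delta)^\alpha$ is the Fourier multiplier $(4\pi^2|k|^2)^\alpha$. Frequencies: let $\sigma=(1,1,1)$. For integers $m\ge0$ let $k^m=2^{2m}\sigma+3^m(1,0,-1)$, $h^m=2^{2m+1}\sigma+3^m(1,1,-2)$, $j^m=2^{2m+1}\sigma+3^m(2,-1,-1)$. For $v\in\mathbb R^3$, $\mathcal P[v]$ is the set of all vectors obtained by permuting the entries of $v$. Let $\mathcal M^+_{2m}=\mathcal P[k^m]$, $\mathcal M^+_{2m+1}=\mathcal P[h^m]\cup\mathcal P[j^m]$, $\mathcal M^+=\bigcup_{n\ge0}\mathcal M_n^+$, $\mathcal M=\mathcal M^+\cup(-\mathcal M^+)$. For $k\in\mathcal M$ let $P_k^\perp(\sigma)=\sigma-\frac{k\cdot\sigma}{|k|^2}k$ and $v^k=P_k^\perp(\sigma)/|P_k^\perp(\sigma)|$. Constraint space: $\dot H^s_{\mathcal M}$ is the set of $u\in\dot H^s(\mathbb T^3;\mathbb R^3)$ with $\operatorname{supp}\hat u\subset\mathcal M$ and $\hat u(k)\in\operatorname{span}\{v^k\}$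 (complex multiples of $v^k$) for all $k\in\mathcal M$. The projection $\mathbb P_{\mathcal M}$ is given by $\widehat{\mathbb P_{\mathcal M}w}(k)=(v^k\cdot\hat w(k))v^k$ for $k\in\mathcal M$ and $0$ for $k\notin\mathcal M$; $(u\cdot\nabla)u=\nabla\cdot(u\otimes u)$ in the sense of distributions. Equations: the Fourier-restricted Euler equation is $\partial_tu+\mathbb P_{\mathcal M}((u\cdot\nabla)u)=0$ (solutions are $C^1$ in time with values in the space). The Fourier-restricted hypodissipative Navier--Stokes equation is $\partial_tu+\nu(-\Delta)^\alpha u+\mathbb P_{\mathcal M}((u\cdot\nabla)u)=0$, with solutions understood in the mild sense: $u(\cdot,t)=e^{-\nu t(-\Delta)^\alpha}u^0-\int_0^te^{-\nu(t-\tau)(-\Delta)^\alpha}\mathbb P_{\mathcal M}((u\cdot\nabla)u)(\cdot,\tau)\,d\tau$. Symmetries: $u$ is odd if $u(-x)=-u(x)$; permutation symmetric if $u(Px)=Pu(x)$ for every permutation $P$ of $\{1,2,3\}$ acting on vectors by $(Pv)_i=v_{P(i)}$; $\sigma$-mirror symmetric if $u(x)=M_\sigma u(M_\sigma x)$ for all $x$, where $M_\sigma=I_3-\frac23\sigma\otimes\sigma$ and $u$ is extended periodically to $\mathbb R^3$. An odd, permutation symmetric, $\sigma$-mirror symmetric $u\in\dot H^s_{\mathcal M}$ is written uniquely as $u(x)=-2\sum_{n\ge0}\psi_n\sum_{k\in\mathcal M_n^+}v^k\sin(2\pi k\cdot x)$ with real $\psi_n$; these are its Fourier coefficients. $\|\psi\|_{\mathcal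 H^s}^2=\sum_{n\ge0}(\sqrt3)^{2sn}\psi_n^2$. *)

theory Defs
  imports "HOL-Analysis.Analysis"
begin

(* Scalar functions and vector fields on the torus R^3/Z^3 are functions on real^3 that are
   invariant under Z^3; L2 fields are represented by concrete functions, and identities between
   fields are understood almost everywhere. *)

definition freq :: "int ^ 3 \<Rightarrow> real ^ 3" where
  "freq k = (\<chi> i. real_of_int (k $ i))"

definition periodic :: "(real ^ 3 \<Rightarrow> 'a) \<Rightarrow> bool" where
  "periodic f \<longleftrightarrow> (\<forall>x k. f (x + freq k) = f x)"

definition torus_integral :: "(real ^ 3 \<Rightarrow> complex) \<Rightarrow> complex" where
  "torus_integral f = (LINT x:cbox 0 1|lebesgue. f x)"

definition fourier_mode :: "int ^ 3 \<Rightarrow> real ^ 3 \<Rightarrow> complex" where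
  "fourier_mode k x = exp (- 2 * complex_of_real pi * \<i> * complex_of_real (freq k \<bullet> x))"

definition fhat :: "(real ^ 3 \<Rightarrow> real ^ 3) \<Rightarrow> int ^ 3 \<Rightarrow> complex ^ 3" where
  "fhat u k = (\<chi> i. torus_integral (\<lambda>x. complex_of_real (u x $ i) * fourier_mode k x))"

definition L2_field :: "(real ^ 3 \<Rightarrow> real ^ 3) \<Rightarrow> bool" where
  "L2_field u \<longleftrightarrow> periodic u \<and> u \<in> borel_measurable lebesgue \<and>
     set_integrable lebesgue (cbox 0 1) (\<lambda>x. (norm (u x))\<^sup>2)"

definition Laplace_symbol :: "int ^ 3 \<Rightarrow> real" where
  "Laplace_symbol k = 4 * pi\<^sup>2 * (norm (freq k))\<^sup>2"

definition Hdot :: "real \<Rightarrow> (real ^ 3 \<Rightarrow> real ^ 3) set" where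
  "Hdot s = {u. L2_field u \<and> fhat u 0 = 0 \<and>
     (\<lambda>k. Laplace_symbol k powr s * (norm (fhat u k))\<^sup>2) summable_on (- {0})}"

(* Only meaningful on Hdot s: infsum is 0 when the sum diverges. *)
definition Hdot_norm :: "real \<Rightarrow> (real ^ 3 \<Rightarrow> real ^ 3) \<Rightarrow> real" where
  "Hdot_norm s u = sqrt (\<Sum>\<^sub>\<infinity>k\<in>- {0}. Laplace_symbol k powr s * (norm (fhat u k))\<^sup>2)"


definition sigma_vec :: "real ^ 3" where
  "sigma_vec = (\<chi> i. 1)"

definition k_vec :: "nat \<Rightarrow> int ^ 3" where
  "k_vec m = 2 ^ (2 * m) *s vector [1, 1, 1] + 3 ^ m *s vector [1, 0, - 1]"

definition h_vec :: "nat \<Rightarrow> int ^ 3" where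
  "h_vec m = 2 ^ (2 * m + 1) *s vector [1, 1, 1] + 3 ^ m *s vector [1, 1, - 2]"

definition j_vec :: "nat \<Rightarrow> int ^ 3" where
  "j_vec m = 2 ^ (2 * m + 1) *s vector [1, 1, 1] + 3 ^ m *s vector [2, - 1, - 1]"

definition permute_vec :: "(3 \<Rightarrow> 3) \<Rightarrow> 'a ^ 3 \<Rightarrow> 'a ^ 3" where
  "permute_vec p v = (\<chi> i. v $ p i)"

definition perms :: "'a ^ 3 \<Rightarrow> ('a ^ 3) set" where
  "perms v = {permute_vec p v | p. bij p}"

definition shell :: "nat \<Rightarrow> (int ^ 3) set" where
  "shell n = (if even n then perms (k_vec (n div 2))
              else perms (h_vec (n div 2)) \<union> perms (j_vec (n div 2)))"

definition freq_set :: "(int ^ 3) set" where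
  "freq_set = (\<Union>n. shell n) \<union> uminus ` (\<Union>n. shell n)"

definition sigma_perp :: "int ^ 3 \<Rightarrow> real ^ 3" where
  "sigma_perp k = sigma_vec - ((freq k \<bullet> sigma_vec) / (norm (freq k))\<^sup>2) *\<^sub>R freq k"

definition dir :: "int ^ 3 \<Rightarrow> real ^ 3" where
  "dir k = sigma_perp k /\<^sub>R norm (sigma_perp k)"

definition cvec :: "real ^ 3 \<Rightarrow> complex ^ 3" where
  "cvec v = (\<chi> i. complex_of_real (v $ i))"


definition HdotM :: "real \<Rightarrow> (real ^ 3 \<Rightarrow> real ^ 3) set" where
  "HdotM s = {u \<in> Hdot s. (\<forall>k. k \<notin> freq_set \<longrightarrow> fhat u k = 0) \<and>
     (\<forall>k\<in>freq_set. \<exists>c. fhat u k = c *s cvec (dir k))}"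

(* The projection, acting on Fourier coefficients so that it applies to distributions. *)
definition proj_M :: "(int ^ 3 \<Rightarrow> complex ^ 3) \<Rightarrow> int ^ 3 \<Rightarrow> complex ^ 3" where
  "proj_M w k = (if k \<in> freq_set
     then (\<Sum>i\<in>UNIV. complex_of_real (dir k $ i) * w k $ i) *s cvec (dir k) else 0)"

(* The pairing of the distribution div (u \<otimes> u) with a smooth periodic test function:
   component i is minus the integral of the sum over j of u_j u_i (d/dx_j) phi. *)
definition advection :: "(real ^ 3 \<Rightarrow> real ^ 3) \<Rightarrow> (real ^ 3 \<Rightarrow> complex) \<Rightarrow> complex ^ 3" where
  "advection u \<phi> = (\<chi> i. - torus_integral (\<lambda>x. \<Sum>j\<in>UNIV.
     complex_of_real (u x $ j * u x $ i) * frechet_derivative \<phi> (at x) (axis j 1)))"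

definition advection_hat :: "(real ^ 3 \<Rightarrow> real ^ 3) \<Rightarrow> int ^ 3 \<Rightarrow> complex ^ 3" where
  "advection_hat u k = advection u (fourier_mode k)"


definition time_dom :: "ereal \<Rightarrow> real set" where
  "time_dom T = {t. 0 \<le> t \<and> ereal t < T}"

definition continuous_HdotM :: "real \<Rightarrow> ereal \<Rightarrow> (real \<Rightarrow> real ^ 3 \<Rightarrow> real ^ 3) \<Rightarrow> bool" where
  "continuous_HdotM s T u \<longleftrightarrow> (\<forall>t\<in>time_dom T. u t \<in> HdotM s \<and>
     ((\<lambda>\<tau>. Hdot_norm s (\<lambda>x. u \<tau> x - u t x)) \<longlongrightarrow> 0) (at t within time_dom T))"

definition has_time_derivative ::
    "real \<Rightarrow> ereal \<Rightarrow> (real \<Rightarrow> real ^ 3 \<Rightarrow> real ^ 3) \<Rightarrow> (real \<Rightarrow> real ^ 3 \<Rightarrow> real ^ 3) \<Rightarrow> bool" where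
  "has_time_derivative s T u u' \<longleftrightarrow> (\<forall>t\<in>time_dom T.
     ((\<lambda>\<tau>. Hdot_norm s (\<lambda>x. (u \<tau> x - u t x) /\<^sub>R (\<tau> - t) - u' t x)) \<longlongrightarrow> 0)
       (at t within time_dom T))"

definition Euler_solution :: "real \<Rightarrow> ereal \<Rightarrow> (real \<Rightarrow> real ^ 3 \<Rightarrow> real ^ 3) \<Rightarrow> bool" where
  "Euler_solution s T u \<longleftrightarrow> continuous_HdotM s T u \<and>
     (\<exists>u'. continuous_HdotM s T u' \<and> has_time_derivative s T u u' \<and>
       (\<forall>t\<in>time_dom T. \<forall>k. fhat (u' t) k + proj_M (advection_hat (u t)) k = 0))"

definition heat_symbol :: "real \<Rightarrow> real \<Rightarrow> real \<Rightarrow> int ^ 3 \<Rightarrow> real" where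
  "heat_symbol \<nu> \<alpha> t k = exp (- \<nu> * t * Laplace_symbol k powr \<alpha>)"

(* Mild solutions; the Duhamel integral is evaluated on each Fourier coefficient. *)
definition NS_solution ::
    "real \<Rightarrow> real \<Rightarrow> real \<Rightarrow> ereal \<Rightarrow> (real \<Rightarrow> real ^ 3 \<Rightarrow> real ^ 3) \<Rightarrow> bool" where
  "NS_solution \<nu> \<alpha> s T u \<longleftrightarrow> continuous_HdotM s T u \<and>
     (\<forall>t\<in>time_dom T. \<forall>k.
       (\<lambda>\<tau>. heat_symbol \<nu> \<alpha> (t - \<tau>) k *\<^sub>R proj_M (advection_hat (u \<tau>)) k)
         absolutely_integrable_on {0..t} \<and>
       fhat (u t) k = heat_symbol \<nu> \<alpha> t k *\<^sub>R fhat (u 0) k -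
         integral {0..t} (\<lambda>\<tau>. heat_symbol \<nu> \<alpha> (t - \<tau>) k *\<^sub>R proj_M (advection_hat (u \<tau>)) k))"

(* T is the maximal time of existence of u: no solution on a longer interval extends u. *)
definition maximal_solution ::
    "(ereal \<Rightarrow> (real \<Rightarrow> real ^ 3 \<Rightarrow> real ^ 3) \<Rightarrow> bool) \<Rightarrow> ereal \<Rightarrow> (real \<Rightarrow> real ^ 3 \<Rightarrow> real ^ 3) \<Rightarrow> bool"
  where
  "maximal_solution is_sol T u \<longleftrightarrow> 0 < T \<and> is_sol T u \<and>
     \<not> (\<exists>T' v. T < T' \<and> is_sol T' v \<and> (\<forall>t\<in>time_dom T. AE x in lebesgue. v t x = u t x))"


definition odd_field :: "(real ^ 3 \<Rightarrow> real ^ 3) \<Rightarrow> bool" where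
  "odd_field u \<longleftrightarrow> (AE x in lebesgue. u (- x) = - u x)"

definition permutation_symmetric :: "(real ^ 3 \<Rightarrow> real ^ 3) \<Rightarrow> bool" where
  "permutation_symmetric u \<longleftrightarrow>
     (\<forall>p. bij p \<longrightarrow> (AE x in lebesgue. u (permute_vec p x) = permute_vec p (u x)))"

definition M_sigma :: "real ^ 3 ^ 3" where
  "M_sigma = mat 1 - (2 / 3) *\<^sub>R (\<chi> i j. sigma_vec $ i * sigma_vec $ j)"

definition sigma_mirror_symmetric :: "(real ^ 3 \<Rightarrow> real ^ 3) \<Rightarrow> bool" where
  "sigma_mirror_symmetric u \<longleftrightarrow> (AE x in lebesgue. u x = M_sigma *v u (M_sigma *v x))"

definition partial_field :: "(nat \<Rightarrow> real) \<Rightarrow> nat \<Rightarrow> real ^ 3 \<Rightarrow> real ^ 3" where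
  "partial_field \<psi> N x =
     (- 2) *\<^sub>R (\<Sum>n<N. \<psi> n *\<^sub>R (\<Sum>k\<in>shell n. sin (2 * pi * (freq k \<bullet> x)) *\<^sub>R dir k))"

(* The unique real sequence whose series sums to u, with convergence in Hdot s. *)
definition psi_coeffs :: "real \<Rightarrow> (real ^ 3 \<Rightarrow> real ^ 3) \<Rightarrow> nat \<Rightarrow> real" where
  "psi_coeffs s u =
     (THE \<psi>. (\<lambda>N. Hdot_norm s (\<lambda>x. u x - partial_field \<psi> N x)) \<longlonglongrightarrow> 0)"

definition seq_norm :: "real \<Rightarrow> (nat \<Rightarrow> real) \<Rightarrow> real" where
  "seq_norm s \<psi> = sqrt (\<Sum>n. sqrt 3 powr (2 * s * real n) * (\<psi> n)\<^sup>2)"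

definition s_crit :: real where
  "s_crit = ln 3 / (2 * ln 2)"

end

theory Submission
  imports Defs
begin

text \<open>
  The coordinate sum of a frequency on shell \<open>n\<close> is \<open>3 * 2^n\<close> up to sign, so three frequencies can
  only resonate across consecutive shells, and the symmetries leave one real amplitude per shell.
  In the rescaled amplitudes \<open>a\<^sub>n = (sqrt 3)^n \<psi>\<^sub>n\<close> both equations become the shell model
  \<open>a\<^sub>n' = - lam\<^sub>n a\<^sub>n + sqrt 2 * pi * (3 \<beta>\<^sub>n\<^sub>-\<^sub>1 (a\<^sub>n\<^sub>-\<^sub>1)^2 - \<beta>\<^sub>n a\<^sub>n a\<^sub>n\<^sub>+\<^sub>1)\<close>
  with \<open>lam\<^sub>n \<ge> 0\<close> and \<open>0 \<le> \<beta>\<^sub>n \<le> 1\<close>, and the critical Sobolev norm is equivalent to the l2 norm of \<open>a\<close>.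
  In the derivative of \<open>\<Sum>\<^sub>n a\<^sub>n\<^sup>2\<close> the cubic terms telescope to
  \<open>4 * sqrt 2 * pi * \<Sum>\<^sub>n \<beta>\<^sub>n a\<^sub>n\<^sup>2 a\<^sub>n\<^sub>+\<^sub>1\<close>, and Gronwall's inequality gives the estimate.
  If the integral of the supremum were finite up to a finite \<open>Tmax\<close>, then \<open>a\<close> would stay bounded in l2;
  a contraction argument for the Duhamel formulation then continues it beyond \<open>Tmax\<close>, and the sine
  series with the continued amplitudes extends the solution.
\<close>

section \<open>Energy estimate for the shell model\<close>

text \<open>Since squared lengths on shell \<open>n\<close> are \<open>3 * 4^n + 2 * 3^n\<close> and
  \<open>4 powr s_crit = 3\<close>, the critical field norm weighs shell \<open>n\<close> like
  \<open>3^n\<close>: up to constants it is the H^1 norm of the amplitudes. The unweighted energy is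
  passed between neighbouring shells without loss; in the weight \<open>3^n\<close> each unit passed
  upward arrives as three, and the surplus 3 - 1 = 2, doubled by differentiating a square, is the 4
  in the constant. Telescoping is done on finite sums, whose boundary term disappears by dominated
  convergence. The rates \<open>lam n\<close> may be unbounded, so \<open>lam n * a n\<close> need
  not be square summable and a flow is differentiable componentwise only. The continuation argument
  therefore uses the Duhamel form, in which dissipation is a contraction, with estimates uniform in
  \<open>lam\<close>; \<open>lam = 0\<close> is Euler. The quadratic term loses no derivative in the
  rescaled amplitudes: it is Lipschitz from balls of l2 into l1, so an l2 bound gives a definite
  time of continuation. Maximality concerns fields, hence fields and amplitudes are translated in
  both directions.\<close>

lemma mem_time_dom [simp]: "t \<in> time_dom T \<longleftrightarrow> 0 \<le> t \<and> ereal t < T"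
  by (simp add: time_dom_def)

lemma atLeastAtMost_subset_time_dom: "t \<in> time_dom T \<Longrightarrow> {0..t} \<subseteq> time_dom T"
  by (auto intro!: le_less_trans[where y = "ereal t"])

section \<open>Square-summable sequences through finite sections\<close>

definition l2_norm :: "(nat \<Rightarrow> real) \<Rightarrow> real" where
  "l2_norm x = sqrt (\<Sum>n. (x n)\<^sup>2)"

lemma L2_set_le_l2_norm:
  assumes "summable (\<lambda>n. (x n)\<^sup>2)" "finite A"
  shows "L2_set x A \<le> l2_norm x"
  unfolding L2_set_def l2_norm_def
  by (intro real_sqrt_le_mono sum_le_suminf assms) auto

lemma l2_norm_nonneg: "summable (\<lambda>n. (x n)\<^sup>2) \<Longrightarrow> 0 \<le> l2_norm x"
  unfolding l2_norm_def by (simp add: suminf_nonneg)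

lemma l2_norm_power2: "summable (\<lambda>n. (x n)\<^sup>2) \<Longrightarrow> (l2_norm x)\<^sup>2 = (\<Sum>n. (x n)\<^sup>2)"
  unfolding l2_norm_def by (simp add: suminf_nonneg)

lemma abs_le_l2_norm: "summable (\<lambda>n. (x n)\<^sup>2) \<Longrightarrow> \<bar>x n\<bar> \<le> l2_norm x"
  using L2_set_le_l2_norm[of x "{n}"] by (simp add: L2_set_def)

text \<open>Reduces l2 claims to finite sections, where the Minkowski and Cauchy-Schwarz
  inequalities for \<open>L2_set\<close> apply; the empty section supplies
  \<open>0 \<le> B\<close>.\<close>

lemma l2_normI:
  assumes B: "\<And>N. L2_set x {..<N} \<le> B"
  shows "summable (\<lambda>n. (x n)\<^sup>2)" "l2_norm x \<le> B"
proof -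
  have B0: "0 \<le> B" using B[of 0] by simp
  have *: "(\<Sum>n<N. (x n)\<^sup>2) \<le> B\<^sup>2" for N
    using B[of N] B0 unfolding L2_set_def by (simp add: real_sqrt_le_iff sqrt_le_D)
  show s: "summable (\<lambda>n. (x n)\<^sup>2)"
    by (rule bounded_imp_summable[where B = "B\<^sup>2"]) (use *[of "Suc _"] in \<open>auto simp: lessThan_Suc_atMost\<close>)
  show "l2_norm x \<le> B"
    unfolding l2_norm_def
    by (rule real_le_lsqrt) (use s B0 * in \<open>auto intro: suminf_nonneg suminf_le_const\<close>)
qed

lemma
  assumes "summable (\<lambda>n. (x n)\<^sup>2)" "summable (\<lambda>n. (y n)\<^sup>2)"
  shows summable_l2_add: "summable (\<lambda>n. (x n + y n)\<^sup>2)"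
    and l2_norm_triangle: "l2_norm (\<lambda>n. x n + y n) \<le> l2_norm x + l2_norm y"
proof -
  have "L2_set (\<lambda>n. x n + y n) {..<N} \<le> l2_norm x + l2_norm y" for N
    by (rule order_trans[OF L2_set_triangle_ineq]) (intro add_mono L2_set_le_l2_norm assms, auto)
  then show "summable (\<lambda>n. (x n + y n)\<^sup>2)" "l2_norm (\<lambda>n. x n + y n) \<le> l2_norm x + l2_norm y"
    by (rule l2_normI)+
qed

lemma
  assumes "summable (\<lambda>n. (x n)\<^sup>2)" "summable (\<lambda>n. (y n)\<^sup>2)"
  shows summable_l2_diff: "summable (\<lambda>n. (x n - y n)\<^sup>2)"
    and l2_norm_diff_triangle: "l2_norm (\<lambda>n. x n - y n) \<le> l2_norm x + l2_norm y"
  using summable_l2_add[of x "\<lambda>n. - y n"] l2_norm_triangle[of x "\<lambda>n. - y n"] assms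
  by (simp_all add: l2_norm_def)

section \<open>The quadratic shell nonlinearity\<close>

definition shell_nl :: "(nat \<Rightarrow> real) \<Rightarrow> (nat \<Rightarrow> real) \<Rightarrow> nat \<Rightarrow> real" where
  "shell_nl \<beta> a n = sqrt 2 * pi *
     ((case n of 0 \<Rightarrow> 0 | Suc m \<Rightarrow> 3 * \<beta> m * (a m)\<^sup>2) - \<beta> n * a n * a (Suc n))"

text \<open>Differentiability is asked of each component only: with unbounded rates the sequence of
  derivatives need not be square summable. Continuity in l2 is a clause of its own because
  componentwise derivatives alone do not control the tails.\<close>

definition shell_flow ::
    "(nat \<Rightarrow> real) \<Rightarrow> (nat \<Rightarrow> real) \<Rightarrow> ereal \<Rightarrow> (real \<Rightarrow> nat \<Rightarrow> real) \<Rightarrow> bool" where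
  "shell_flow \<beta> lam T a \<longleftrightarrow> (\<forall>t\<in>time_dom T.
     summable (\<lambda>n. (a t n)\<^sup>2) \<and>
     ((\<lambda>\<tau>. l2_norm (\<lambda>n. a \<tau> n - a t n)) \<longlongrightarrow> 0) (at t within time_dom T) \<and>
     (\<forall>n. ((\<lambda>\<tau>. a \<tau> n) has_real_derivative - lam n * a t n + shell_nl \<beta> (a t) n)
            (at t within time_dom T)))"

lemma shell_nl_diff_le:
  assumes \<beta>: "\<And>n. 0 \<le> \<beta> n" "\<And>n. \<beta> n \<le> 1"
  shows "\<bar>shell_nl \<beta> x n - shell_nl \<beta> y n\<bar> \<le> sqrt 2 * pi *
     (3 * (case n of 0 \<Rightarrow> 0 | Suc m \<Rightarrow> \<bar>x m - y m\<bar> * \<bar>x m + y m\<bar>) +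
      \<bar>x n - y n\<bar> * \<bar>x (Suc n)\<bar> + \<bar>y n\<bar> * \<bar>x (Suc n) - y (Suc n)\<bar>)"
proof -
  let ?P = "\<lambda>z. case n of 0 \<Rightarrow> 0 | Suc m \<Rightarrow> 3 * \<beta> m * (z m)\<^sup>2"
  have shrink: "\<bar>\<beta> m * r\<bar> \<le> \<bar>r\<bar>" for m and r :: real
    using \<beta>[of m] by (simp add: abs_mult mult_left_le_one_le)
  have 1: "\<bar>?P x - ?P y\<bar> \<le> 3 * (case n of 0 \<Rightarrow> 0 | Suc m \<Rightarrow> \<bar>x m - y m\<bar> * \<bar>x m + y m\<bar>)"
  proof (cases n)
    case (Suc m)
    have "?P x - ?P y = 3 * (\<beta> m * ((x m - y m) * (x m + y m)))"
      by (simp add: Suc algebra_simps power2_eq_square)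
    then show ?thesis
      using shrink[of m "(x m - y m) * (x m + y m)"] Suc by (simp add: abs_mult)
  qed simp
  have "\<beta> n * x n * x (Suc n) - \<beta> n * y n * y (Suc n)
      = \<beta> n * ((x n - y n) * x (Suc n) + y n * (x (Suc n) - y (Suc n)))"
    by (simp add: algebra_simps)
  then have 2: "\<bar>\<beta> n * x n * x (Suc n) - \<beta> n * y n * y (Suc n)\<bar>
      \<le> \<bar>x n - y n\<bar> * \<bar>x (Suc n)\<bar> + \<bar>y n\<bar> * \<bar>x (Suc n) - y (Suc n)\<bar>"
    using shrink[of n "(x n - y n) * x (Suc n) + y n * (x (Suc n) - y (Suc n))"]
      abs_triangle_ineq[of "(x n - y n) * x (Suc n)" "y n * (x (Suc n) - y (Suc n))"]
    by (simp add: abs_mult)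
  have "shell_nl \<beta> x n - shell_nl \<beta> y n
      = sqrt 2 * pi * ((?P x - ?P y) - (\<beta> n * x n * x (Suc n) - \<beta> n * y n * y (Suc n)))"
    by (simp add: shell_nl_def algebra_simps)
  then have "\<bar>shell_nl \<beta> x n - shell_nl \<beta> y n\<bar>
      = sqrt 2 * pi * \<bar>(?P x - ?P y) - (\<beta> n * x n * x (Suc n) - \<beta> n * y n * y (Suc n))\<bar>"
    by (simp add: abs_mult)
  also have "\<dots> \<le> sqrt 2 * pi *
     (3 * (case n of 0 \<Rightarrow> 0 | Suc m \<Rightarrow> \<bar>x m - y m\<bar> * \<bar>x m + y m\<bar>) +
      \<bar>x n - y n\<bar> * \<bar>x (Suc n)\<bar> + \<bar>y n\<bar> * \<bar>x (Suc n) - y (Suc n)\<bar>)"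
    using 1 2 by (intro mult_left_mono order_trans[OF abs_triangle_ineq4]) (linarith, simp)
  finally show ?thesis .
qed

text \<open>The quadratic term maps l2 into l1, which is why differences of solutions can be measured
  in l1 below.\<close>

lemma sum_shell_nl_diff_le:
  assumes \<beta>: "\<And>n. 0 \<le> \<beta> n" "\<And>n. \<beta> n \<le> 1"
    and x: "summable (\<lambda>n. (x n)\<^sup>2)" and y: "summable (\<lambda>n. (y n)\<^sup>2)"
  shows "(\<Sum>n<N. \<bar>shell_nl \<beta> x n - shell_nl \<beta> y n\<bar>)
    \<le> 4 * sqrt 2 * pi * l2_norm (\<lambda>n. x n - y n) * (l2_norm x + l2_norm y)"
proof -
  let ?d = "\<lambda>n. x n - y n"
  define D where "D = l2_norm ?d"
  note d = summable_l2_diff[OF x y] and s = summable_l2_add[OF x y]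
  have nn: "0 \<le> D" "0 \<le> l2_norm x" "0 \<le> l2_norm y"
    unfolding D_def by (intro l2_norm_nonneg d x y)+
  have D: "L2_set ?d A \<le> D" if "finite A" for A
    unfolding D_def by (intro L2_set_le_l2_norm d that)
  have shift: "L2_set (\<lambda>n. z (Suc n)) {..<N} \<le> l2_norm z" if "summable (\<lambda>n. (z n)\<^sup>2)" for z :: "nat \<Rightarrow> real" and N
  proof -
    have "L2_set (\<lambda>n. z (Suc n)) {..<N} = L2_set z (Suc ` {..<N})"
      unfolding L2_set_def by (subst sum.reindex) auto
    then show ?thesis using L2_set_le_l2_norm[OF that] by simp
  qed
  \<comment> \<open>The term from the shell below is an index shift; enlarging the range to
    \<open>Suc N\<close> makes the shift exact, the summand at index 0 being 0.\<close>
  have "(\<Sum>n<N. (case n of 0 \<Rightarrow> 0 | Suc m \<Rightarrow> \<bar>x m - y m\<bar> * \<bar>x m + y m\<bar>))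
      \<le> (\<Sum>n<Suc N. (case n of 0 \<Rightarrow> 0 | Suc m \<Rightarrow> \<bar>x m - y m\<bar> * \<bar>x m + y m\<bar>))"
    by (intro sum_mono2) (auto split: nat.split)
  also have "\<dots> = (\<Sum>m<N. \<bar>x m - y m\<bar> * \<bar>x m + y m\<bar>)"
    by (subst sum.lessThan_Suc_shift) simp
  also have "\<dots> \<le> L2_set ?d {..<N} * L2_set (\<lambda>n. x n + y n) {..<N}"
    by (rule L2_set_mult_ineq)
  also have "\<dots> \<le> D * (l2_norm x + l2_norm y)"
    using L2_set_le_l2_norm[OF s, of "{..<N}"] l2_norm_triangle[OF x y] D nn
    by (intro mult_mono) auto
  finally have 1: "(\<Sum>n<N. (case n of 0 \<Rightarrow> 0 | Suc m \<Rightarrow> \<bar>x m - y m\<bar> * \<bar>x m + y m\<bar>))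
     \<le> D * (l2_norm x + l2_norm y)" .
  have "(\<Sum>n<N. \<bar>x n - y n\<bar> * \<bar>x (Suc n)\<bar>) \<le> L2_set ?d {..<N} * L2_set (\<lambda>n. x (Suc n)) {..<N}"
    by (rule L2_set_mult_ineq)
  also have "\<dots> \<le> D * l2_norm x"
    using shift[OF x] D nn by (intro mult_mono) auto
  finally have 2: "(\<Sum>n<N. \<bar>x n - y n\<bar> * \<bar>x (Suc n)\<bar>) \<le> D * l2_norm x" .
  have "(\<Sum>n<N. \<bar>y n\<bar> * \<bar>x (Suc n) - y (Suc n)\<bar>)
      \<le> L2_set y {..<N} * L2_set (\<lambda>n. x (Suc n) - y (Suc n)) {..<N}"
    by (rule L2_set_mult_ineq)
  also have "\<dots> \<le> l2_norm y * D"
    using shift[OF d] L2_set_le_l2_norm[OF y] nn unfolding D_def by (intro mult_mono) auto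
  finally have 3: "(\<Sum>n<N. \<bar>y n\<bar> * \<bar>x (Suc n) - y (Suc n)\<bar>) \<le> l2_norm y * D" .
  have "(\<Sum>n<N. \<bar>shell_nl \<beta> x n - shell_nl \<beta> y n\<bar>) \<le> (\<Sum>n<N. sqrt 2 * pi *
     (3 * (case n of 0 \<Rightarrow> 0 | Suc m \<Rightarrow> \<bar>x m - y m\<bar> * \<bar>x m + y m\<bar>) +
      \<bar>x n - y n\<bar> * \<bar>x (Suc n)\<bar> + \<bar>y n\<bar> * \<bar>x (Suc n) - y (Suc n)\<bar>))"
    by (intro sum_mono shell_nl_diff_le \<beta>)
  also have "\<dots> = sqrt 2 * pi *
     (3 * (\<Sum>n<N. case n of 0 \<Rightarrow> 0 | Suc m \<Rightarrow> \<bar>x m - y m\<bar> * \<bar>x m + y m\<bar>) +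
      (\<Sum>n<N. \<bar>x n - y n\<bar> * \<bar>x (Suc n)\<bar>) + (\<Sum>n<N. \<bar>y n\<bar> * \<bar>x (Suc n) - y (Suc n)\<bar>))"
    by (simp only: sum.distrib sum_distrib_left[symmetric])
  also have "\<dots> \<le> sqrt 2 * pi * (3 * (D * (l2_norm x + l2_norm y)) + D * l2_norm x + l2_norm y * D)"
    using 1 2 3 by (intro mult_left_mono) auto
  also have "\<dots> = 4 * sqrt 2 * pi * D * (l2_norm x + l2_norm y)"
    by (simp add: algebra_simps)
  finally show ?thesis unfolding D_def .
qed

lemma sum_shell_nl_le:
  assumes \<beta>: "\<And>n. 0 \<le> \<beta> n" "\<And>n. \<beta> n \<le> 1" and x: "summable (\<lambda>n. (x n)\<^sup>2)"
  shows "(\<Sum>n<N. \<bar>shell_nl \<beta> x n\<bar>) \<le> 4 * sqrt 2 * pi * (l2_norm x)\<^sup>2"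
proof -
  have "shell_nl \<beta> (\<lambda>_. 0) n = 0" for n
    by (simp add: shell_nl_def split: nat.split)
  moreover have "l2_norm (\<lambda>_. 0) = 0" by (simp add: l2_norm_def)
  ultimately show ?thesis
    using sum_shell_nl_diff_le[where \<beta> = \<beta> and x = x and y = "\<lambda>_. 0" and N = N, OF \<beta> x]
    by (simp add: power2_eq_square mult.assoc)
qed

lemma tendsto_shell_nl:
  assumes "\<And>n. ((\<lambda>\<tau>. a \<tau> n) \<longlongrightarrow> b n) F"
  shows "((\<lambda>\<tau>. shell_nl \<beta> (a \<tau>) n) \<longlongrightarrow> shell_nl \<beta> b n) F"
  unfolding shell_nl_def by (cases n) (auto intro!: tendsto_intros assms)

lemma continuous_on_shell_nl:
  assumes "\<And>n. continuous_on S (\<lambda>\<tau>. a \<tau> n)"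
  shows "continuous_on S (\<lambda>\<tau>. shell_nl \<beta> (a \<tau>) n)"
  using assms unfolding continuous_on_def by (auto intro: tendsto_shell_nl)

text \<open>Shell \<open>n\<close> loses the flux \<open>\<beta> n * (x n)^2 * x (Suc n)\<close> and
  shell \<open>Suc n\<close> gains three times that, so a net 2 of each flux remains. The gain of
  shell \<open>Suc M\<close> lies outside the sum, which is the last term with its factor 3.\<close>

lemma sum_energy_production:
  fixes lam \<beta> x :: "nat \<Rightarrow> real"
  shows "(\<Sum>n<Suc M. 2 * x n * (- lam n * x n + shell_nl \<beta> x n))
    = - 2 * (\<Sum>n<Suc M. lam n * (x n)\<^sup>2)
      + 2 * sqrt 2 * pi * (2 * (\<Sum>n<Suc M. \<beta> n * (x n)\<^sup>2 * x (Suc n)) - 3 * \<beta> M * (x M)\<^sup>2 * x (Suc M))"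
proof (induction M)
  case 0
  show ?case by (simp add: shell_nl_def) algebra
next
  case (Suc M)
  have step: "- 2 * L + 2 * sqrt 2 * pi * (2 * P - 3 * \<beta> M * (x M)\<^sup>2 * x (Suc M))
      + 2 * x (Suc M) * (- lam (Suc M) * x (Suc M) + shell_nl \<beta> x (Suc M))
    = - 2 * (L + lam (Suc M) * (x (Suc M))\<^sup>2) + 2 * sqrt 2 * pi *
      (2 * (P + \<beta> (Suc M) * (x (Suc M))\<^sup>2 * x (Suc (Suc M)))
        - 3 * \<beta> (Suc M) * (x (Suc M))\<^sup>2 * x (Suc (Suc M)))" for L P
    by (simp add: shell_nl_def) algebra
  show ?case
    unfolding sum.lessThan_Suc[of _ "Suc M"] Suc.IH by (rule step)
qed

section \<open>Gronwall estimate for a shell flow\<close>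

context
  fixes \<beta> lam :: "nat \<Rightarrow> real" and T :: ereal and a :: "real \<Rightarrow> nat \<Rightarrow> real"
  assumes \<beta>: "\<And>n. 0 \<le> \<beta> n" "\<And>n. \<beta> n \<le> 1" and lam: "\<And>n. 0 \<le> lam n"
    and flow: "shell_flow \<beta> lam T a"
begin

lemma flow_summable: "t \<in> time_dom T \<Longrightarrow> summable (\<lambda>n. (a t n)\<^sup>2)"
  using flow unfolding shell_flow_def by blast

lemma flow_deriv: "t \<in> time_dom T \<Longrightarrow>
    ((\<lambda>\<tau>. a \<tau> n) has_real_derivative - lam n * a t n + shell_nl \<beta> (a t) n) (at t within time_dom T)"
  using flow unfolding shell_flow_def by blast

lemma flow_continuous: "continuous_on (time_dom T) (\<lambda>t. a t n)"
  unfolding continuous_on_eq_continuous_within using DERIV_continuous[OF flow_deriv] by blast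

lemma flow_bdd_above: "t \<in> time_dom T \<Longrightarrow> bdd_above (range (a t))"
  using abs_le_l2_norm[OF flow_summable] by (intro bdd_aboveI[of _ "l2_norm (a t)"]) (force simp: abs_le_iff)

text \<open>Square summability forces the entries to tend to 0, and the supremum dominates this
  limit. The sign lets \<open>\<beta> n\<close> be replaced by 1 in the energy flux and keeps the
  exponential weight at most 1.\<close>

lemma flow_SUP_nonneg:
  assumes t: "t \<in> time_dom T"
  shows "0 \<le> (SUP n. a t n)"
proof -
  have "(\<lambda>n. (a t n)\<^sup>2) \<longlonglongrightarrow> 0"
    by (rule summable_LIMSEQ_zero[OF flow_summable[OF t]])
  then have "(\<lambda>n. a t n) \<longlonglongrightarrow> 0" by simp
  moreover have "a t n \<le> (SUP n. a t n)" for n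
    by (rule cSUP_upper[OF _ flow_bdd_above[OF t]]) simp
  ultimately show ?thesis by (intro LIMSEQ_le_const2) auto
qed

text \<open>The supremum is 1-Lipschitz in the sup norm, which the l2 norm dominates.\<close>

lemma flow_SUP_continuous: "continuous_on (time_dom T) (\<lambda>t. SUP n. a t n)"
  unfolding continuous_on_def
proof
  fix t assume t: "t \<in> time_dom T"
  define d where "d = (\<lambda>\<tau>. l2_norm (\<lambda>n. a \<tau> n - a t n))"
  have lim: "(d \<longlongrightarrow> 0) (at t within time_dom T)"
    using flow t unfolding shell_flow_def d_def by blast
  have bound: "\<bar>(SUP n. a \<tau> n) - (SUP n. a t n)\<bar> \<le> d \<tau>" if \<tau>: "\<tau> \<in> time_dom T" for \<tau>
  proof -
    have *: "\<bar>a \<tau> n - a t n\<bar> \<le> d \<tau>" for n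
      unfolding d_def
      by (rule abs_le_l2_norm[of "\<lambda>n. a \<tau> n - a t n"]) (intro summable_l2_diff flow_summable t \<tau>)
    have "(SUP n. a \<tau> n) \<le> (SUP n. a t n) + d \<tau>"
    proof (rule cSUP_least)
      fix n
      show "a \<tau> n \<le> (SUP n. a t n) + d \<tau>"
        using *[of n] cSUP_upper[OF _ flow_bdd_above[OF t], of n] by auto
    qed simp
    moreover have "(SUP n. a t n) \<le> (SUP n. a \<tau> n) + d \<tau>"
    proof (rule cSUP_least)
      fix n
      show "a t n \<le> (SUP n. a \<tau> n) + d \<tau>"
        using *[of n] cSUP_upper[OF _ flow_bdd_above[OF \<tau>], of n] by auto
    qed simp
    ultimately show ?thesis by auto
  qed
  have "((\<lambda>\<tau>. (SUP n. a \<tau> n) - (SUP n. a t n)) \<longlongrightarrow> 0) (at t within time_dom T)"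
    by (rule tendsto_rabs_zero_cancel, rule tendsto_sandwich[OF _ _ tendsto_const lim])
      (use bound in \<open>auto simp: eventually_at intro: exI[of _ 1]\<close>)
  then show "((\<lambda>t. SUP n. a t n) \<longlongrightarrow> (SUP n. a t n)) (at t within time_dom T)"
    by (simp add: LIM_zero_iff)
qed

text \<open>Reverse triangle inequality and compactness of \<open>{0..t}\<close>. The bound later
  dominates the boundary fluxes.\<close>

lemma flow_l2_norm_bounded:
  assumes t: "t \<in> time_dom T"
  obtains R where "\<And>s. s \<in> {0..t} \<Longrightarrow> l2_norm (a s) \<le> R"
proof -
  have sub: "{0..t} \<subseteq> time_dom T" by (rule atLeastAtMost_subset_time_dom[OF t])
  have "continuous_on {0..t} (\<lambda>s. l2_norm (a s))"
    unfolding continuous_on_def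
  proof
    fix s assume "s \<in> {0..t}"
    then have s: "s \<in> time_dom T" using sub by blast
    have lim: "((\<lambda>\<tau>. l2_norm (\<lambda>n. a \<tau> n - a s n)) \<longlongrightarrow> 0) (at s within {0..t})"
      using flow s tendsto_within_subset[OF _ sub] unfolding shell_flow_def by blast
    have bound: "\<bar>l2_norm (a \<tau>) - l2_norm (a s)\<bar> \<le> l2_norm (\<lambda>n. a \<tau> n - a s n)"
      if "\<tau> \<in> {0..t}" for \<tau>
    proof -
      have \<tau>: "\<tau> \<in> time_dom T" using that sub by blast
      note d = summable_l2_diff[OF flow_summable[OF \<tau>] flow_summable[OF s]]
      show ?thesis
        using l2_norm_triangle[OF d flow_summable[OF s]] l2_norm_diff_triangle[OF flow_summable[OF \<tau>] d]
        by simp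
    qed
    have "((\<lambda>\<tau>. l2_norm (a \<tau>) - l2_norm (a s)) \<longlongrightarrow> 0) (at s within {0..t})"
      by (rule tendsto_rabs_zero_cancel, rule tendsto_sandwich[OF _ _ tendsto_const lim])
        (use bound in \<open>auto simp: eventually_at intro: exI[of _ 1]\<close>)
    then show "((\<lambda>s. l2_norm (a s)) \<longlongrightarrow> l2_norm (a s)) (at s within {0..t})"
      by (simp add: LIM_zero_iff)
  qed
  then have "bounded ((\<lambda>s. l2_norm (a s)) ` {0..t})"
    by (intro compact_imp_bounded compact_continuous_image) auto
  then show thesis
    using that unfolding bounded_iff by (metis abs_le_D1 imageI real_norm_def)
qed

text \<open>Gronwall with an integrating factor, on partial sums: \<open>exp (- c * G)\<close>
  cancels the growth term and leaves the boundary flux \<open>e N\<close>, whose time integral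
  vanishes as \<open>N\<close> grows. Taking the limit after integrating avoids differentiating the
  infinite sum.\<close>

theorem flow_energy_le:
  assumes t: "t \<in> time_dom T"
  shows "(\<Sum>n. (a t n)\<^sup>2) \<le> (\<Sum>n. (a 0 n)\<^sup>2) * exp (4 * sqrt 2 * pi * integral {0..t} (\<lambda>s. SUP n. a s n))"
proof -
  define c where "c = 4 * sqrt 2 * pi"
  have c: "0 < c" by (simp add: c_def)
  define g where "g = (\<lambda>s. SUP n. a s n)"
  define G where "G = (\<lambda>s. integral {0..s} g)"
  define y where "y = (\<lambda>N s. \<Sum>n<Suc N. (a s n)\<^sup>2)"
  \<comment> \<open>The boundary flux carries \<open>2 * sqrt 2 * pi * 3 = (3/2) * c\<close>; the
    absolute value covers either sign of the last entry.\<close>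
  define e where "e = (\<lambda>N s. (3/2) * c * (a s N)\<^sup>2 * \<bar>a s (Suc N)\<bar>)"
  have t0: "0 \<le> t" using t by simp
  have sub: "{0..t} \<subseteq> time_dom T" by (rule atLeastAtMost_subset_time_dom[OF t])
  have gc: "continuous_on {0..t} g"
    unfolding g_def using flow_SUP_continuous sub by (rule continuous_on_subset)
  have ac: "continuous_on {0..t} (\<lambda>s. a s n)" for n
    using flow_continuous sub by (rule continuous_on_subset)
  have g_upper: "a s n \<le> g s" "0 \<le> g s" if "s \<in> {0..t}" for s n
    unfolding g_def using sub that flow_SUP_nonneg cSUP_upper[OF _ flow_bdd_above] by blast+
  have G0: "0 \<le> G s" if "s \<in> {0..t}" for s
    unfolding G_def
    by (rule integral_nonneg) (use g_upper that gc in \<open>auto intro!: integrable_continuous_real intro: continuous_on_subset\<close>)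
  have dG: "(G has_real_derivative g s) (at s within {0..t})" if "s \<in> {0..t}" for s
    unfolding G_def by (rule integral_has_real_derivative[OF gc that])
  have y0: "0 \<le> y N s" for N s
    unfolding y_def by (intro sum_nonneg) auto
  have main: "y N t * exp (- c * G t) \<le> y N 0 + integral {0..t} (e N)" for N
  proof -
    define y' where "y' = (\<lambda>s. \<Sum>n<Suc N. 2 * a s n * (- lam n * a s n + shell_nl \<beta> (a s) n))"
    have dy: "(y N has_real_derivative y' s) (at s within {0..t})" if "s \<in> {0..t}" for s
    proof -
      have "((\<lambda>\<tau>. a \<tau> n) has_real_derivative - lam n * a s n + shell_nl \<beta> (a s) n) (at s within {0..t})" for n
        using DERIV_subset[OF flow_deriv sub] that sub by blast
      then show ?thesis
        unfolding y_def y'_def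
        by (intro DERIV_sum) (auto intro!: derivative_eq_intros)
    qed
    define z' where "z' = (\<lambda>s. (y' s - c * g s * y N s) * exp (- c * G s))"
    have "((\<lambda>s. y N s * exp (- c * G s)) has_real_derivative z' s) (at s within {0..t})"
      if "s \<in> {0..t}" for s
      unfolding z'_def
      by (rule derivative_eq_intros dy dG that refl)+ (simp add: algebra_simps)
    then have "(z' has_integral y N t * exp (- c * G t) - y N 0 * exp (- c * G 0)) {0..t}"
      by (intro fundamental_theorem_of_calculus[OF t0])
        (auto simp: has_real_derivative_iff_has_vector_derivative[symmetric])
    moreover have "(e N has_integral integral {0..t} (e N)) {0..t}"
      unfolding e_def
      by (intro integrable_integral integrable_continuous_real continuous_intros ac)
    moreover have "z' s \<le> e N s" if s: "s \<in> {0..t}" for s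
    proof -
      define P where "P = (\<Sum>n<Suc N. \<beta> n * (a s n)\<^sup>2 * a s (Suc n))"
      have "(\<Sum>n<Suc N. \<beta> n * (a s n)\<^sup>2 * a s (Suc n)) \<le> (\<Sum>n<Suc N. g s * (a s n)\<^sup>2)"
      proof (rule sum_mono)
        fix n
        have "\<beta> n * (a s n)\<^sup>2 * a s (Suc n) \<le> \<beta> n * (a s n)\<^sup>2 * g s"
          using g_upper[OF s] \<beta> by (intro mult_left_mono) auto
        \<comment> \<open>Replacing \<open>\<beta> n\<close> by 1 is allowed because
          \<open>g s\<close> is nonnegative.\<close>
        also have "\<dots> \<le> 1 * (a s n)\<^sup>2 * g s"
          using g_upper(2)[OF s] \<beta> by (intro mult_right_mono) auto
        finally show "\<beta> n * (a s n)\<^sup>2 * a s (Suc n) \<le> g s * (a s n)\<^sup>2" by (simp add: mult.commute)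
      qed
      also have "\<dots> = g s * y N s" unfolding y_def by (rule sum_distrib_left[symmetric])
      finally have 1: "P \<le> g s * y N s" unfolding P_def .
      have "- (3 * \<beta> N * (a s N)\<^sup>2 * a s (Suc N)) \<le> \<bar>3 * \<beta> N * (a s N)\<^sup>2 * a s (Suc N)\<bar>" by simp
      also have "\<dots> = \<beta> N * (3 * (a s N)\<^sup>2 * \<bar>a s (Suc N)\<bar>)" using \<beta>(1)[of N] by (simp add: abs_mult)
      also have "\<dots> \<le> 3 * (a s N)\<^sup>2 * \<bar>a s (Suc N)\<bar>"
        using \<beta>[of N] by (intro mult_left_le_one_le) auto
      finally have 2: "- (3 * \<beta> N * (a s N)\<^sup>2 * a s (Suc N)) \<le> 3 * (a s N)\<^sup>2 * \<bar>a s (Suc N)\<bar>" .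
      have 3: "0 \<le> (\<Sum>n<Suc N. lam n * (a s n)\<^sup>2)" using lam by (intro sum_nonneg) auto
      have "y' s \<le> 2 * sqrt 2 * pi * (2 * P - 3 * \<beta> N * (a s N)\<^sup>2 * a s (Suc N))"
        unfolding y'_def sum_energy_production P_def using 3 by linarith
      also have "\<dots> \<le> 2 * sqrt 2 * pi * (2 * (g s * y N s) + 3 * (a s N)\<^sup>2 * \<bar>a s (Suc N)\<bar>)"
        using 1 2 by (intro mult_left_mono) (linarith, simp)
      also have "\<dots> = c * g s * y N s + e N s" by (simp add: c_def e_def algebra_simps)
      finally have "y' s - c * g s * y N s \<le> e N s" by simp
      moreover have "0 \<le> e N s" unfolding e_def using c by simp
      moreover have "exp (- c * G s) \<le> 1" using G0[OF s] c by simp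
      ultimately show ?thesis
        unfolding z'_def
        by (intro order_trans[OF mult_right_mono mult_left_le]) auto
    qed
    ultimately have "y N t * exp (- c * G t) - y N 0 * exp (- c * G 0) \<le> integral {0..t} (e N)"
      by (rule has_integral_le)
    then show ?thesis by (simp add: G_def)
  qed
  obtain R where R: "\<And>s. s \<in> {0..t} \<Longrightarrow> l2_norm (a s) \<le> R"
    using flow_l2_norm_bounded[OF t] by blast
  \<comment> \<open>At each time the entries tend to 0, hence so does the flux; the l2 bound on
    \<open>{0..t}\<close> dominates it.\<close>
  have "(\<lambda>N. integral {0..t} (e N)) \<longlonglongrightarrow> integral {0..t} (\<lambda>_. 0)"
  proof (rule dominated_convergence(2))
    show "e N integrable_on {0..t}" for N
      unfolding e_def by (intro integrable_continuous_real continuous_intros ac)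
    show "(\<lambda>_. (3/2) * c * R\<^sup>2 * R) integrable_on {0..t}" by (rule integrable_const_ivl)
    show "norm (e N s) \<le> (3/2) * c * R\<^sup>2 * R" if s: "s \<in> {0..t}" for N s
    proof -
      have b: "\<bar>a s n\<bar> \<le> R" for n
        using abs_le_l2_norm[OF flow_summable, of s n] R[OF s] s sub by force
      have R0: "0 \<le> R" using b[of 0] by linarith
      have "(a s N)\<^sup>2 \<le> R\<^sup>2" using b[of N] by (meson abs_le_square_iff abs_ge_self order_trans)
      then have "(3/2) * c * (a s N)\<^sup>2 * \<bar>a s (Suc N)\<bar> \<le> (3/2) * c * R\<^sup>2 * R"
        using b c R0 by (intro mult_mono) auto
      moreover have "0 \<le> e N s" using c by (simp add: e_def)
      ultimately show ?thesis by (simp add: e_def)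
    qed
    show "(\<lambda>N. e N s) \<longlonglongrightarrow> 0" if s: "s \<in> {0..t}" for s
    proof -
      have "(\<lambda>n. (a s n)\<^sup>2) \<longlonglongrightarrow> 0"
        using s sub by (intro summable_LIMSEQ_zero flow_summable) blast
      then have l: "(\<lambda>n. a s n) \<longlonglongrightarrow> 0" by simp
      then have "(\<lambda>N. e N s) \<longlonglongrightarrow> (3/2) * c * 0\<^sup>2 * \<bar>0\<bar>"
        unfolding e_def by (intro tendsto_intros l LIMSEQ_Suc[OF l])
      then show ?thesis by simp
    qed
  qed
  then have e0: "(\<lambda>N. integral {0..t} (e N)) \<longlonglongrightarrow> 0" by simp
  have ylim: "(\<lambda>N. y N s) \<longlonglongrightarrow> (\<Sum>n. (a s n)\<^sup>2)" if "s \<in> time_dom T" for s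
    unfolding y_def using LIMSEQ_Suc[OF summable_LIMSEQ[OF flow_summable[OF that]]] .
  have "(\<Sum>n. (a t n)\<^sup>2) * exp (- c * G t) \<le> (\<Sum>n. (a 0 n)\<^sup>2) + 0"
  proof (rule LIMSEQ_le)
    show "(\<lambda>N. y N t * exp (- c * G t)) \<longlonglongrightarrow> (\<Sum>n. (a t n)\<^sup>2) * exp (- c * G t)"
      by (intro tendsto_intros ylim t)
    show "(\<lambda>N. y N 0 + integral {0..t} (e N)) \<longlonglongrightarrow> (\<Sum>n. (a 0 n)\<^sup>2) + 0"
      using sub t0 by (intro tendsto_intros ylim e0) auto
  qed (use main in blast)
  then have "(\<Sum>n. (a t n)\<^sup>2) \<le> (\<Sum>n. (a 0 n)\<^sup>2) * exp (c * G t)"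
    by (simp add: exp_minus field_simps)
  then show ?thesis by (simp add: c_def G_def g_def)
qed

end

section \<open>Continuation of bounded shell flows\<close>

lemma sum_shell_nl_le_finite:
  assumes \<beta>: "\<And>n. 0 \<le> \<beta> n" "\<And>n. \<beta> n \<le> 1" and x: "summable (\<lambda>n. (x n)\<^sup>2)"
    and R: "l2_norm x \<le> R" and A: "finite A"
  shows "(\<Sum>n\<in>A. \<bar>shell_nl \<beta> x n\<bar>) \<le> 4 * sqrt 2 * pi * R\<^sup>2"
proof -
  obtain N where N: "A \<subseteq> {..<N}" using A finite_nat_iff_bounded by blast
  have "(\<Sum>n\<in>A. \<bar>shell_nl \<beta> x n\<bar>) \<le> (\<Sum>n<N. \<bar>shell_nl \<beta> x n\<bar>)"
    using N by (intro sum_mono2) auto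
  also have "\<dots> \<le> 4 * sqrt 2 * pi * (l2_norm x)\<^sup>2"
    by (rule sum_shell_nl_le[where \<beta> = \<beta>, OF \<beta> x])
  also have "\<dots> \<le> 4 * sqrt 2 * pi * R\<^sup>2"
    using R l2_norm_nonneg[OF x] by (intro mult_left_mono power_mono) auto
  finally show ?thesis .
qed

lemma L2_set_abs: "L2_set (\<lambda>n. \<bar>f n\<bar>) A = L2_set f A"
  by (simp add: L2_set_def)

text \<open>Written with growing exponentials, the Duhamel identity gives
  \<open>\<bar>y n\<bar> \<le> \<bar>x n\<bar> + J n\<close> for any \<open>lam n \<ge> 0\<close>,
  since the exponential is largest at the right end. The l2 norm of \<open>J\<close> is below its l1
  norm, and the finite l1 sum commutes with the time integral. The resulting bound depends on
  neither \<open>lam\<close> nor \<open>A\<close>.\<close>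

lemma L2_set_duhamel_le:
  fixes x y :: "nat \<Rightarrow> real" and F :: "real \<Rightarrow> nat \<Rightarrow> real"
  assumes rs: "r \<le> s" and lam: "\<And>n. 0 \<le> lam n" and A: "finite A"
    and cont: "\<And>n. n \<in> A \<Longrightarrow> continuous_on {r..s} (\<lambda>\<tau>. F \<tau> n)"
    and eq: "\<And>n. n \<in> A \<Longrightarrow> exp (lam n * s) * y n
      = exp (lam n * r) * x n + integral {r..s} (\<lambda>\<tau>. exp (lam n * \<tau>) * F \<tau> n)"
    and bound: "\<And>\<tau>. \<tau> \<in> {r..s} \<Longrightarrow> (\<Sum>n\<in>A. \<bar>F \<tau> n\<bar>) \<le> K"
  shows "L2_set y A \<le> L2_set x A + K * (s - r)"
proof -
  define J where "J n = integral {r..s} (\<lambda>\<tau>. \<bar>F \<tau> n\<bar>)" for n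
  have i: "(\<lambda>\<tau>. \<bar>F \<tau> n\<bar>) integrable_on {r..s}" if "n \<in> A" for n
    by (intro integrable_continuous_real continuous_intros cont that)
  have J0: "0 \<le> J n" if "n \<in> A" for n
    unfolding J_def by (intro integral_nonneg i that) auto
  have pt: "\<bar>y n\<bar> \<le> \<bar>x n\<bar> + J n" if n: "n \<in> A" for n
  proof -
    have "\<bar>integral {r..s} (\<lambda>\<tau>. exp (lam n * \<tau>) * F \<tau> n)\<bar>
        \<le> integral {r..s} (\<lambda>\<tau>. exp (lam n * s) * \<bar>F \<tau> n\<bar>)"
      unfolding real_norm_def[symmetric]
    proof (rule integral_norm_bound_integral)
      show "(\<lambda>\<tau>. exp (lam n * \<tau>) * F \<tau> n) integrable_on {r..s}"
        by (intro integrable_continuous_real continuous_intros cont n)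
      show "(\<lambda>\<tau>. exp (lam n * s) * norm (F \<tau> n)) integrable_on {r..s}"
        by (intro integrable_continuous_real continuous_intros cont n)
      show "norm (exp (lam n * \<tau>) * F \<tau> n) \<le> exp (lam n * s) * norm (F \<tau> n)" if "\<tau> \<in> {r..s}" for \<tau>
        using that lam[of n] by (auto simp: abs_mult intro!: mult_right_mono mult_left_mono)
    qed
    also have "integral {r..s} (\<lambda>\<tau>. exp (lam n * s) * \<bar>F \<tau> n\<bar>) = exp (lam n * s) * J n" by (simp add: J_def)
    finally have 1: "\<bar>integral {r..s} (\<lambda>\<tau>. exp (lam n * \<tau>) * F \<tau> n)\<bar> \<le> exp (lam n * s) * J n" .
    have "exp (lam n * r) * \<bar>x n\<bar> \<le> exp (lam n * s) * \<bar>x n\<bar>"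
      using rs lam[of n] by (intro mult_right_mono) (auto intro: mult_left_mono)
    moreover have "exp (lam n * s) * \<bar>y n\<bar> = \<bar>exp (lam n * s) * y n\<bar>" by (simp add: abs_mult)
    moreover have "\<bar>exp (lam n * s) * y n\<bar> \<le> exp (lam n * r) * \<bar>x n\<bar> + exp (lam n * s) * J n"
      unfolding eq[OF n] using 1 abs_triangle_ineq[of "exp (lam n * r) * x n"
        "integral {r..s} (\<lambda>\<tau>. exp (lam n * \<tau>) * F \<tau> n)"]
      by (simp add: abs_mult)
    ultimately have "exp (lam n * s) * \<bar>y n\<bar> \<le> exp (lam n * s) * (\<bar>x n\<bar> + J n)"
      by (simp add: algebra_simps)
    then show ?thesis by simp
  qed
  have "L2_set y A = L2_set (\<lambda>n. \<bar>y n\<bar>) A" by (simp add: L2_set_abs)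
  also have "\<dots> \<le> L2_set (\<lambda>n. \<bar>x n\<bar> + J n) A"
    by (intro L2_set_mono pt) auto
  also have "\<dots> \<le> L2_set (\<lambda>n. \<bar>x n\<bar>) A + L2_set J A"
    by (rule L2_set_triangle_ineq)
  also have "\<dots> \<le> L2_set x A + (\<Sum>n\<in>A. J n)"
    by (simp add: L2_set_abs L2_set_le_sum J0)
  also have "(\<Sum>n\<in>A. J n) = integral {r..s} (\<lambda>\<tau>. \<Sum>n\<in>A. \<bar>F \<tau> n\<bar>)"
    unfolding J_def by (rule integral_sum[symmetric]) (use A i in auto)
  also have "\<dots> \<le> integral {r..s} (\<lambda>_. K)"
    using bound i A by (intro integral_le integrable_sum integrable_const_ivl) auto
  also have "\<dots> = K * (s - r)" using rs by simp
  finally show ?thesis by simp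
qed

lemma duhamel_of_deriv:
  fixes f :: "real \<Rightarrow> real"
  assumes "r \<le> s" and "\<And>t. t \<in> {r..s} \<Longrightarrow> (f has_real_derivative - l * f t + F t) (at t within {r..s})"
  shows "exp (l * s) * f s = exp (l * r) * f r + integral {r..s} (\<lambda>\<tau>. exp (l * \<tau>) * F \<tau>)"
proof -
  have "((\<lambda>\<tau>. exp (l * \<tau>) * f \<tau>) has_real_derivative exp (l * t) * F t) (at t within {r..s})"
    if "t \<in> {r..s}" for t
    by (rule derivative_eq_intros assms that refl)+ (simp add: algebra_simps)
  then have "((\<lambda>\<tau>. exp (l * \<tau>) * F \<tau>) has_integral exp (l * s) * f s - exp (l * r) * f r) {r..s}"
    by (intro fundamental_theorem_of_calculus[OF assms(1)])
      (auto simp: has_real_derivative_iff_has_vector_derivative[symmetric])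
  then show ?thesis by (simp add: integral_unique)
qed

lemma deriv_of_duhamel:
  fixes f :: "real \<Rightarrow> real"
  assumes F: "continuous_on {0..s} F" and t: "t \<in> {0..s}"
    and eq: "\<And>t. t \<in> {0..s} \<Longrightarrow> exp (l * t) * f t = c + integral {0..t} (\<lambda>\<tau>. exp (l * \<tau>) * F \<tau>)"
  shows "(f has_real_derivative - l * f t + F t) (at t within {0..s})"
proof -
  define P where "P = (\<lambda>t. integral {0..t} (\<lambda>\<tau>. exp (l * \<tau>) * F \<tau>))"
  have f: "f t = exp (- l * t) * (c + P t)" if "t \<in> {0..s}" for t
    using eq[OF that] by (simp add: P_def exp_minus field_simps)
  have "(P has_real_derivative exp (l * t) * F t) (at t within {0..s})"
    unfolding P_def by (rule integral_has_real_derivative[OF _ t]) (intro continuous_intros F)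
  then have "((\<lambda>t. exp (- l * t) * (c + P t)) has_real_derivative - l * f t + F t) (at t within {0..s})"
    unfolding f[OF t]
    by - ((rule derivative_eq_intros refl | assumption)+, simp add: algebra_simps exp_minus)
  then show ?thesis
    by (rule has_field_derivative_transform_within[OF _ zero_less_one t]) (simp add: f)
qed

text \<open>Continuity in l2 is automatic once the scalar equations hold with a uniform l2 bound:
  Duhamel controls the tails, and finitely many components are continuous anyway.\<close>

lemma shell_flowI:
  fixes a :: "real \<Rightarrow> nat \<Rightarrow> real"
  assumes \<beta>: "\<And>n. 0 \<le> \<beta> n" "\<And>n. \<beta> n \<le> 1" and lam: "\<And>n. 0 \<le> lam n"
    and sm: "\<And>t. t \<in> time_dom T \<Longrightarrow> summable (\<lambda>n. (a t n)\<^sup>2)"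
    and R: "\<And>t. t \<in> time_dom T \<Longrightarrow> l2_norm (a t) \<le> R"
    and deriv: "\<And>t n. t \<in> time_dom T \<Longrightarrow>
      ((\<lambda>\<tau>. a \<tau> n) has_real_derivative - lam n * a t n + shell_nl \<beta> (a t) n) (at t within time_dom T)"
  shows "shell_flow \<beta> lam T a"
  unfolding shell_flow_def
proof (intro ballI conjI allI sm deriv)
  fix t0 assume t0: "t0 \<in> time_dom T"
  define K where "K = 4 * sqrt 2 * pi * R\<^sup>2"
  have K0: "0 \<le> K" by (simp add: K_def)
  have cont: "continuous_on (time_dom T) (\<lambda>t. a t n)" for n
    unfolding continuous_on_eq_continuous_within using DERIV_continuous[OF deriv] by blast
  have tail: "L2_set (a s) A \<le> L2_set (a r) A + K * (s - r)"
    if rs: "r \<le> s" "r \<in> time_dom T" "s \<in> time_dom T" "finite A" for r s A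
  proof (rule L2_set_duhamel_le[where lam = lam and F = "\<lambda>\<tau>. shell_nl \<beta> (a \<tau>)"])
    have sub: "{r..s} \<subseteq> time_dom T"
      using rs atLeastAtMost_subset_time_dom[OF rs(3)] by auto
    show "continuous_on {r..s} (\<lambda>\<tau>. shell_nl \<beta> (a \<tau>) n)" for n
      by (intro continuous_on_shell_nl continuous_on_subset[OF cont sub])
    show "exp (lam n * s) * a s n
      = exp (lam n * r) * a r n + integral {r..s} (\<lambda>\<tau>. exp (lam n * \<tau>) * shell_nl \<beta> (a \<tau>) n)" for n
      by (rule duhamel_of_deriv[OF rs(1), where f = "\<lambda>t. a t n"]) (use deriv DERIV_subset sub in blast)
    show "(\<Sum>n\<in>A. \<bar>shell_nl \<beta> (a \<tau>) n\<bar>) \<le> K" if "\<tau> \<in> {r..s}" for \<tau>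
      unfolding K_def using that sub by (intro sum_shell_nl_le_finite \<beta> sm R \<open>finite A\<close>) blast+
  qed (use that lam in auto)
  show "((\<lambda>\<tau>. l2_norm (\<lambda>n. a \<tau> n - a t0 n)) \<longlongrightarrow> 0) (at t0 within time_dom T)"
  proof (rule tendstoI)
    fix \<epsilon> :: real assume \<epsilon>: "0 < \<epsilon>"
    \<comment> \<open>At most \<open>2 * \<eta>\<close> elapses between \<open>r\<close> and the
      times considered, so the tails grow by at most \<open>\<epsilon> / 8\<close>; the
      \<open>+ 1\<close> covers \<open>K = 0\<close>.\<close>
    define \<eta> where "\<eta> = \<epsilon> / (16 * (K + 1))"
    have \<eta>: "0 < \<eta>" "2 * K * \<eta> \<le> \<epsilon> / 8"
      using \<epsilon> K0 by (auto simp: \<eta>_def field_simps)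
    \<comment> \<open>Duhamel propagates forward only. A small tail is therefore fixed at a time
      before \<open>t0\<close> (or at 0) and controls all nearby times on both sides of
      \<open>t0\<close>.\<close>
    define r where "r = max 0 (t0 - \<eta>)"
    have r: "r \<in> time_dom T" "r \<le> t0"
      using t0 \<eta>(1) by (auto simp: r_def max_def intro: le_less_trans[where y = "ereal t0"])
    have "\<exists>N. \<forall>m\<ge>N. \<forall>n. norm (\<Sum>i=m..<n. (a r i)\<^sup>2) < (\<epsilon>/8)\<^sup>2"
      using sm[OF r(1)] \<epsilon> unfolding summable_Cauchy by (meson zero_less_power divide_pos_pos zero_less_numeral)
    then obtain N where N: "\<And>m. (\<Sum>i=N..<m. (a r i)\<^sup>2) < (\<epsilon>/8)\<^sup>2"
      by (force simp: abs_less_iff)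
    have tr: "L2_set (a r) {N..<m} \<le> \<epsilon> / 8" for m
      unfolding L2_set_def using N[of m] \<epsilon> by (intro real_le_lsqrt) (auto simp: sum_nonneg)
    have ts: "L2_set (a s) {N..<m} \<le> \<epsilon> / 4" if s: "s \<in> time_dom T" "\<bar>s - t0\<bar> < \<eta>" for s m
    proof -
      have "r \<le> s" "s - r \<le> 2 * \<eta>" using s by (auto simp: r_def)
      moreover have "K * (s - r) \<le> K * (2 * \<eta>)"
        using calculation K0 by (intro mult_left_mono) auto
      ultimately show ?thesis
        using tail[of r s "{N..<m}"] r(1) s(1) tr[of m] \<eta>(2) by simp
    qed
    have "((\<lambda>\<tau>. sqrt (\<Sum>n<N. (a \<tau> n - a t0 n)\<^sup>2)) \<longlongrightarrow> sqrt (\<Sum>n<N. (a t0 n - a t0 n)\<^sup>2)) (at t0 within time_dom T)"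
      using cont t0 unfolding continuous_on_def by (intro tendsto_intros) blast
    then have "\<forall>\<^sub>F \<tau> in at t0 within time_dom T. L2_set (\<lambda>n. a \<tau> n - a t0 n) {..<N} < \<epsilon> / 4"
      using \<epsilon> unfolding L2_set_def by (intro order_tendstoD(2)) auto
    moreover have "\<forall>\<^sub>F \<tau> in at t0 within time_dom T. \<tau> \<in> time_dom T \<and> \<bar>\<tau> - t0\<bar> < \<eta>"
      using \<eta>(1) unfolding eventually_at by (auto simp: dist_real_def)
    ultimately show "\<forall>\<^sub>F \<tau> in at t0 within time_dom T. dist (l2_norm (\<lambda>n. a \<tau> n - a t0 n)) 0 < \<epsilon>"
    proof eventually_elim
      case (elim \<tau>)
      let ?d = "\<lambda>n. a \<tau> n - a t0 n"
      \<comment> \<open>Budget: \<open>\<epsilon> / 4\<close> for each of the two tails and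
        \<open>\<epsilon> / 4\<close> for the head.\<close>
      have "L2_set ?d {..<m} \<le> 3/4 * \<epsilon>" for m
      proof -
        have "L2_set ?d {N..<m} \<le> L2_set (a \<tau>) {N..<m} + L2_set (a t0) {N..<m}"
          using L2_set_triangle_ineq[of "a \<tau>" "\<lambda>n. - a t0 n" "{N..<m}"] by (simp add: L2_set_def)
        also have "\<dots> \<le> \<epsilon>/4 + \<epsilon>/4"
          using elim t0 \<eta>(1) by (intro add_mono ts) auto
        finally have 1: "L2_set ?d {N..<m} \<le> \<epsilon>/2" by simp
        have "(\<Sum>n<m. (?d n)\<^sup>2) \<le> (\<Sum>n\<in>{..<N} \<union> {N..<m}. (?d n)\<^sup>2)"
          by (intro sum_mono2) auto
        also have "\<dots> = (\<Sum>n<N. (?d n)\<^sup>2) + (\<Sum>n=N..<m. (?d n)\<^sup>2)"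
          by (rule sum.union_disjoint) auto
        finally have "L2_set ?d {..<m} \<le> sqrt ((\<Sum>n<N. (?d n)\<^sup>2) + (\<Sum>n=N..<m. (?d n)\<^sup>2))"
          unfolding L2_set_def by (rule real_sqrt_le_mono)
        also have "\<dots> \<le> L2_set ?d {..<N} + L2_set ?d {N..<m}"
          unfolding L2_set_def by (intro sqrt_add_le_add_sqrt sum_nonneg) auto
        finally show ?thesis using 1 elim by linarith
      qed
      note * = l2_normI[OF this]
      then show ?case using \<epsilon> l2_norm_nonneg[OF *(1)] by (simp add: dist_real_def)
    qed
  qed
qed

text \<open>Distinct numbers are at distance at least 1, so this metric induces the discrete
  topology. It makes \<open>real \<times> nat\<close> a metric space, and the real-valued bounded
  continuous functions on it are the complete space of the fixed point argument.\<close>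

instantiation nat :: metric_space
begin
definition dist_nat :: "nat \<Rightarrow> nat \<Rightarrow> real" where "dist_nat m n = \<bar>real m - real n\<bar>"
definition uniformity_nat :: "(nat \<times> nat) filter" where
  "uniformity_nat = (INF e\<in>{0<..}. principal {(x, y). dist x y < e})"
instance
proof
  show "uniformity = (INF e\<in>{0<..}. principal {(x, y :: nat). dist x y < e})"
    by (rule uniformity_nat_def)
  show "open U \<longleftrightarrow> (\<forall>x\<in>U. \<forall>\<^sub>F (x', y) in uniformity. x' = x \<longrightarrow> y \<in> U)" for U :: "nat set"
  proof -
    have "\<forall>\<^sub>F (x', y) in uniformity. x' = x \<longrightarrow> y \<in> U" if "x \<in> U" for x
    proof -
      have "\<forall>\<^sub>F z in uniformity. z \<in> {(x, y :: nat). dist x y < 1/2}"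
        unfolding uniformity_nat_def by (rule eventually_INF1[of "1/2"]) (auto simp: eventually_principal)
      moreover have "y = x" if "dist x y < 1/2" for x y :: nat
        using that unfolding dist_nat_def by linarith
      ultimately show ?thesis
        by (elim eventually_mono) (use that in \<open>auto\<close>)
    qed
    then show ?thesis by (auto simp: open_discrete)
  qed
qed (auto simp: dist_nat_def)
end

section \<open>Continuation by a contraction\<close>

lemma continuous_on_real_nat:
  fixes F :: "real \<times> nat \<Rightarrow> 'b::topological_space"
  assumes "\<And>n. continuous_on UNIV (\<lambda>t. F (t, n))"
  shows "continuous_on UNIV F"
proof -
  have "continuous_on (\<Union>n. UNIV \<times> {n}) F"
  proof (rule continuous_on_open_UN)
    show "open (UNIV \<times> {n} :: (real \<times> nat) set)" for n
      by (intro open_Times open_UNIV open_discrete)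
    show "continuous_on (UNIV \<times> {n}) F" for n
    proof (rule continuous_on_eq)
      show "continuous_on (UNIV \<times> {n}) ((\<lambda>t. F (t, n)) \<circ> fst)"
        by (intro continuous_on_compose continuous_on_subset[OF assms] continuous_on_fst continuous_on_id) auto
    qed auto
  qed
  moreover have "(\<Union>n. UNIV \<times> {n}) = (UNIV :: (real \<times> nat) set)" by auto
  ultimately show ?thesis by simp
qed

lemma L2_set_tendsto:
  assumes "\<And>n. n \<in> A \<Longrightarrow> (\<lambda>k. f k n) \<longlonglongrightarrow> g n"
  shows "(\<lambda>k. L2_set (f k) A) \<longlonglongrightarrow> L2_set g A"
  unfolding L2_set_def by (intro tendsto_intros assms)

text \<open>The fixed point is sought among bounded continuous functions of time and index with the
  sup metric, not among curves in l2: the l2 bound is a closed side condition on finite sections,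
  and continuity in l2 is recovered afterwards by \<open>shell_flowI\<close>. Working on the whole
  interval with the past prescribed avoids gluing derivatives at \<open>T\<close>.\<close>

theorem flow_extend:
  fixes T :: real and a :: "real \<Rightarrow> nat \<Rightarrow> real"
  assumes \<beta>: "\<And>n. 0 \<le> \<beta> n" "\<And>n. \<beta> n \<le> 1" and lam: "\<And>n. 0 \<le> lam n" and T: "0 < T"
    and flow: "shell_flow \<beta> lam (ereal T) a"
    and bounded: "\<And>t. t \<in> time_dom (ereal T) \<Longrightarrow> l2_norm (a t) \<le> R"
  obtains T' b where "T < T'" "shell_flow \<beta> lam (ereal T') b" "\<And>t. t \<in> time_dom (ereal T) \<Longrightarrow> b t = a t"
proof -
  have dom: "time_dom (ereal T) = {0..<T}" by (auto simp: time_dom_def)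
  have sm: "summable (\<lambda>n. (a t n)\<^sup>2)" if "t \<in> {0..<T}" for t
    using flow_summable[OF \<beta> lam flow] that dom by blast
  have deriv: "((\<lambda>\<tau>. a \<tau> n) has_real_derivative - lam n * a t n + shell_nl \<beta> (a t) n) (at t within {0..<T})"
    if "t \<in> {0..<T}" for t n
    using flow_deriv[OF \<beta> lam flow, of t n] that dom by simp
  have bd: "l2_norm (a t) \<le> R" if "t \<in> {0..<T}" for t using bounded that dom by blast
  have R0: "0 \<le> R" using l2_norm_nonneg[OF sm, of 0] bd[of 0] T by simp
  have "\<exists>g. continuous_on {0..T} g \<and> (\<forall>t\<in>{0..<T}. g t = a t n)" for n
  proof -
    \<comment> \<open>A bound for the derivative of component \<open>n\<close> on all of
      \<open>{0..<T}\<close>; it may depend on \<open>n\<close>, since the extension to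
      \<open>T\<close> is made component by component.\<close>
    define L where "L = lam n * R + 4 * sqrt 2 * pi * R\<^sup>2"
    have L0: "0 \<le> L" using lam R0 by (simp add: L_def)
    have "norm (a x n - a y n) \<le> L * norm (x - y)" if "x \<in> {0..<T}" "y \<in> {0..<T}" for x y
    proof (rule field_differentiable_bound[of "{0..<T}" "\<lambda>t. a t n"])
      fix z assume z: "z \<in> {0..<T}"
      have "\<bar>a z n\<bar> \<le> R" using abs_le_l2_norm[OF sm[OF z], of n] bd[OF z] by linarith
      moreover have "\<bar>shell_nl \<beta> (a z) n\<bar> \<le> 4 * sqrt 2 * pi * R\<^sup>2"
        using sum_shell_nl_le_finite[where A = "{n}", OF \<beta> sm[OF z] bd[OF z]] by simp
      moreover have "lam n * \<bar>a z n\<bar> \<le> lam n * R"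
        using calculation(1) lam by (intro mult_left_mono)
      moreover have "norm (- lam n * a z n + shell_nl \<beta> (a z) n) \<le> lam n * \<bar>a z n\<bar> + \<bar>shell_nl \<beta> (a z) n\<bar>"
        using abs_triangle_ineq[of "- lam n * a z n"] lam[of n] by (simp add: abs_mult)
      ultimately show "norm (- lam n * a z n + shell_nl \<beta> (a z) n) \<le> L"
        unfolding L_def by linarith
    qed (use deriv that in auto)
    then have "uniformly_continuous_on {0..<T} (\<lambda>t. a t n)"
      using L0 by (intro lipschitz_on_uniformly_continuous[of L] lipschitz_onI) (auto simp: dist_norm)
    then obtain g where "uniformly_continuous_on (closure {0..<T}) g" "\<And>t. t \<in> {0..<T} \<Longrightarrow> a t n = g t"
      using uniformly_continuous_on_extension_on_closure by metis
    then show ?thesis using T by (auto dest: uniformly_continuous_imp_continuous)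
  qed
  then have "\<forall>n. \<exists>g. continuous_on {0..T} g \<and> (\<forall>t\<in>{0..<T}. g t = a t n)" by blast
  from choice[OF this] obtain g where g: "\<forall>n. continuous_on {0..T} (g n) \<and> (\<forall>t\<in>{0..<T}. g n t = a t n)"
    by blast
  obtain abar where abar_cont: "\<And>n. continuous_on {0..T} (\<lambda>t. abar t n)"
      and abar_eq: "\<And>t n. t \<in> {0..<T} \<Longrightarrow> abar t n = a t n"
    using g by (intro that[of "\<lambda>t n. g n t"]) auto
  have cl: "closure {0..<T} = {0..T}" using T by simp
  \<comment> \<open>Only finite sections are carried to the limit \<open>t = T\<close>, so
    convergence of each component is enough.\<close>
  have abar_L2: "L2_set (abar t) {..<N} \<le> R" if t: "t \<in> {0..T}" for t N
  proof (rule continuous_le_on_closure[of "{0..<T}" "\<lambda>t. L2_set (abar t) {..<N}"])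
    show "continuous_on (closure {0..<T}) (\<lambda>t. L2_set (abar t) {..<N})"
      unfolding cl L2_set_def by (intro continuous_intros abar_cont)
    fix s assume s: "s \<in> {0..<T}"
    then have "abar s = a s" using abar_eq by blast
    then show "L2_set (abar s) {..<N} \<le> R"
      using L2_set_le_l2_norm[OF sm[OF s], of "{..<N}"] bd[OF s] by simp
  qed (use t cl in auto)
  have nlc: "continuous_on {0..T} (\<lambda>\<tau>. exp (lam n * \<tau>) * shell_nl \<beta> (abar \<tau>) n)" for n
    by (intro continuous_intros continuous_on_shell_nl abar_cont)
  have abar_duhamel: "exp (lam n * t) * abar t n
      = abar 0 n + integral {0..t} (\<lambda>\<tau>. exp (lam n * \<tau>) * shell_nl \<beta> (abar \<tau>) n)" if t: "t \<in> {0..T}" for t n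
  proof -
    have "exp (lam n * t) * abar t n - integral {0..t} (\<lambda>\<tau>. exp (lam n * \<tau>) * shell_nl \<beta> (abar \<tau>) n) = abar 0 n"
    proof (rule continuous_constant_on_closure[of "{0..<T}" "\<lambda>t. exp (lam n * t) * abar t n
          - integral {0..t} (\<lambda>\<tau>. exp (lam n * \<tau>) * shell_nl \<beta> (abar \<tau>) n)"])
      show "continuous_on (closure {0..<T}) (\<lambda>t. exp (lam n * t) * abar t n
          - integral {0..t} (\<lambda>\<tau>. exp (lam n * \<tau>) * shell_nl \<beta> (abar \<tau>) n))"
        unfolding cl
        by (intro continuous_intros abar_cont indefinite_integral_continuous_1 integrable_continuous_real nlc)
      fix s assume s: "s \<in> {0..<T}"
      have e: "abar \<tau> = a \<tau>" if "\<tau> \<in> {0..s}" for \<tau> using abar_eq that s by force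
      have "exp (lam n * s) * a s n = exp (lam n * 0) * a 0 n
          + integral {0..s} (\<lambda>\<tau>. exp (lam n * \<tau>) * shell_nl \<beta> (a \<tau>) n)"
      proof (rule duhamel_of_deriv[where f = "\<lambda>t. a t n"])
        fix t assume "t \<in> {0..s}"
        then show "((\<lambda>t. a t n) has_real_derivative - lam n * a t n + shell_nl \<beta> (a t) n) (at t within {0..s})"
          using s by (intro DERIV_subset[OF deriv]) auto
      qed (use s in auto)
      moreover have "integral {0..s} (\<lambda>\<tau>. exp (lam n * \<tau>) * shell_nl \<beta> (abar \<tau>) n)
          = integral {0..s} (\<lambda>\<tau>. exp (lam n * \<tau>) * shell_nl \<beta> (a \<tau>) n)"
        by (rule integral_cong) (simp add: e)
      ultimately show "exp (lam n * s) * abar s n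
          - integral {0..s} (\<lambda>\<tau>. exp (lam n * \<tau>) * shell_nl \<beta> (abar \<tau>) n) = abar 0 n"
        using e[of s] e[of 0] s by simp
    qed (use t cl in auto)
    then show ?thesis by simp
  qed
  \<comment> \<open>Within time \<open>\<delta>\<close> the l2 norm grows by at most 1/4, staying
    below \<open>R + 1\<close>, and the Lipschitz constant \<open>8 * sqrt 2 * pi * (R + 1)\<close>
    integrates to at most 1/2, by \<open>R + 1 \<le> (R + 1)^2\<close>.\<close>
  define \<delta> where "\<delta> = 1 / (16 * sqrt 2 * pi * (R + 1)\<^sup>2)"
  have \<delta>: "0 < \<delta>" "16 * sqrt 2 * pi * (R + 1)\<^sup>2 * \<delta> = 1" using R0 by (auto simp: \<delta>_def)
  define S where "S = {f :: (real \<times> nat) \<Rightarrow>\<^sub>C real. (\<forall>t n. t \<in> {0..T} \<longrightarrow> f (t, n) = abar t n) \<and>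
     (\<forall>t N. L2_set (\<lambda>n. f (t, n)) {..<N} \<le> R + 1)}"
  \<comment> \<open>Freezing time outside \<open>{0..T + \<delta>}\<close> turns the Duhamel map
    into a bounded continuous function on the whole line, where the members of \<open>S\<close>
    live.\<close>
  define clamp where "clamp t = max 0 (min t (T + \<delta>))" for t
  define D where "D f t n = exp (- lam n * t) * (abar 0 n
      + integral {0..t} (\<lambda>\<tau>. exp (lam n * \<tau>) * shell_nl \<beta> (\<lambda>m. apply_bcontfun f (\<tau>, m)) n))" for f t n
  define \<Phi> where "\<Phi> f = Bcontfun (\<lambda>(t, n). D f (clamp t) n)" for f
  have clamp: "clamp t \<in> {0..T + \<delta>}" for t using T \<delta> by (auto simp: clamp_def)
  have Fc: "continuous_on X (\<lambda>\<tau>. apply_bcontfun f (\<tau>, n))" for X f n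
    by (intro continuous_on_compose2[OF continuous_on_apply_bcontfun[of UNIV f]] continuous_intros) auto
  have Fnl: "continuous_on X (\<lambda>\<tau>. shell_nl \<beta> (\<lambda>m. apply_bcontfun f (\<tau>, m)) n)" for X f n
    by (rule continuous_on_shell_nl) (rule Fc)
  have D_duhamel: "exp (lam n * t) * D f t n = abar 0 n
      + integral {0..t} (\<lambda>\<tau>. exp (lam n * \<tau>) * shell_nl \<beta> (\<lambda>m. apply_bcontfun f (\<tau>, m)) n)" for f t n
    by (simp add: D_def exp_minus)
  have in_S: "summable (\<lambda>n. (apply_bcontfun f (t, n))\<^sup>2)" "l2_norm (\<lambda>n. apply_bcontfun f (t, n)) \<le> R + 1"
    "\<bar>apply_bcontfun f (t, n)\<bar> \<le> R + 1"
    if f: "f \<in> S" for f t n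
  proof -
    have *: "L2_set (\<lambda>n. f (t, n)) {..<N} \<le> R + 1" for N using f by (simp add: S_def)
    show **: "summable (\<lambda>n. (apply_bcontfun f (t, n))\<^sup>2)" "l2_norm (\<lambda>n. apply_bcontfun f (t, n)) \<le> R + 1"
      using l2_normI[OF *] by auto
    show "\<bar>apply_bcontfun f (t, n)\<bar> \<le> R + 1"
      using abs_le_l2_norm[OF **(1), of n] **(2) by linarith
  qed
  \<comment> \<open>Up to \<open>T\<close> every member of \<open>S\<close> equals
    \<open>abar\<close>, which solves the integral equation, so the past is reproduced.\<close>
  have D_abar: "D f t n = abar t n" if f: "f \<in> S" and t: "t \<in> {0..T}" for f t n
  proof -
    have "exp (lam n * t) * D f t n = exp (lam n * t) * abar t n"
      unfolding D_duhamel abar_duhamel[OF t]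
      by (rule arg_cong2[where f = "(+)"], simp, rule integral_cong) (use f t in \<open>simp add: S_def\<close>)
    then show ?thesis by simp
  qed
  \<comment> \<open>Restarting at \<open>T\<close> means that the estimates see only the short time
    \<open>t - T \<le> \<delta>\<close>.\<close>
  have D_split: "exp (lam n * t) * D f t n = exp (lam n * T) * D f T n
      + integral {T..t} (\<lambda>\<tau>. exp (lam n * \<tau>) * shell_nl \<beta> (\<lambda>m. apply_bcontfun f (\<tau>, m)) n)"
    if "T \<le> t" for f t n
  proof -
    have "integral {0..T} (\<lambda>\<tau>. exp (lam n * \<tau>) * shell_nl \<beta> (\<lambda>m. apply_bcontfun f (\<tau>, m)) n)
        + integral {T..t} (\<lambda>\<tau>. exp (lam n * \<tau>) * shell_nl \<beta> (\<lambda>m. apply_bcontfun f (\<tau>, m)) n)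
        = integral {0..t} (\<lambda>\<tau>. exp (lam n * \<tau>) * shell_nl \<beta> (\<lambda>m. apply_bcontfun f (\<tau>, m)) n)"
      using that T by (intro Henstock_Kurzweil_Integration.integral_combine integrable_continuous_real
          continuous_intros Fnl) auto
    then show ?thesis unfolding D_duhamel by simp
  qed
  have D_L2: "L2_set (D f t) {..<N} \<le> R + 1" if f: "f \<in> S" and t: "t \<in> {0..T + \<delta>}" for f t N
  proof (cases "t \<le> T")
    case True
    then have "D f t = abar t" using D_abar[OF f] t by auto
    then show ?thesis using abar_L2[of t N] True t by simp
  next
    case False
    have 1: "L2_set (D f t) {..<N} \<le> L2_set (D f T) {..<N} + 4 * sqrt 2 * pi * (R + 1)\<^sup>2 * (t - T)"
    proof (rule L2_set_duhamel_le[where lam = lam and F = "\<lambda>\<tau>. shell_nl \<beta> (\<lambda>m. f (\<tau>, m))"])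
      show "(\<Sum>n<N. \<bar>shell_nl \<beta> (\<lambda>m. f (\<tau>, m)) n\<bar>) \<le> 4 * sqrt 2 * pi * (R + 1)\<^sup>2" for \<tau>
        by (rule sum_shell_nl_le_finite[OF \<beta>]) (use in_S[OF f] in auto)
      show "exp (lam n * t) * D f t n = exp (lam n * T) * D f T n
        + integral {T..t} (\<lambda>\<tau>. exp (lam n * \<tau>) * shell_nl \<beta> (\<lambda>m. f (\<tau>, m)) n)" for n
        using False by (intro D_split) simp
    qed (use False lam Fnl in simp_all)
    have 2: "L2_set (D f T) {..<N} \<le> R"
      using abar_L2[of T N] D_abar[OF f, of T] T by (simp add: L2_set_def)
    have 3: "4 * sqrt 2 * pi * (R + 1)\<^sup>2 * (t - T) \<le> 4 * sqrt 2 * pi * (R + 1)\<^sup>2 * \<delta>"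
      using t by (intro mult_left_mono) auto
    have 4: "4 * sqrt 2 * pi * (R + 1)\<^sup>2 * \<delta> \<le> 1"
      using \<delta>(2) by simp
    show ?thesis using order_trans[OF 1 add_mono[OF 2 order_trans[OF 3 4]]] .
  qed
  have D_cont: "continuous_on {0..T+\<delta>} (\<lambda>t. D f t n)" for f n
    unfolding D_def
    by (intro continuous_intros indefinite_integral_continuous_1 integrable_continuous_real Fnl)
  have clampc: "continuous_on UNIV clamp" unfolding clamp_def by (intro continuous_intros)
  have \<Phi>: "apply_bcontfun (\<Phi> f) (t, n) = D f (clamp t) n" if f: "f \<in> S" for f t n
  proof -
    have "(\<lambda>(t, n). D f (clamp t) n) \<in> bcontfun"
    proof (rule bcontfun_normI)
      show "continuous_on UNIV (\<lambda>(t, n). D f (clamp t) n)"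
        by (rule continuous_on_real_nat) (use clamp in \<open>auto intro!: continuous_on_compose2[OF D_cont clampc]\<close>)
      show "norm (case x of (t, n) \<Rightarrow> D f (clamp t) n) \<le> R + 1" for x
      proof (cases x)
        case (Pair t n)
        have "\<bar>D f (clamp t) n\<bar> \<le> L2_set (D f (clamp t)) {..<Suc n}"
          using member_le_L2_set[of "{..<Suc n}" n "\<lambda>n. \<bar>D f (clamp t) n\<bar>"] by (simp add: L2_set_abs)
        then show ?thesis using D_L2[OF f clamp, of t "Suc n"] Pair by simp
      qed
    qed
    then show ?thesis by (simp add: \<Phi>_def Bcontfun_inverse)
  qed
  have "\<exists>!f\<in>S. \<Phi> f = f"
  proof (rule Banach_fix[where c = "1/2"])
    \<comment> \<open>Uniform limits are pointwise limits, and each defining condition involves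
      finitely many entries at a time.\<close>
    have "closed S"
      unfolding closed_sequential_limits
    proof (intro allI impI, elim conjE)
      fix X f assume X: "\<forall>n. X n \<in> S" "X \<longlonglongrightarrow> f"
      have lim: "(\<lambda>k. apply_bcontfun (X k) x) \<longlonglongrightarrow> apply_bcontfun f x" for x
      proof -
        have d: "(\<lambda>k. dist (X k) f) \<longlonglongrightarrow> 0" using X(2) by (rule iffD1[OF tendsto_dist_iff])
        have "(\<lambda>k. dist (apply_bcontfun (X k) x) (apply_bcontfun f x)) \<longlonglongrightarrow> 0"
          by (rule tendsto_sandwich[OF _ _ tendsto_const d]) (auto simp: dist_bounded)
        then show ?thesis by (rule iffD2[OF tendsto_dist_iff])
      qed
      show "f \<in> S"
        unfolding S_def
      proof (intro CollectI conjI allI impI)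
        fix t n assume "t \<in> {0..T}"
        then have "(\<lambda>k. apply_bcontfun (X k) (t, n)) \<longlonglongrightarrow> abar t n"
          using X(1) by (simp add: S_def)
        then show "apply_bcontfun f (t, n) = abar t n" using lim LIMSEQ_unique by blast
      next
        fix t N
        have "(\<lambda>k. L2_set (\<lambda>n. apply_bcontfun (X k) (t, n)) {..<N}) \<longlonglongrightarrow> L2_set (\<lambda>n. apply_bcontfun f (t, n)) {..<N}"
          by (rule L2_set_tendsto) (rule lim)
        moreover have "L2_set (\<lambda>n. apply_bcontfun (X k) (t, n)) {..<N} \<le> R + 1" for k
          using X(1) unfolding S_def by blast
        ultimately show "L2_set (\<lambda>n. apply_bcontfun f (t, n)) {..<N} \<le> R + 1"
          by (intro LIMSEQ_le_const2) auto
      qed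
    qed
    then show "complete S" by (rule iffD2[OF complete_eq_closed])
    \<comment> \<open>The state at \<open>T\<close> held constant afterwards: a first guess showing
      that \<open>S\<close> is nonempty.\<close>
    define f0 where "f0 = Bcontfun (\<lambda>(t, n). abar (max 0 (min t T)) n)"
    have m: "max 0 (min t T) \<in> {0..T}" for t using T by auto
    have "(\<lambda>(t, n). abar (max 0 (min t T)) n) \<in> bcontfun"
    proof (rule bcontfun_normI)
      show "continuous_on UNIV (\<lambda>(t, n). abar (max 0 (min t T)) n)"
        by (rule continuous_on_real_nat) (use m in \<open>auto intro!: continuous_on_compose2[OF abar_cont] continuous_intros\<close>)
      show "norm (case x of (t, n) \<Rightarrow> abar (max 0 (min t T)) n) \<le> R" for x
      proof (cases x)
        case (Pair t n)
        have "\<bar>abar (max 0 (min t T)) n\<bar> \<le> L2_set (abar (max 0 (min t T))) {..<Suc n}"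
          using member_le_L2_set[of "{..<Suc n}" n "\<lambda>n. \<bar>abar (max 0 (min t T)) n\<bar>"] by (simp add: L2_set_abs)
        then show ?thesis using abar_L2[OF m, of t "Suc n"] Pair by simp
      qed
    qed
    then have "f0 (t, n) = abar (max 0 (min t T)) n" for t n by (simp add: f0_def Bcontfun_inverse)
    then have "f0 \<in> S" unfolding S_def using abar_L2[OF m] by (auto intro: order_trans[where y = R])
    then show "S \<noteq> {}" by blast
    show "\<Phi> ` S \<subseteq> S"
    proof
      fix g assume "g \<in> \<Phi> ` S"
      then obtain f where f: "f \<in> S" "g = \<Phi> f" by blast
      show "g \<in> S"
        unfolding S_def f(2)
      proof (intro CollectI conjI allI impI)
        fix t n assume t: "t \<in> {0..T}"
        then have "clamp t = t" using \<delta> by (auto simp: clamp_def)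
        then show "apply_bcontfun (\<Phi> f) (t, n) = abar t n" using \<Phi>[OF f(1)] D_abar[OF f(1) t] by simp
      next
        fix t N show "L2_set (\<lambda>n. apply_bcontfun (\<Phi> f) (t, n)) {..<N} \<le> R + 1"
          using D_L2[OF f(1) clamp] \<Phi>[OF f(1)] by simp
      qed
    qed
    show "dist (\<Phi> f) (\<Phi> g) \<le> 1/2 * dist f g" if f: "f \<in> S" and g: "g \<in> S" for f g
    proof (rule dist_bound)
      fix x :: "real \<times> nat"
      obtain t n where x: "x = (t, n)" by (cases x)
      define s where "s = clamp t"
      have s: "s \<in> {0..T + \<delta>}" using clamp s_def by simp
      have "\<bar>D f s n - D g s n\<bar> \<le> 1/2 * dist f g"
      proof (cases "s \<le> T")
        case True
        then show ?thesis using D_abar[OF f, of s n] D_abar[OF g, of s n] s by simp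
      next
        case False
        \<comment> \<open>For the sup metric one component at a time suffices: Duhamel is applied on
          \<open>{n}\<close> to the difference, which starts from 0 because both maps agree at
          \<open>T\<close>.\<close>
        have 1: "L2_set (\<lambda>n. D f s n - D g s n) {n} \<le> L2_set (\<lambda>n. 0) {n}
            + 8 * sqrt 2 * pi * (R + 1) * dist f g * (s - T)"
        proof (rule L2_set_duhamel_le[where lam = lam and
              F = "\<lambda>\<tau> n. shell_nl \<beta> (\<lambda>m. f (\<tau>, m)) n - shell_nl \<beta> (\<lambda>m. g (\<tau>, m)) n"])
          have "D f T n = D g T n" for n using D_abar[OF f, of T] D_abar[OF g, of T] T by simp
          then show "exp (lam n * s) * (D f s n - D g s n) = exp (lam n * T) * 0 + integral {T..s}
            (\<lambda>\<tau>. exp (lam n * \<tau>) * (shell_nl \<beta> (\<lambda>m. f (\<tau>, m)) n - shell_nl \<beta> (\<lambda>m. g (\<tau>, m)) n))" for n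
            unfolding right_diff_distrib using False D_split[of s n f] D_split[of s n g]
            by (subst integral_diff) (auto intro!: integrable_continuous_real continuous_intros Fnl)
          fix \<tau>
          have d: "\<bar>apply_bcontfun f (\<tau>, m) - apply_bcontfun g (\<tau>, m)\<bar> \<le> dist f g" for m
            using dist_bounded[of f "(\<tau>, m)" g] by (simp add: dist_real_def)
          note b = in_S(3)[OF f] in_S(3)[OF g]
          have b2: "\<bar>f (\<tau>, m) + g (\<tau>, m)\<bar> \<le> 2 * (R + 1)" for m
            using order_trans[OF abs_triangle_ineq add_mono[OF b(1)[of \<tau> m] b(2)[of \<tau> m]]] by simp
          have "\<bar>shell_nl \<beta> (\<lambda>m. f (\<tau>, m)) n - shell_nl \<beta> (\<lambda>m. g (\<tau>, m)) n\<bar> \<le> sqrt 2 * pi *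
             (3 * (case n of 0 \<Rightarrow> 0 | Suc m \<Rightarrow> \<bar>f (\<tau>, m) - g (\<tau>, m)\<bar> * \<bar>f (\<tau>, m) + g (\<tau>, m)\<bar>) +
              \<bar>f (\<tau>, n) - g (\<tau>, n)\<bar> * \<bar>f (\<tau>, Suc n)\<bar> + \<bar>g (\<tau>, n)\<bar> * \<bar>f (\<tau>, Suc n) - g (\<tau>, Suc n)\<bar>)"
            by (rule shell_nl_diff_le[OF \<beta>])
          also have "\<dots> \<le> sqrt 2 * pi * (3 * (dist f g * (2 * (R + 1))) + dist f g * (R + 1) + (R + 1) * dist f g)"
          proof (intro mult_left_mono add_mono)
            show "(case n of 0 \<Rightarrow> 0 | Suc m \<Rightarrow> \<bar>f (\<tau>, m) - g (\<tau>, m)\<bar> * \<bar>f (\<tau>, m) + g (\<tau>, m)\<bar>) \<le> dist f g * (2 * (R + 1))"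
            proof (cases n)
              case 0
              then show ?thesis using R0 by simp
            next
              case (Suc m)
              show ?thesis
                unfolding Suc nat.case by (intro mult_mono d b2) auto
            qed
            show "\<bar>f (\<tau>, n) - g (\<tau>, n)\<bar> * \<bar>f (\<tau>, Suc n)\<bar> \<le> dist f g * (R + 1)"
              by (intro mult_mono d b) auto
            show "\<bar>g (\<tau>, n)\<bar> * \<bar>f (\<tau>, Suc n) - g (\<tau>, Suc n)\<bar> \<le> (R + 1) * dist f g"
              using R0 by (intro mult_mono d b) auto
          qed auto
          also have "\<dots> = 8 * sqrt 2 * pi * (R + 1) * dist f g" by (simp add: algebra_simps)
          finally show "(\<Sum>n\<in>{n}. \<bar>shell_nl \<beta> (\<lambda>m. f (\<tau>, m)) n - shell_nl \<beta> (\<lambda>m. g (\<tau>, m)) n\<bar>)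
              \<le> 8 * sqrt 2 * pi * (R + 1) * dist f g" by simp
        qed (use False lam in \<open>auto intro!: continuous_intros Fnl\<close>)
        have "8 * sqrt 2 * pi * (R + 1) * dist f g * (s - T) \<le> 8 * sqrt 2 * pi * (R + 1)\<^sup>2 * dist f g * \<delta>"
          using s False R0 by (intro mult_mono) (auto simp: power2_eq_square)
        also have "\<dots> = 1/2 * dist f g * (16 * sqrt 2 * pi * (R + 1)\<^sup>2 * \<delta>)" by simp
        also have "\<dots> = 1/2 * dist f g" unfolding \<delta>(2) by simp
        finally show ?thesis using 1 by (simp add: L2_set_def)
      qed
      then show "dist (\<Phi> f x) (\<Phi> g x) \<le> 1/2 * dist f g"
        using \<Phi>[OF f] \<Phi>[OF g] by (simp add: x s_def dist_real_def)
    qed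
  qed auto
  then obtain f where f: "f \<in> S" and fixpoint: "\<Phi> f = f" by blast
  define b where "b t n = apply_bcontfun f (t, n)" for t n
  have b_eq: "b t n = D f t n" if "t \<in> {0..T + \<delta>}" for t n
    using \<Phi>[OF f, of t n] that unfolding fixpoint b_def by (auto simp: clamp_def max_def min_def split: if_splits)
  show thesis
  proof (rule that)
    show "T < T + \<delta>" using \<delta> by simp
    show "b t = a t" if "t \<in> time_dom (ereal T)" for t
      using f that abar_eq unfolding S_def b_def dom by auto
    show "shell_flow \<beta> lam (ereal (T + \<delta>)) b"
    proof (rule shell_flowI[OF \<beta> lam, where R = "R + 1"])
      show "summable (\<lambda>n. (b t n)\<^sup>2)" "l2_norm (b t) \<le> R + 1" for t
        using in_S[OF f] by (auto simp: b_def[abs_def])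
      fix t n assume "t \<in> time_dom (ereal (T + \<delta>))"
      then have t: "t \<in> {0..T + \<delta>}" by auto
      have "((\<lambda>\<tau>. b \<tau> n) has_real_derivative - lam n * b t n + shell_nl \<beta> (b t) n) (at t within {0..T + \<delta>})"
      proof (rule deriv_of_duhamel[OF _ t, where c = "abar 0 n"])
        show "continuous_on {0..T + \<delta>} (\<lambda>\<tau>. shell_nl \<beta> (b \<tau>) n)"
          unfolding b_def[abs_def] by (rule Fnl)
        show "exp (lam n * s) * b s n = abar 0 n + integral {0..s} (\<lambda>\<tau>. exp (lam n * \<tau>) * shell_nl \<beta> (b \<tau>) n)"
          if "s \<in> {0..T + \<delta>}" for s
          unfolding b_eq[OF that] D_duhamel by (simp add: b_def[abs_def])
      qed
      then show "((\<lambda>\<tau>. b \<tau> n) has_real_derivative - lam n * b t n + shell_nl \<beta> (b t) n)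
          (at t within time_dom (ereal (T + \<delta>)))"
        by (rule DERIV_subset) auto
    qed
  qed
qed

section \<open>Fourier series on the torus\<close>

lemma freq_add: "freq (k + l) = freq k + freq l"
  by (simp add: freq_def vec_eq_iff)

lemma freq_minus: "freq (- k) = - freq k"
  by (simp add: freq_def vec_eq_iff)

lemma freq_diff: "freq (k - l) = freq k - freq l"
  by (simp add: freq_def vec_eq_iff)

lemma freq_0: "freq 0 = 0"
  by (simp add: freq_def vec_eq_iff)

lemma freq_nth [simp]: "freq k $ i = of_int (k $ i)"
  by (simp add: freq_def)

lemma fourier_mode_add: "fourier_mode (k + l) x = fourier_mode k x * fourier_mode l x"
  by (simp only: fourier_mode_def freq_add inner_add_left of_real_add ring_distribs exp_add)

lemma fourier_mode_0 [simp]: "fourier_mode 0 x = 1"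
  by (simp add: fourier_mode_def freq_0)

lemma norm_fourier_mode [simp]: "norm (fourier_mode k x) = 1"
proof -
  have "fourier_mode k x = exp (\<i> * complex_of_real (- 2 * pi * (freq k \<bullet> x)))"
    by (simp add: fourier_mode_def algebra_simps)
  then show ?thesis by (simp only: norm_exp_i_times)
qed

lemma cnj_fourier_mode: "cnj (fourier_mode k x) = fourier_mode (- k) x"
  by (simp add: fourier_mode_def exp_cnj freq_minus)

lemma continuous_on_fourier_mode [continuous_intros]: "continuous_on S (fourier_mode k)"
  unfolding fourier_mode_def[abs_def] by (intro continuous_intros)

lemma fourier_mode_periodic: "fourier_mode k (x + freq l) = fourier_mode k x"
proof -
  define m :: int where "m = (\<Sum>i\<in>UNIV. k $ i * l $ i)"
  have m: "freq k \<bullet> freq l = of_int m"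
    by (simp add: inner_vec_def m_def)
  have "exp (- 2 * complex_of_real pi * \<i> * of_int m) = 1"
    by (auto simp: exp_eq_1 intro!: exI[of _ "- m"])
  then show ?thesis
    unfolding fourier_mode_def inner_add_right m of_real_add ring_distribs exp_add by simp
qed

text \<open>\<open>lborel\<close> is the image of a finite product of one-dimensional copies, which
  turns the claim into Fubini for products.\<close>

lemma integral_lborel_prod:
  fixes f :: "'a::euclidean_space \<Rightarrow> real \<Rightarrow> complex"
  assumes "\<And>b. b \<in> Basis \<Longrightarrow> integrable lborel (f b)"
  shows "(\<integral>x. (\<Prod>b\<in>Basis. f b (x \<bullet> b)) \<partial>lborel) = (\<Prod>b\<in>Basis. \<integral>y. f b y \<partial>lborel)"
proof -
  interpret product_sigma_finite "\<lambda>_. lborel :: real measure" by standard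
  have meas: "f b \<in> borel_measurable borel" if "b \<in> Basis" for b
    using borel_measurable_integrable[OF assms[OF that]] by simp
  have "(\<integral>x. (\<Prod>b\<in>Basis. f b (x \<bullet> b)) \<partial>lborel)
     = (\<integral>g. (\<Prod>b\<in>Basis. f b ((\<Sum>c\<in>Basis. g c *\<^sub>R c) \<bullet> b)) \<partial>(\<Pi>\<^sub>M b\<in>(Basis::'a set). lborel))"
    unfolding lborel_eq[where 'a = 'a] using meas
    by (subst integral_distr) (auto intro!: borel_measurable_prod measurable_compose[OF _ meas])
  also have "\<dots> = (\<integral>g. (\<Prod>b\<in>Basis. f b (g b)) \<partial>(\<Pi>\<^sub>M b\<in>(Basis::'a set). lborel))"
    by (intro Bochner_Integration.integral_cong prod.cong refl) simp
  also have "\<dots> = (\<Prod>b\<in>Basis. \<integral>y. f b y \<partial>lborel)"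
    by (rule product_integral_prod) (use assms in auto)
  finally show ?thesis .
qed

lemma integral_unit_interval_mode:
  "(\<integral>y. indicator {0..1} y *\<^sub>R exp (- 2 * complex_of_real pi * \<i> * of_real (of_int m * y)) \<partial>lborel)
     = (if m = 0 then 1 else 0)" (is "?I = _")
proof -
  define e where "e = (\<lambda>y::real. exp (- 2 * complex_of_real pi * \<i> * of_real (of_int m * y)))"
  have ec: "continuous_on {0..1} e" unfolding e_def by (intro continuous_intros)
  have si: "set_integrable lborel {0..1} e"
    unfolding set_integrable_def by (rule borel_integrable_compact[OF compact_Icc ec])
  have "?I = integral {0..1} e"
    using set_borel_integral_eq_integral(2)[OF si] by (simp add: set_lebesgue_integral_def e_def)
  also have "\<dots> = (if m = 0 then 1 else 0)"
  proof (cases "m = 0")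
    case True
    then show ?thesis by (simp add: e_def)
  next
    case False
    define c where "c = - 2 * complex_of_real pi * \<i> * of_int m"
    have c: "c \<noteq> 0" using False by (simp add: c_def)
    have e: "e y = exp (c * of_real y)" for y by (simp add: e_def c_def mult.assoc)
    have "((\<lambda>y. exp (c * of_real y) / c) has_vector_derivative e y) (at y within {0..1})" for y
      unfolding e
      by (rule has_vector_derivative_real_field)
        (use c in \<open>auto intro!: derivative_eq_intros\<close>)
    then have "(e has_integral exp (c * of_real 1) / c - exp (c * of_real 0) / c) {0..1}"
      by (intro fundamental_theorem_of_calculus) auto
    moreover have "exp c = 1"
      by (auto simp: c_def exp_eq_1 intro!: exI[of _ "- m"])
    ultimately show ?thesis using False by (simp add: integral_unique)
  qed
  finally show ?thesis .
qed

lemma set_integrable_cube_continuous: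
  fixes f :: "real ^ 3 \<Rightarrow> 'b::euclidean_space"
  assumes "continuous_on (cbox 0 1) f"
  shows "set_integrable lebesgue (cbox 0 1) f"
  using absolutely_integrable_continuous[OF assms] by simp

text \<open>The indicator of the cube and the exponential both factor over the coordinates, and
  passing from \<open>lebesgue\<close> to \<open>lborel\<close> changes no integral of a Borel
  function.\<close>

lemma torus_integral_fourier_mode: "torus_integral (fourier_mode k) = (if k = 0 then 1 else 0)"
proof -
  define f where "f b y = indicator {0..1} y *\<^sub>R exp (- 2 * complex_of_real pi * \<i> * of_real ((freq k \<bullet> b) * y))"
    for b :: "real ^ 3" and y :: real
  have fb: "f b = (\<lambda>y. indicator {0..1} y *\<^sub>R exp (- 2 * complex_of_real pi * \<i> * of_real ((freq k \<bullet> b) * y)))" for b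
    by (simp add: f_def fun_eq_iff)
  have int: "integrable lborel (f b)" for b
    unfolding fb by (rule borel_integrable_compact[OF compact_Icc]) (intro continuous_intros)
  have split: "indicator (cbox 0 1) x *\<^sub>R fourier_mode k x = (\<Prod>b\<in>Basis. f b (x \<bullet> b))" for x
  proof -
    have "fourier_mode k x = (\<Prod>b\<in>Basis. exp (- 2 * complex_of_real pi * \<i> * of_real ((freq k \<bullet> b) * (x \<bullet> b))))"
      unfolding fourier_mode_def euclidean_inner[of "freq k" x]
      by (simp add: exp_sum sum_distrib_left)
    moreover have "indicator (cbox 0 1) x = (\<Prod>b\<in>(Basis::(real^3) set). indicator {0..1} (x \<bullet> b) :: real)"
    proof -
      have *: "(1 :: real^3) \<bullet> b = 1" if "b \<in> Basis" for b
        using that by (auto simp: Basis_vec_def inner_axis)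
      show ?thesis by (auto simp: indicator_def cbox_def * split: if_splits)
    qed
    ultimately show ?thesis by (simp only: f_def prod.distrib scaleR_conv_of_real of_real_prod)
  qed
  have "torus_integral (fourier_mode k) = (\<integral>x. indicator (cbox 0 1) x *\<^sub>R fourier_mode k x \<partial>lebesgue)"
    by (simp add: torus_integral_def set_lebesgue_integral_def)
  also have "\<dots> = (\<integral>x. indicator (cbox 0 1) x *\<^sub>R fourier_mode k x \<partial>lborel)"
    by (rule integral_completion)
      (use borel_measurable_continuous_on_indicator[OF _ continuous_on_fourier_mode, of "cbox 0 1" k] in simp)
  also have "\<dots> = (\<Prod>b\<in>Basis. \<integral>y. f b y \<partial>lborel)"
    unfolding split by (rule integral_lborel_prod[OF int])
  also have "\<dots> = (\<Prod>i\<in>UNIV. \<integral>y. f (axis i 1) y \<partial>lborel)"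
  proof -
    have B: "Basis = (\<lambda>i. axis i (1::real)) ` (UNIV :: 3 set)" by (auto simp: Basis_vec_def)
    have inj: "inj (\<lambda>i::3. axis i (1::real))" by (auto simp: inj_on_def axis_eq_axis)
    show ?thesis unfolding B by (subst prod.reindex[OF inj]) simp
  qed
  also have "\<dots> = (\<Prod>i\<in>UNIV. if k $ i = 0 then 1 else 0)"
    using integral_unit_interval_mode by (simp add: fb inner_axis)
  also have "\<dots> = (if k = 0 then 1 else 0)"
    by (auto simp: vec_eq_iff)
  finally show ?thesis .
qed

lemma torus_integral_add:
  assumes "set_integrable lebesgue (cbox 0 1) f" "set_integrable lebesgue (cbox 0 1) g"
  shows "torus_integral (\<lambda>x. f x + g x) = torus_integral f + torus_integral g"
  unfolding torus_integral_def using assms by (rule set_integral_add)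

lemma torus_integral_diff:
  assumes "set_integrable lebesgue (cbox 0 1) f" "set_integrable lebesgue (cbox 0 1) g"
  shows "torus_integral (\<lambda>x. f x - g x) = torus_integral f - torus_integral g"
  unfolding torus_integral_def using assms by (rule set_integral_diff)

lemma torus_integral_cmult: "torus_integral (\<lambda>x. c * f x) = c * torus_integral f"
  unfolding torus_integral_def set_lebesgue_integral_def by (simp flip: mult_scaleR_right)

lemma torus_integral_sum:
  assumes "\<And>i. i \<in> I \<Longrightarrow> set_integrable lebesgue (cbox 0 1) (f i)"
  shows "torus_integral (\<lambda>x. \<Sum>i\<in>I. f i x) = (\<Sum>i\<in>I. torus_integral (f i))"
  using assms unfolding torus_integral_def set_lebesgue_integral_def set_integrable_def scaleR_sum_right
  by (rule Bochner_Integration.integral_sum)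

lemma set_integrable_bounded_mult:
  fixes f g :: "real ^ 3 \<Rightarrow> complex"
  assumes f: "set_integrable lebesgue (cbox 0 1) f" and g: "g \<in> borel_measurable lebesgue"
    and b: "\<And>x. norm (g x) \<le> B"
  shows "set_integrable lebesgue (cbox 0 1) (\<lambda>x. f x * g x)"
proof -
  have "integrable lebesgue (\<lambda>x. B *\<^sub>R norm (indicator (cbox 0 1) x *\<^sub>R f x))"
    using f unfolding set_integrable_def by (intro integrable_scaleR_right integrable_norm) auto
  then have "integrable lebesgue (\<lambda>x. (indicator (cbox 0 1) x *\<^sub>R f x) * g x)"
  proof (rule Bochner_Integration.integrable_bound)
    show "(\<lambda>x. (indicator (cbox 0 1) x *\<^sub>R f x) * g x) \<in> borel_measurable lebesgue"
      using f g unfolding set_integrable_def by (intro borel_measurable_times) auto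
    have "norm ((indicator (cbox 0 1) x *\<^sub>R f x) * g x) \<le> B * norm (indicator (cbox 0 1) x *\<^sub>R f x)" for x
      using mult_right_mono[OF b[of x], of "norm (indicator (cbox 0 1) x *\<^sub>R f x)"]
      by (simp only: norm_mult norm_ge_zero mult.commute[of _ "norm (g x)"])
    then show "AE x in lebesgue. norm ((indicator (cbox 0 1) x *\<^sub>R f x) * g x)
        \<le> norm (B *\<^sub>R norm (indicator (cbox 0 1) x *\<^sub>R f x))"
      by (intro AE_I2) (smt (verit) real_norm_def real_scaleR_def norm_ge_zero)
  qed
  then show ?thesis by (simp add: set_integrable_def)
qed

lemma borel_measurable_lebesgue_continuous:
  fixes f :: "real ^ 3 \<Rightarrow> 'b::topological_space"
  assumes "continuous_on UNIV f"
  shows "f \<in> borel_measurable lebesgue"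
  using borel_measurable_continuous_onI[OF assms] by (intro measurable_completion) simp

lemma borel_measurable_fourier_mode [measurable]: "fourier_mode k \<in> borel_measurable lebesgue"
  by (intro borel_measurable_lebesgue_continuous continuous_intros)

section \<open>Uniqueness of Fourier coefficients\<close>

inductive trig_poly :: "(real ^ 3 \<Rightarrow> complex) \<Rightarrow> bool" where
  mode: "trig_poly (fourier_mode k)"
| add: "trig_poly f \<Longrightarrow> trig_poly g \<Longrightarrow> trig_poly (\<lambda>x. f x + g x)"
| cmult: "trig_poly f \<Longrightarrow> trig_poly (\<lambda>x. c * f x)"

lemma trig_poly_const: "trig_poly (\<lambda>_. c)"
  using trig_poly.cmult[OF trig_poly.mode[of 0], of c] by simp

lemma trig_poly_sum: "finite I \<Longrightarrow> (\<And>i. i \<in> I \<Longrightarrow> trig_poly (f i)) \<Longrightarrow> trig_poly (\<lambda>x. \<Sum>i\<in>I. f i x)"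
  by (induction I rule: finite_induct) (auto intro: trig_poly_const trig_poly.add)

lemma trig_poly_mult:
  assumes "trig_poly f" "trig_poly g"
  shows "trig_poly (\<lambda>x. f x * g x)"
  using assms(1)
proof (induction rule: trig_poly.induct)
  case (mode k)
  from assms(2) show ?case
  proof (induction rule: trig_poly.induct)
    case (mode l)
    have "(\<lambda>x. fourier_mode k x * fourier_mode l x) = fourier_mode (k + l)"
      by (simp add: fun_eq_iff fourier_mode_add)
    then show ?case by (simp add: trig_poly.mode)
  next
    case (cmult f c)
    then show ?case using trig_poly.cmult[OF cmult.IH, of c] by (simp add: mult.left_commute)
  qed (simp add: distrib_left trig_poly.add)
next
  case (add f g)
  then show ?case by (simp add: distrib_right trig_poly.add)
next
  case (cmult f c)
  then show ?case using trig_poly.cmult[OF cmult.IH, of c] by (simp add: mult.assoc)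
qed

text \<open>The torus as a compact subset of complex 3-space, opposite faces of the cube being
  identified. Real polynomials there pull back to trigonometric polynomials, so Stone-Weierstrass on
  the image gives uniform approximation.\<close>

definition torus_embed :: "real ^ 3 \<Rightarrow> complex ^ 3" where
  "torus_embed x = (\<chi> j. fourier_mode (axis j 1) x)"

lemma continuous_on_torus_embed: "continuous_on S torus_embed"
  unfolding torus_embed_def[abs_def] by (intro continuous_intros)

text \<open>The essential case is a real-linear functional: \<open>Re w\<close> and
  \<open>Im w\<close> are combinations of \<open>w\<close> and \<open>cnj w\<close>, and conjugating
  a mode yields the mode of the opposite frequency.\<close>

lemma trig_poly_real_polynomial:
  assumes "real_polynomial_function q"
  shows "trig_poly (\<lambda>x. complex_of_real (q (torus_embed x)))"
  using assms
proof (induction rule: real_polynomial_function.induct)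
  case (linear f)
  interpret bounded_linear f by fact
  define re where "re j = f (axis j 1)" for j
  define im where "im j = f (axis j \<i>)" for j
  have ax: "f (axis j c) = Re c * re j + Im c * im j" for j c
  proof -
    have "axis j c = Re c *\<^sub>R axis j 1 + Im c *\<^sub>R axis j (\<i>::complex)"
      by (auto simp: axis_def vec_eq_iff complex_eq_iff)
    then show ?thesis by (simp add: add scaleR re_def im_def)
  qed
  have z: "z = (\<Sum>j\<in>UNIV. axis j (z $ j))" for z :: "complex ^ 3"
    by (simp add: vec_eq_iff axis_def if_distrib cong: if_cong)
  have "f z = (\<Sum>j\<in>UNIV. Re (z $ j) * re j + Im (z $ j) * im j)" for z
    by (subst z) (simp add: sum ax)
  moreover have "complex_of_real (Re w * r + Im w * s) = ((r - \<i> * s) / 2) * w + ((r + \<i> * s) / 2) * cnj w" for w r s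
    by (simp add: complex_eq_iff field_simps)
  ultimately have f: "complex_of_real (f z) = (\<Sum>j\<in>UNIV. ((re j - \<i> * im j) / 2) * z $ j + ((re j + \<i> * im j) / 2) * cnj (z $ j))" for z
    by (simp only: of_real_sum)
  have "trig_poly (\<lambda>x. \<Sum>j\<in>UNIV. ((re j - \<i> * im j) / 2) * fourier_mode (axis j 1) x
      + ((re j + \<i> * im j) / 2) * fourier_mode (- axis j 1) x)"
    by (intro trig_poly_sum trig_poly.intros) auto
  then show ?case unfolding f torus_embed_def by (simp add: cnj_fourier_mode)
next
  case (const c)
  show ?case by (rule trig_poly_const)
next
  case (add f g)
  then show ?case by (simp add: trig_poly.add)
next
  case (mult f g)
  then show ?case using trig_poly_mult[of "\<lambda>x. complex_of_real (f (torus_embed x))"] by simp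
qed

text \<open>Coordinates agree up to integers, which vanish as soon as one point avoids the faces;
  two boundary points may well be identified.\<close>

lemma torus_embed_eqD:
  assumes x: "x \<in> cbox 0 1" and y: "y \<in> box 0 1" and eq: "torus_embed x = torus_embed y"
  shows "x = y"
proof -
  have "x $ j = y $ j" for j
  proof -
    have in_x: "0 \<le> x $ j" "x $ j \<le> 1" and in_y: "0 < y $ j" "y $ j < 1"
      using x y by (auto simp: mem_box_cart)
    have "exp (- 2 * complex_of_real pi * \<i> * of_real (x $ j)) = exp (- 2 * complex_of_real pi * \<i> * of_real (y $ j))"
    proof -
      have fa: "freq (axis j 1) \<bullet> z = z $ j" for z
        by (simp add: freq_def inner_vec_def axis_def if_distrib[of of_int] if_distrib[of "\<lambda>c. c * _"] cong: if_cong)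
      have "fourier_mode (axis j 1) x = fourier_mode (axis j 1) y"
        using eq by (auto simp: torus_embed_def vec_eq_iff)
      then show ?thesis unfolding fourier_mode_def fa .
    qed
    then obtain n :: int where "- 2 * complex_of_real pi * \<i> * of_real (x $ j)
        = - 2 * complex_of_real pi * \<i> * of_real (y $ j) + (of_int (2 * n) * pi) * \<i>"
      unfolding exp_eq by blast
    then have "- 2 * pi * x $ j = - 2 * pi * y $ j + of_int (2 * n) * pi"
      by (simp add: complex_eq_iff)
    then have "pi * (x $ j) = pi * (y $ j - of_int n)" by (simp add: algebra_simps)
    then have "x $ j = y $ j - of_int n" by simp
    moreover from this have "n = 0" using in_x in_y by linarith
    ultimately show ?thesis by simp
  qed
  then show ?thesis by (simp add: vec_eq_iff)
qed

context
  fixes f :: "real ^ 3 \<Rightarrow> complex"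
  assumes f: "set_integrable lebesgue (cbox 0 1) f"
    and zero: "\<And>k. torus_integral (\<lambda>x. f x * fourier_mode k x) = 0"
begin

lemma integral_trig_poly_zero:
  assumes "trig_poly g"
  shows "set_integrable lebesgue (cbox 0 1) (\<lambda>x. f x * g x) \<and> torus_integral (\<lambda>x. f x * g x) = 0"
  using assms
proof (induction rule: trig_poly.induct)
  case (mode k)
  show ?case
    by (auto intro!: set_integrable_bounded_mult[OF f, where B = 1] zero)
next
  case (add g h)
  then show ?case by (simp add: distrib_left torus_integral_add set_integral_add)
next
  case (cmult g c)
  then show ?case
    using torus_integral_cmult[of c "\<lambda>x. f x * g x"] set_integrable_mult_right[of c lebesgue "cbox 0 1" "\<lambda>x. f x * g x"]
    by (simp add: mult.left_commute)
qed

text \<open>Uniform approximation by trigonometric polynomials, with the error paid against the L1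
  norm of \<open>f\<close>.\<close>

lemma integral_continuous_zero:
  fixes h :: "complex ^ 3 \<Rightarrow> real"
  assumes h: "continuous_on UNIV h"
  shows "torus_integral (\<lambda>x. f x * complex_of_real (h (torus_embed x))) = 0"
proof -
  define C where "C = (LINT x:cbox 0 1|lebesgue. norm (f x))"
  have fn: "set_integrable lebesgue (cbox 0 1) (\<lambda>x. norm (f x))"
    using set_integrable_norm[OF f] .
  have C0: "0 \<le> C" unfolding C_def set_lebesgue_integral_def by (intro integral_nonneg_AE) auto
  let ?T = "torus_embed ` cbox 0 1"
  have comp: "compact ?T" by (intro compact_continuous_image continuous_on_torus_embed compact_cbox)
  have hc: "continuous_on ?T h" using h continuous_on_subset by blast
  have hi: "set_integrable lebesgue (cbox 0 1) (\<lambda>x. f x * complex_of_real (h (torus_embed x)))"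
  proof -
    have "compact (h ` ?T)" by (intro compact_continuous_image hc comp)
    then obtain B where B: "\<And>z. z \<in> ?T \<Longrightarrow> norm (h z) \<le> B"
      by (meson bounded_iff compact_imp_bounded imageI)
    have B0: "0 \<le> B" using B[of "torus_embed 0"] by (force simp: mem_box_cart)
    have "integrable lebesgue (\<lambda>x. B *\<^sub>R norm (indicator (cbox 0 1) x *\<^sub>R f x))"
      using f unfolding set_integrable_def by (intro integrable_scaleR_right integrable_norm) auto
    then have "integrable lebesgue (\<lambda>x. (indicator (cbox 0 1) x *\<^sub>R f x) * complex_of_real (h (torus_embed x)))"
    proof (rule Bochner_Integration.integrable_bound)
      have "(\<lambda>x. complex_of_real (h (torus_embed x))) \<in> borel_measurable lebesgue"
        by (intro borel_measurable_lebesgue_continuous continuous_on_of_real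
            continuous_on_compose2[OF h continuous_on_torus_embed]) auto
      then show "(\<lambda>x. (indicator (cbox 0 1) x *\<^sub>R f x) * complex_of_real (h (torus_embed x))) \<in> borel_measurable lebesgue"
        using f unfolding set_integrable_def by (intro borel_measurable_times) auto
      show "AE x in lebesgue. norm ((indicator (cbox 0 1) x *\<^sub>R f x) * complex_of_real (h (torus_embed x)))
          \<le> norm (B *\<^sub>R norm (indicator (cbox 0 1) x *\<^sub>R f x))"
        using B B0 by (intro AE_I2) (auto simp: norm_mult indicator_def mult.commute[of _ "\<bar>h _\<bar>"] intro!: mult_right_mono)
    qed
    then show ?thesis by (simp add: set_integrable_def)
  qed
  have "norm (torus_integral (\<lambda>x. f x * complex_of_real (h (torus_embed x)))) \<le> e * C" if e: "0 < e" for e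
  proof -
    obtain q where q: "real_polynomial_function q" "\<And>z. z \<in> ?T \<Longrightarrow> \<bar>h z - q z\<bar> < e"
      using Stone_Weierstrass_real_polynomial_function[OF comp hc e] by blast
    note tp = integral_trig_poly_zero[OF trig_poly_real_polynomial[OF q(1)]]
    let ?d = "\<lambda>x. f x * complex_of_real (h (torus_embed x)) - f x * complex_of_real (q (torus_embed x))"
    have "torus_integral (\<lambda>x. f x * complex_of_real (h (torus_embed x))) = torus_integral ?d"
      using tp by (subst torus_integral_diff[OF hi]) auto
    also have "norm \<dots> \<le> (LINT x:cbox 0 1|lebesgue. norm (?d x))"
      unfolding torus_integral_def set_lebesgue_integral_def
      by (rule order_trans[OF integral_norm_bound]) simp
    also have "\<dots> \<le> (LINT x:cbox 0 1|lebesgue. e * norm (f x))"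
    proof (rule set_integral_mono)
      show "set_integrable lebesgue (cbox 0 1) (\<lambda>x. norm (?d x))"
        using hi tp by (intro set_integrable_norm set_integral_diff) auto
      show "set_integrable lebesgue (cbox 0 1) (\<lambda>x. e * norm (f x))"
        using fn by simp
      fix x :: "real ^ 3" assume x: "x \<in> cbox 0 1"
      have "?d x = f x * complex_of_real (h (torus_embed x) - q (torus_embed x))"
        by (simp add: right_diff_distrib)
      then have "norm (?d x) = norm (f x) * \<bar>h (torus_embed x) - q (torus_embed x)\<bar>"
        by (simp only: norm_mult norm_of_real real_norm_def)
      also have "\<dots> \<le> norm (f x) * e"
        using q(2)[of "torus_embed x"] x by (intro mult_left_mono) auto
      finally show "norm (?d x) \<le> e * norm (f x)" by (simp add: mult.commute)
    qed
    also have "\<dots> = e * C" by (simp add: C_def)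
    finally show ?thesis .
  qed
  note small = this
  have "norm (torus_integral (\<lambda>x. f x * complex_of_real (h (torus_embed x)))) \<le> 0 + e" if "0 < e" for e
  proof -
    have "e / (C + 1) * C \<le> e" using C0 that by (simp add: field_simps)
    then show ?thesis using small[of "e / (C + 1)"] that C0 by force
  qed
  then have "norm (torus_integral (\<lambda>x. f x * complex_of_real (h (torus_embed x)))) \<le> 0"
    by (rule field_le_epsilon)
  then show ?thesis by simp
qed

text \<open>Cutoffs around the image of \<open>K\<close> tend to the indicator of all points sharing
  an image with a point of \<open>K\<close>. Since \<open>K\<close> avoids the faces, within the
  closed cube these are the points of \<open>K\<close> itself.\<close>

lemma integral_compact_zero:
  assumes K: "compact K" "K \<subseteq> box 0 1"
  shows "(LINT x:K|lebesgue. f x) = 0"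
proof (cases "K = {}")
  case False
  define h where "h m z = max 0 (1 - real m * infdist z (torus_embed ` K))" for m z
  have TK: "closed (torus_embed ` K)" "torus_embed ` K \<noteq> {}"
    using K False by (auto intro!: compact_imp_closed compact_continuous_image continuous_on_torus_embed)
  have hc: "continuous_on UNIV (h m)" for m
    unfolding h_def[abs_def] by (intro continuous_intros)
  have h01: "0 \<le> h m z" "h m z \<le> 1" for m z
    unfolding h_def by (auto simp: infdist_nonneg)
  have Kc: "K \<subseteq> cbox 0 1" using K box_subset_cbox by blast
  have lim: "(\<lambda>m. h m (torus_embed x)) \<longlonglongrightarrow> indicator K x" if x: "x \<in> cbox 0 1" for x
  proof (cases "x \<in> K")
    case True
    then show ?thesis by (simp add: h_def)
  next
    case False
    have "torus_embed x \<notin> torus_embed ` K"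
      using torus_embed_eqD[OF x] False K(2) by blast
    then have pos: "0 < infdist (torus_embed x) (torus_embed ` K)"
      using infdist_pos_not_in_closed[OF TK] by blast
    then obtain M :: nat where M: "1 < real M * infdist (torus_embed x) (torus_embed ` K)"
      using reals_Archimedean3 by blast
    have "h m (torus_embed x) = 0" if "m \<ge> M" for m
    proof -
      have "real M * infdist (torus_embed x) (torus_embed ` K) \<le> real m * infdist (torus_embed x) (torus_embed ` K)"
        using that pos by (intro mult_right_mono) auto
      then show ?thesis using M by (simp add: h_def)
    qed
    then have "\<forall>\<^sub>F m in sequentially. h m (torus_embed x) = 0"
      unfolding eventually_sequentially by blast
    then show ?thesis using False by (simp add: tendsto_eventually)
  qed
  have "(\<lambda>m. torus_integral (\<lambda>x. f x * complex_of_real (h m (torus_embed x))))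
      \<longlonglongrightarrow> (LINT x|lebesgue. indicator K x *\<^sub>R f x)"
    unfolding torus_integral_def set_lebesgue_integral_def
  proof (rule integral_dominated_convergence)
    show "integrable lebesgue (\<lambda>x. norm (indicator (cbox 0 1) x *\<^sub>R f x))"
      using f unfolding set_integrable_def by (intro integrable_norm)
    have Km: "K \<in> sets lebesgue" using K(1) by (simp add: borel_compact)
    have "integrable lebesgue (\<lambda>x. indicator K x *\<^sub>R (indicator (cbox 0 1) x *\<^sub>R f x))"
      using integrable_mult_indicator[OF Km f[unfolded set_integrable_def]] .
    moreover have "(\<lambda>x. indicator K x *\<^sub>R (indicator (cbox 0 1) x *\<^sub>R f x)) = (\<lambda>x. indicator K x *\<^sub>R f x)"
      using Kc by (force simp: indicator_def fun_eq_iff)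
    ultimately show "(\<lambda>x. indicator K x *\<^sub>R f x) \<in> borel_measurable lebesgue"
      by (metis borel_measurable_integrable)
    fix m
    have "(\<lambda>x. complex_of_real (h m (torus_embed x))) \<in> borel_measurable lebesgue"
      by (intro borel_measurable_lebesgue_continuous continuous_on_of_real
          continuous_on_compose2[OF hc continuous_on_torus_embed]) auto
    then have "(\<lambda>x. (indicator (cbox 0 1) x *\<^sub>R f x) * complex_of_real (h m (torus_embed x))) \<in> borel_measurable lebesgue"
      using f unfolding set_integrable_def by (intro borel_measurable_times) auto
    then show "(\<lambda>x. indicator (cbox 0 1) x *\<^sub>R (f x * complex_of_real (h m (torus_embed x)))) \<in> borel_measurable lebesgue"
      by simp
    show "AE x in lebesgue. norm (indicator (cbox 0 1) x *\<^sub>R (f x * complex_of_real (h m (torus_embed x))))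
        \<le> norm (indicator (cbox 0 1) x *\<^sub>R f x)"
      using h01 by (intro AE_I2) (auto simp: norm_mult indicator_def intro!: mult_right_le_one_le)
  next
    show "AE x in lebesgue. (\<lambda>m. indicator (cbox 0 1) x *\<^sub>R (f x * complex_of_real (h m (torus_embed x))))
       \<longlonglongrightarrow> indicator K x *\<^sub>R f x"
    proof (intro AE_I2)
      fix x :: "real ^ 3"
      show "(\<lambda>m. indicator (cbox 0 1) x *\<^sub>R (f x * complex_of_real (h m (torus_embed x))))
       \<longlonglongrightarrow> indicator K x *\<^sub>R f x"
      proof (cases "x \<in> cbox 0 1")
        case True
        have "(\<lambda>m. f x * complex_of_real (h m (torus_embed x))) \<longlonglongrightarrow> f x * complex_of_real (indicator K x)"
          by (intro tendsto_intros lim True)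
        then show ?thesis using True by (simp add: scaleR_conv_of_real mult.commute)
      next
        case False
        then show ?thesis using Kc by (auto simp: indicator_def)
      qed
    qed
  qed
  then show ?thesis
    by (simp add: integral_continuous_zero[OF hc] set_lebesgue_integral_def LIMSEQ_const_iff)
qed (simp add: set_lebesgue_integral_def)

end

text \<open>If \<open>g \<ge> 1 / (n + 1)\<close> held on a set of positive measure, inner
  regularity would provide a compact subset of positive measure, over which the integral is
  positive. The faces of the cube are null.\<close>

lemma AE_nonpos_if_compact_integrals_zero:
  assumes g: "set_integrable lebesgue (cbox 0 1) (g :: real ^ 3 \<Rightarrow> real)"
    and z: "\<And>K. compact K \<Longrightarrow> K \<subseteq> box 0 1 \<Longrightarrow> (LINT x:K|lebesgue. g x) = 0"
  shows "AE x in lebesgue. x \<in> cbox 0 1 \<longrightarrow> g x \<le> 0"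
proof -
  define G where "G x = indicator (cbox 0 1) x *\<^sub>R g x" for x
  have Gm: "G \<in> borel_measurable lebesgue"
    using g unfolding set_integrable_def G_def[abs_def] by simp
  define A where "A n = {x \<in> box 0 1. G x \<ge> 1 / real (Suc n)}" for n
  have Am: "A n \<in> sets lebesgue" for n
  proof -
    have "A n = (G -` {1 / real (Suc n)..} \<inter> space lebesgue) \<inter> box 0 1"
      by (auto simp: A_def)
    also have "\<dots> \<in> sets lebesgue"
      by (intro sets.Int measurable_sets[OF Gm]) auto
    finally show ?thesis .
  qed
  have A0: "A n \<in> null_sets lebesgue" for n
  proof (rule ccontr)
    assume "A n \<notin> null_sets lebesgue"
    then have pos: "0 < emeasure lebesgue (A n)"
      using Am[of n] by (auto simp: null_sets_def zero_less_iff_neq_zero)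
    have fin: "emeasure lebesgue (A n) < \<infinity>"
    proof -
      have "emeasure lebesgue (A n) \<le> emeasure lebesgue (box 0 1 :: (real^3) set)"
        by (rule emeasure_mono) (auto simp: A_def)
      also have "\<dots> < \<infinity>" by (simp add: emeasure_lborel_box_eq)
      finally show ?thesis .
    qed
    define e where "e = measure lebesgue (A n)"
    have e2: "emeasure lebesgue (A n) = ennreal e"
      unfolding e_def using fin by (intro emeasure_eq_ennreal_measure) auto
    have e: "0 < e" "emeasure lebesgue (A n) = ennreal e"
      using pos e2 by auto
    obtain T where T: "closed T" "T \<subseteq> A n" "(A n - T) \<in> lmeasurable" "emeasure lebesgue (A n - T) < ennreal e"
      using sets_lebesgue_inner_closed[OF Am e(1)] by blast
    have Tb: "T \<subseteq> box 0 1" using T(2) by (auto simp: A_def)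
    then have Tc: "compact T"
      using T(1) bounded_subset[OF bounded_box] by (simp add: compact_eq_bounded_closed) blast
    have Tm: "T \<in> lmeasurable" by (rule lmeasurable_compact[OF Tc])
    have "T \<notin> null_sets lebesgue"
    proof
      assume "T \<in> null_sets lebesgue"
      then have "emeasure lebesgue (A n - T) = emeasure lebesgue (A n)"
        using Am by (intro emeasure_Diff_null_set)
      then show False using T(4) e(2) by simp
    qed
    then have "emeasure lebesgue T \<noteq> 0" using fmeasurableD[OF Tm] by (simp add: null_sets_def)
    then have mT: "0 < measure lebesgue T"
      unfolding emeasure_eq_measure2[OF Tm] using measure_nonneg[of lebesgue T] by (simp add: less_le)
    have "0 < (1 / real (Suc n)) * measure lebesgue T" using mT by simp
    also have "\<dots> = (LINT x|lebesgue. indicator T x *\<^sub>R (1 / real (Suc n)))"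
      using Tm by simp
    also have "\<dots> \<le> (LINT x|lebesgue. indicator T x *\<^sub>R g x)"
    proof (rule integral_mono)
      show "integrable lebesgue (\<lambda>x. indicator T x *\<^sub>R (1 / real (Suc n)))"
        using Tm by (intro integrable_scaleR_left integrable_real_indicator) (auto simp: fmeasurable_def)
      have "integrable lebesgue (\<lambda>x. indicator T x *\<^sub>R (indicator (cbox 0 1) x *\<^sub>R g x))"
        using integrable_mult_indicator[OF _ g[unfolded set_integrable_def]] Tm by blast
      moreover have "(\<lambda>x. indicator T x *\<^sub>R (indicator (cbox 0 1) x *\<^sub>R g x)) = (\<lambda>x. indicator T x *\<^sub>R g x)"
        using Tb box_subset_cbox by (force simp: indicator_def fun_eq_iff)
      ultimately show "integrable lebesgue (\<lambda>x. indicator T x *\<^sub>R g x)" by simp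
      show "indicator T x *\<^sub>R (1 / real (Suc n)) \<le> indicator T x *\<^sub>R g x" for x
        using T(2) Tb box_subset_cbox[of "0::real^3" 1] by (force simp: A_def G_def indicator_def)
    qed
    also have "\<dots> = 0" using z[OF Tc Tb] by (simp add: set_lebesgue_integral_def)
    finally show False by simp
  qed
  have "(\<Union>n. A n) \<union> (cbox 0 1 - box 0 1) \<in> null_sets lebesgue"
    using negligible_frontier_interval[of "0::real^3" 1]
    by (intro null_sets.Un null_sets_UN A0) (simp add: negligible_iff_null_sets)
  then show ?thesis
  proof (rule AE_I')
    show "{x \<in> space lebesgue. \<not> (x \<in> cbox 0 1 \<longrightarrow> g x \<le> 0)} \<subseteq> (\<Union>n. A n) \<union> (cbox 0 1 - box 0 1)"
    proof
      fix x assume "x \<in> {x \<in> space lebesgue. \<not> (x \<in> cbox 0 1 \<longrightarrow> g x \<le> 0)}"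
      then have x: "x \<in> cbox 0 1" "0 < g x" by auto
      then obtain n where "1 / real (Suc n) < g x" using nat_approx_posE by blast
      then show "x \<in> (\<Union>n. A n) \<union> (cbox 0 1 - box 0 1)"
        using x by (auto simp: A_def G_def intro: exI[of _ n] less_imp_le)
    qed
  qed
qed

text \<open>The one-sided statement is applied to the real and imaginary parts and to their
  negatives, which leaves only zero.\<close>

theorem fourier_unique:
  assumes f: "set_integrable lebesgue (cbox 0 1) f"
    and coeff0: "\<And>k. torus_integral (\<lambda>x. f x * fourier_mode k x) = 0"
  shows "AE x in lebesgue. x \<in> cbox 0 1 \<longrightarrow> f x = 0"
proof -
  have part: "AE x in lebesgue. x \<in> cbox 0 1 \<longrightarrow> L (f x) \<le> 0"
    if L: "bounded_linear (L :: complex \<Rightarrow> real)" for L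
  proof (rule AE_nonpos_if_compact_integrals_zero)
    interpret bounded_linear L by fact
    show "set_integrable lebesgue (cbox 0 1) (\<lambda>x. L (f x))"
      using integrable_bounded_linear[OF L f[unfolded set_integrable_def]]
      by (simp add: set_integrable_def scaleR)
    fix K :: "(real ^ 3) set" assume K: "compact K" "K \<subseteq> box 0 1"
    have "integrable lebesgue (\<lambda>x. indicator K x *\<^sub>R (indicator (cbox 0 1) x *\<^sub>R f x))"
      using integrable_mult_indicator[OF _ f[unfolded set_integrable_def]] lmeasurable_compact[OF K(1)] by blast
    moreover have "(\<lambda>x. indicator K x *\<^sub>R (indicator (cbox 0 1) x *\<^sub>R f x)) = (\<lambda>x. indicator K x *\<^sub>R f x)"
      using K(2) box_subset_cbox by (force simp: indicator_def fun_eq_iff)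
    ultimately have i: "integrable lebesgue (\<lambda>x. indicator K x *\<^sub>R f x)" by simp
    have "(LINT x:K|lebesgue. L (f x)) = L (LINT x:K|lebesgue. f x)"
      unfolding set_lebesgue_integral_def using integral_bounded_linear[OF L i] by (simp add: scaleR)
    then show "(LINT x:K|lebesgue. L (f x)) = 0"
      by (simp add: integral_compact_zero[OF f coeff0 K] zero)
  qed
  have "AE x in lebesgue. x \<in> cbox 0 1 \<longrightarrow> Re (f x) \<le> 0" "AE x in lebesgue. x \<in> cbox 0 1 \<longrightarrow> - Re (f x) \<le> 0"
    "AE x in lebesgue. x \<in> cbox 0 1 \<longrightarrow> Im (f x) \<le> 0" "AE x in lebesgue. x \<in> cbox 0 1 \<longrightarrow> - Im (f x) \<le> 0"
    by (intro part bounded_linear_Re bounded_linear_Im bounded_linear_minus)+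
  then show ?thesis
    by eventually_elim (auto simp: complex_eq_iff)
qed

lemma cvec_nth [simp]: "cvec v $ i = complex_of_real (v $ i)"
  by (simp add: cvec_def)

lemma norm_vector_smult: "norm (a *s v) = norm a * norm v" for a :: complex and v :: "complex ^ 'n"
  by (simp add: norm_vec_def norm_mult L2_set_right_distrib)

lemma norm_mode_smult [simp]: "norm (fourier_mode k x *s v) = norm v" for v :: "complex ^ 'n"
  by (simp add: norm_vector_smult)

lemma torus_integral_mode_mult:
  "torus_integral (\<lambda>x. fourier_mode (- p) x * fourier_mode k x) = (if p = k then 1 else 0)"
proof -
  have "(\<lambda>x. fourier_mode (- p) x * fourier_mode k x) = fourier_mode (k - p)"
    by (simp add: fun_eq_iff fourier_mode_add[symmetric])
  then show ?thesis by (auto simp: torus_integral_fourier_mode)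
qed

lemma borel_measurable_indicator_cube:
  fixes f :: "real ^ 3 \<Rightarrow> complex"
  assumes "f \<in> borel_measurable lebesgue"
  shows "(\<lambda>x. indicator (cbox 0 1) x *\<^sub>R f x) \<in> borel_measurable lebesgue"
  by (rule borel_measurable_scaleR[OF borel_measurable_indicator assms]) simp

lemma torus_integral_cong_AE:
  assumes "f \<in> borel_measurable lebesgue" "g \<in> borel_measurable lebesgue" "AE x in lebesgue. f x = g x"
  shows "torus_integral f = torus_integral g"
  unfolding torus_integral_def set_lebesgue_integral_def
  by (rule integral_cong_AE)
    (use assms in \<open>auto intro!: borel_measurable_indicator_cube elim!: eventually_mono\<close>)

text \<open>The series below converge absolutely, so their partial sums are uniformly bounded and
  dominated convergence on the cube applies.\<close>

lemma torus_integral_LIMSEQ: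
  fixes F :: "nat \<Rightarrow> real ^ 3 \<Rightarrow> complex"
  assumes cont: "\<And>N. continuous_on UNIV (F N)" and bound: "\<And>N x. norm (F N x) \<le> W"
    and lim: "\<And>x. (\<lambda>N. F N x) \<longlonglongrightarrow> f x"
  shows "(\<lambda>N. torus_integral (F N)) \<longlonglongrightarrow> torus_integral f"
    and "f \<in> borel_measurable lebesgue"
    and "set_integrable lebesgue (cbox 0 1) f"
proof -
  have meas: "F N \<in> borel_measurable lebesgue" for N
    by (rule borel_measurable_lebesgue_continuous[OF cont])
  show f: "f \<in> borel_measurable lebesgue"
    by (rule borel_measurable_LIMSEQ_metric[OF meas lim])
  have Wi: "integrable lebesgue (\<lambda>x :: real^3. indicator (cbox 0 1) x *\<^sub>R W)"
    using set_integrable_cube_continuous[of "\<lambda>_. W"] by (simp add: set_integrable_def)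
  show "(\<lambda>N. torus_integral (F N)) \<longlonglongrightarrow> torus_integral f"
    unfolding torus_integral_def set_lebesgue_integral_def
  proof (rule integral_dominated_convergence[OF _ _ Wi])
    show "(\<lambda>x. indicator (cbox 0 1) x *\<^sub>R f x) \<in> borel_measurable lebesgue"
      "\<And>N. (\<lambda>x. indicator (cbox 0 1) x *\<^sub>R F N x) \<in> borel_measurable lebesgue"
      using f meas by (auto intro!: borel_measurable_indicator_cube)
    show "AE x in lebesgue. (\<lambda>N. indicator (cbox 0 1) x *\<^sub>R F N x) \<longlonglongrightarrow> indicator (cbox 0 1) x *\<^sub>R f x"
      by (intro AE_I2 tendsto_intros lim)
    show "AE x in lebesgue. norm (indicator (cbox 0 1) x *\<^sub>R F N x) \<le> indicator (cbox 0 1) x *\<^sub>R W" for N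
      using bound by (intro AE_I2) (auto simp: indicator_def)
  qed
  have fb: "norm (f x) \<le> W" for x
    by (rule LIMSEQ_le_const2[OF tendsto_norm[OF lim]]) (use bound in auto)
  show "set_integrable lebesgue (cbox 0 1) f"
    unfolding set_integrable_def
  proof (rule Bochner_Integration.integrable_bound[OF Wi borel_measurable_indicator_cube[OF f]])
    show "AE x in lebesgue. norm (indicator (cbox 0 1) x *\<^sub>R f x) \<le> norm (indicator (cbox 0 1) x *\<^sub>R W)"
      using fb by (intro AE_I2) (auto simp: indicator_def intro: order_trans[OF _ abs_ge_self])
  qed
qed

lemma L2_field_component_integrable:
  assumes "L2_field u"
  shows "set_integrable lebesgue (cbox 0 1) (\<lambda>x. complex_of_real (u x $ i))"
proof -
  have um: "u \<in> borel_measurable lebesgue" and u2: "set_integrable lebesgue (cbox 0 1) (\<lambda>x. (norm (u x))\<^sup>2)"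
    using assms by (auto simp: L2_field_def)
  have comp: "(\<lambda>x. complex_of_real (u x $ i)) \<in> borel_measurable lebesgue"
    by (rule measurable_compose[OF um]) (auto intro!: borel_measurable_continuous_onI continuous_intros)
  have 1: "set_integrable lebesgue (cbox 0 1) (\<lambda>_ :: real^3. 1::real)"
    by (intro set_integrable_cube_continuous continuous_intros)
  have "set_integrable lebesgue (cbox 0 1) (\<lambda>x. 1 + (norm (u x))\<^sup>2)"
    by (rule set_integral_add(1)[OF 1 u2])
  then show ?thesis
    unfolding set_integrable_def
  proof (rule Bochner_Integration.integrable_bound)
    show "(\<lambda>x. indicator (cbox 0 1) x *\<^sub>R complex_of_real (u x $ i)) \<in> borel_measurable lebesgue"
      using comp by (rule borel_measurable_indicator_cube)
    have "\<bar>u x $ i\<bar> \<le> 1 + (norm (u x))\<^sup>2" for x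
    proof -
      have "\<bar>u x $ i\<bar> \<le> norm (u x)" using component_le_norm_cart[of "u x" i] by simp
      moreover have "0 \<le> (norm (u x) - 1/2)\<^sup>2" by simp
      ultimately show ?thesis by (simp add: power2_eq_square algebra_simps)
    qed
    then show "AE x in lebesgue. norm (indicator (cbox 0 1) x *\<^sub>R complex_of_real (u x $ i))
        \<le> norm (indicator (cbox 0 1) x *\<^sub>R (1 + (norm (u x))\<^sup>2))"
      by (intro AE_I2) (auto simp: indicator_def intro: order_trans[OF _ abs_ge_self])
  qed
qed

lemma L2_field_mode_integrable:
  assumes "L2_field u"
  shows "set_integrable lebesgue (cbox 0 1) (\<lambda>x. complex_of_real (u x $ i) * fourier_mode k x)"
  by (rule set_integrable_bounded_mult[OF L2_field_component_integrable[OF assms], where B = 1]) auto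

text \<open>Countably many integer translates of an exceptional null set in the cell cover every
  exceptional point.\<close>

lemma AE_periodic:
  assumes ae: "AE x in lebesgue. x \<in> cbox 0 1 \<longrightarrow> P (x :: real ^ 3)"
    and per: "\<And>x k. P (x + freq k) \<longleftrightarrow> P x"
  shows "AE x in lebesgue. P x"
proof -
  obtain N where N: "N \<in> null_sets lebesgue" "{x. \<not> (x \<in> cbox 0 1 \<longrightarrow> P x)} \<subseteq> N"
    using ae unfolding eventually_ae_filter by auto
  have "negligible (\<Union>k. (+) (freq k) ` N)"
  proof (rule negligible_countable_Union)
    show "countable (range (\<lambda>k. (+) (freq k) ` N))" by simp
    show "negligible S" if "S \<in> range (\<lambda>k. (+) (freq k) ` N)" for S
      using that N(1) unfolding negligible_iff_null_sets[symmetric] by (auto intro: negligible_translation)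
  qed
  then show ?thesis
  proof (intro AE_I')
    show "(\<Union>k. (+) (freq k) ` N) \<in> null_sets lebesgue" if "negligible (\<Union>k. (+) (freq k) ` N)"
      using that by (simp add: negligible_iff_null_sets)
    show "{x \<in> space lebesgue. \<not> P x} \<subseteq> (\<Union>k. (+) (freq k) ` N)"
    proof
      fix x assume "x \<in> {x \<in> space lebesgue. \<not> P x}"
      then have nP: "\<not> P x" by simp
      define k :: "int ^ 3" where "k = (\<chi> i. \<lfloor>x $ i\<rfloor>)"
      define y where "y = x - freq k"
      have x: "x = y + freq k" by (simp add: y_def)
      have "y \<in> cbox 0 1" by (auto simp: y_def k_def mem_box_cart) linarith+
      moreover have "\<not> P y" using nP per[of y k] x by simp
      ultimately have "y \<in> N" using N(2) by blast
      then show "x \<in> (\<Union>k. (+) (freq k) ` N)" using x by (auto simp: add.commute)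
    qed
  qed
qed

text \<open>Points that \<open>B\<close> sends into a null set lie in the image of this set under
  the linear left inverse, and linear images of null sets are null.\<close>

lemma AE_compose_linear:
  assumes ae: "AE x in lebesgue. P (x :: real ^ 3)" and lin: "linear (B' :: real ^ 3 \<Rightarrow> real ^ 3)" and inv: "\<And>x. B' (B x) = x"
  shows "AE x in lebesgue. P (B x)"
proof -
  obtain N where N: "N \<in> null_sets lebesgue" "{x. \<not> P x} \<subseteq> N"
    using ae unfolding eventually_ae_filter by auto
  have "negligible (B' ` N)"
    using N(1) linear_imp_differentiable_on[OF lin, of N]
    by (intro negligible_differentiable_image_negligible) (auto simp: negligible_iff_null_sets)
  then show ?thesis
  proof (intro AE_I'[of "B' ` N"])
    show "{x \<in> space lebesgue. \<not> P (B x)} \<subseteq> B' ` N"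
      using N(2) by (force simp: inv intro: rev_image_eqI[of "B _"])
  qed (simp add: negligible_iff_null_sets)
qed

section \<open>Fourier series summed over finite shells\<close>

definition trig_part :: "(nat \<Rightarrow> (int ^ 3) set) \<Rightarrow> (int ^ 3 \<Rightarrow> complex ^ 3) \<Rightarrow> nat \<Rightarrow> real ^ 3 \<Rightarrow> complex ^ 3" where
  "trig_part S c N x = (\<Sum>k\<in>(\<Union>n<N. S n). fourier_mode (- k) x *s c k)"

text \<open>\<open>fourier_mode k\<close> is the kernel of the analysis integral, so synthesis uses
  \<open>- k\<close>. Grouping frequencies into finite blocks replaces a sum over the lattice by an
  ordinary series.\<close>

definition trig_series :: "(nat \<Rightarrow> (int ^ 3) set) \<Rightarrow> (int ^ 3 \<Rightarrow> complex ^ 3) \<Rightarrow> real ^ 3 \<Rightarrow> complex ^ 3" where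
  "trig_series S c x = (\<Sum>n. \<Sum>k\<in>S n. fourier_mode (- k) x *s c k)"

context
  fixes S :: "nat \<Rightarrow> (int ^ 3) set"
  assumes fin: "\<And>n. finite (S n)" and disj: "\<And>m n. m \<noteq> n \<Longrightarrow> S m \<inter> S n = {}"
begin

lemma trig_part_eq: "trig_part S c N x = (\<Sum>n<N. \<Sum>k\<in>S n. fourier_mode (- k) x *s c k)"
  unfolding trig_part_def using fin disj by (intro sum.UNION_disjoint) auto

lemma continuous_on_trig_part [continuous_intros]: "continuous_on X (trig_part S c N)"
proof -
  have "continuous_on X (\<lambda>x. fourier_mode (- k) x *s c k)" for k
    by (simp add: continuous_on_vec_lambda vector_scalar_mult_def continuous_intros)
  then show ?thesis unfolding trig_part_def[abs_def] by (intro continuous_intros)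
qed

lemma trig_part_nth: "trig_part S c N x $ i = (\<Sum>k\<in>(\<Union>n<N. S n). fourier_mode (- k) x * c k $ i)"
  by (simp add: trig_part_def)

lemma fin_UN: "finite (\<Union>n<N. S n)" using fin by auto

context
  fixes c :: "int ^ 3 \<Rightarrow> complex ^ 3"
  assumes sm: "summable (\<lambda>n. \<Sum>k\<in>S n. norm (c k))"
begin

definition "coeff_bound = (\<Sum>n. \<Sum>k\<in>S n. norm (c k))"

lemma norm_trig_part_le: "norm (trig_part S c N x) \<le> coeff_bound"
proof -
  have "norm (trig_part S c N x) \<le> (\<Sum>n<N. \<Sum>k\<in>S n. norm (fourier_mode (- k) x *s c k))"
    unfolding trig_part_eq by (intro order_trans[OF norm_sum] sum_mono norm_sum)
  also have "\<dots> \<le> coeff_bound"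
    unfolding coeff_bound_def using sm by (simp add: sum_le_suminf sum_nonneg)
  finally show ?thesis .
qed

lemma trig_part_tendsto: "(\<lambda>N. trig_part S c N x) \<longlonglongrightarrow> trig_series S c x"
proof -
  have "summable (\<lambda>n. \<Sum>k\<in>S n. fourier_mode (- k) x *s c k)"
    by (rule summable_comparison_test'[OF sm]) (rule order_trans[OF norm_sum], simp)
  then show ?thesis unfolding trig_part_eq trig_series_def by (rule summable_LIMSEQ)
qed

lemma norm_trig_series_le: "norm (trig_series S c x) \<le> coeff_bound"
  by (rule LIMSEQ_le_const2[OF tendsto_norm[OF trig_part_tendsto]]) (use norm_trig_part_le in auto)

text \<open>By orthogonality the coefficients of the partial sums are stationary once the block of
  \<open>k\<close> is included.\<close>

lemma trig_series_coeff:
  shows "torus_integral (\<lambda>x. trig_series S c x $ i * fourier_mode k x) = (if k \<in> (\<Union>n. S n) then c k $ i else 0)"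
    and "set_integrable lebesgue (cbox 0 1) (\<lambda>x. trig_series S c x $ i)"
    and "(\<lambda>x. trig_series S c x $ i) \<in> borel_measurable lebesgue"
proof -
  have part: "torus_integral (\<lambda>x. trig_part S c N x $ i * fourier_mode k x)
      = (if k \<in> (\<Union>n<N. S n) then c k $ i else 0)" for N
  proof -
    have "(\<lambda>x. trig_part S c N x $ i * fourier_mode k x)
        = (\<lambda>x. \<Sum>p\<in>(\<Union>n<N. S n). c p $ i * (fourier_mode (- p) x * fourier_mode k x))"
      by (simp add: trig_part_nth sum_distrib_left mult_ac)
    then have "torus_integral (\<lambda>x. trig_part S c N x $ i * fourier_mode k x)
        = (\<Sum>p\<in>(\<Union>n<N. S n). torus_integral (\<lambda>x. c p $ i * (fourier_mode (- p) x * fourier_mode k x)))"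
      by (simp only:) (intro torus_integral_sum set_integrable_cube_continuous continuous_intros)
    also have "\<dots> = (\<Sum>p\<in>(\<Union>n<N. S n). if p = k then c p $ i else 0)"
      by (intro sum.cong refl) (simp add: torus_integral_cmult torus_integral_mode_mult)
    also have "\<dots> = (if k \<in> (\<Union>n<N. S n) then c k $ i else 0)"
      using fin_UN by (simp add: sum.delta)
    finally show ?thesis .
  qed
  have nth_le: "norm (trig_part S c N x $ i) \<le> coeff_bound" for N x
    by (rule order_trans[OF Finite_Cartesian_Product.norm_nth_le norm_trig_part_le])
  have "(\<lambda>N. torus_integral (\<lambda>x. trig_part S c N x $ i * fourier_mode k x))
      \<longlonglongrightarrow> torus_integral (\<lambda>x. trig_series S c x $ i * fourier_mode k x)"
    by (rule torus_integral_LIMSEQ(1)[where W = coeff_bound])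
      (auto intro!: continuous_intros tendsto_intros trig_part_tendsto nth_le simp: norm_mult)
  moreover have "(\<lambda>N. torus_integral (\<lambda>x. trig_part S c N x $ i * fourier_mode k x))
      \<longlonglongrightarrow> (if k \<in> (\<Union>n. S n) then c k $ i else 0)"
  proof (cases "k \<in> (\<Union>n. S n)")
    case True
    then obtain n where n: "k \<in> S n" by blast
    have "torus_integral (\<lambda>x. trig_part S c N x $ i * fourier_mode k x) = c k $ i" if "N \<ge> Suc n" for N
      using n that unfolding part by (auto simp: Suc_le_eq)
    then show ?thesis using True by (intro tendsto_eventually) (auto simp: eventually_sequentially)
  next
    case False
    then show ?thesis unfolding part by simp
  qed
  ultimately show "torus_integral (\<lambda>x. trig_series S c x $ i * fourier_mode k x) = (if k \<in> (\<Union>n. S n) then c k $ i else 0)"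
    by (rule LIMSEQ_unique)
  have "continuous_on UNIV (\<lambda>x. trig_part S c N x $ i)" for N by (intro continuous_intros)
  moreover have "(\<lambda>N. trig_part S c N x $ i) \<longlonglongrightarrow> trig_series S c x $ i" for x
    by (intro tendsto_intros trig_part_tendsto)
  ultimately show "set_integrable lebesgue (cbox 0 1) (\<lambda>x. trig_series S c x $ i)"
    "(\<lambda>x. trig_series S c x $ i) \<in> borel_measurable lebesgue"
    by (rule torus_integral_LIMSEQ(3)[OF _ nth_le] torus_integral_LIMSEQ(2)[OF _ nth_le]; blast)+
qed

lemma trig_series_periodic: "trig_series S c (x + freq k) = trig_series S c x"
  by (simp add: trig_series_def fourier_mode_periodic)

end

text \<open>The difference has vanishing Fourier coefficients; uniqueness settles the cube and
  periodicity the rest of space.\<close>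

lemma AE_eq_trig_series:
  assumes u: "L2_field u" and supp: "\<And>k. k \<notin> (\<Union>n. S n) \<Longrightarrow> fhat u k = 0"
    and sm: "summable (\<lambda>n. \<Sum>k\<in>S n. norm (fhat u k))"
  shows "AE x in lebesgue. cvec (u x) = trig_series S (fhat u) x"
proof -
  note ts = trig_series_coeff[OF sm]
  have "AE x in lebesgue. x \<in> cbox 0 1 \<longrightarrow> complex_of_real (u x $ i) - trig_series S (fhat u) x $ i = 0" for i
  proof (rule fourier_unique)
    show "set_integrable lebesgue (cbox 0 1) (\<lambda>x. complex_of_real (u x $ i) - trig_series S (fhat u) x $ i)"
      by (intro set_integral_diff L2_field_component_integrable[OF u] ts)
    fix k
    have "torus_integral (\<lambda>x. complex_of_real (u x $ i) * fourier_mode k x - trig_series S (fhat u) x $ i * fourier_mode k x)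
       = fhat u k $ i - (if k \<in> (\<Union>n. S n) then fhat u k $ i else 0)"
      by (subst torus_integral_diff[OF L2_field_mode_integrable[OF u]
            set_integrable_bounded_mult[OF ts(2) borel_measurable_fourier_mode, where B = 1]])
        (simp_all add: ts(1) fhat_def)
    also have "\<dots> = 0" using supp[of k] by simp
    finally show "torus_integral (\<lambda>x. (complex_of_real (u x $ i) - trig_series S (fhat u) x $ i) * fourier_mode k x) = 0"
      by (simp add: left_diff_distrib)
  qed
  then have "AE x in lebesgue. \<forall>i. x \<in> cbox 0 1 \<longrightarrow> complex_of_real (u x $ i) - trig_series S (fhat u) x $ i = 0"
    unfolding AE_all_countable by blast
  then have "AE x in lebesgue. x \<in> cbox 0 1 \<longrightarrow> cvec (u x) = trig_series S (fhat u) x"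
    by eventually_elim (auto simp: vec_eq_iff)
  then show ?thesis
  proof (rule AE_periodic)
    have "u (x + freq k) = u x" for x k
      using u by (simp add: L2_field_def periodic_def)
    then show "(cvec (u (x + freq k)) = trig_series S (fhat u) (x + freq k)) = (cvec (u x) = trig_series S (fhat u) x)" for x k
      by (simp add: trig_series_periodic[OF sm])
  qed
qed

lemma fhat_of_trig_series:
  assumes um: "u \<in> borel_measurable lebesgue" and eq: "AE x in lebesgue. cvec (u x) = trig_series S c x"
    and sm: "summable (\<lambda>n. \<Sum>k\<in>S n. norm (c k))"
  shows "fhat u k = (if k \<in> (\<Union>n. S n) then c k else 0)"
proof -
  have "torus_integral (\<lambda>x. complex_of_real (u x $ i) * fourier_mode k x)
      = torus_integral (\<lambda>x. trig_series S c x $ i * fourier_mode k x)" for i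
  proof (rule torus_integral_cong_AE)
    show "AE x in lebesgue. complex_of_real (u x $ i) * fourier_mode k x = trig_series S c x $ i * fourier_mode k x"
      using eq by eventually_elim (metis cvec_nth)
    have "(\<lambda>x. complex_of_real (u x $ i)) \<in> borel_measurable lebesgue"
      by (rule measurable_compose[OF um]) (auto intro!: borel_measurable_continuous_onI continuous_intros)
    then show "(\<lambda>x. complex_of_real (u x $ i) * fourier_mode k x) \<in> borel_measurable lebesgue"
      by (intro borel_measurable_times borel_measurable_fourier_mode)
    show "(\<lambda>x. trig_series S c x $ i * fourier_mode k x) \<in> borel_measurable lebesgue"
      by (intro borel_measurable_times borel_measurable_fourier_mode trig_series_coeff[OF sm])
  qed
  then show ?thesis
    by (auto simp: fhat_def vec_eq_iff trig_series_coeff[OF sm])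
qed

text \<open>The symmetry may move points out of the unit cell (the mirror matrix does not preserve the
  integer lattice), so it is transported through the Fourier series instead of a change of
  variables.\<close>

lemma fhat_symmetry:
  assumes um: "u \<in> borel_measurable lebesgue" and rep: "AE x in lebesgue. cvec (u x) = trig_series S (fhat u) x"
    and sm: "summable (\<lambda>n. \<Sum>k\<in>S n. norm (fhat u k))"
    and sym: "AE x in lebesgue. cvec (u x) = A (cvec (u (B x)))"
    and A: "bounded_linear A" "\<And>a v. A (a *s v) = a *s A v"
    and B: "linear B" "linear B'" "\<And>x. B' (B x) = x"
    and \<tau>: "\<And>k x. k \<in> (\<Union>n. S n) \<Longrightarrow> fourier_mode (- k) (B x) = fourier_mode (- \<tau> k) x" "inj_on \<tau> (\<Union>n. S n)"
    and k: "k \<in> (\<Union>n. S n)"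
  shows "fhat u (\<tau> k) = A (fhat u k)"
proof -
  interpret A: bounded_linear A by (rule A(1))
  let ?c = "fhat u"
  obtain K where K: "0 < K" "\<And>v. norm (A v) \<le> norm v * K" using A.pos_bounded by blast
  have "AE x in lebesgue. cvec (u (B x)) = trig_series S ?c (B x)"
    by (rule AE_compose_linear[OF rep B(2,3)])
  with sym have eq: "AE x in lebesgue. cvec (u x) = A (trig_series S ?c (B x))"
    by eventually_elim simp
  have Bc: "continuous_on UNIV B" by (rule linear_continuous_on[OF linear_conv_bounded_linear[THEN iffD1, OF B(1)]])
  have "fhat u (\<tau> k) $ i = A (fhat u k) $ i" for i
  proof -
    define F where "F N x = A (trig_part S ?c N (B x)) $ i * fourier_mode (\<tau> k) x" for N x
    define f where "f x = A (trig_series S ?c (B x)) $ i * fourier_mode (\<tau> k) x" for x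
    have Fc: "continuous_on UNIV (F N)" for N
      unfolding F_def[abs_def]
      by (intro continuous_intros A.continuous_on continuous_on_compose2[OF continuous_on_trig_part Bc]) auto
    have Fb: "norm (F N x) \<le> coeff_bound ?c * K" for N x
    proof -
      have "norm (F N x) \<le> norm (A (trig_part S ?c N (B x)))"
        by (simp add: F_def norm_mult Finite_Cartesian_Product.norm_nth_le)
      also have "\<dots> \<le> norm (trig_part S ?c N (B x)) * K" by (rule K(2))
      also have "\<dots> \<le> coeff_bound ?c * K" using K(1) by (intro mult_right_mono norm_trig_part_le[OF sm]) auto
      finally show ?thesis .
    qed
    have Fl: "(\<lambda>N. F N x) \<longlonglongrightarrow> f x" for x
      unfolding F_def f_def by (intro tendsto_intros A.tendsto trig_part_tendsto[OF sm])
    note lim = torus_integral_LIMSEQ[of F, OF Fc Fb Fl]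
    \<comment> \<open>Composition with \<open>B\<close> turns the mode of \<open>p\<close> into that
      of \<open>\<tau> p\<close>, and injectivity of \<open>\<tau>\<close> isolates
      \<open>p = k\<close>.\<close>
    have Fi: "torus_integral (F N) = (if k \<in> (\<Union>n<N. S n) then A (?c k) $ i else 0)" for N
    proof -
      have "F N = (\<lambda>x. \<Sum>p\<in>(\<Union>n<N. S n). A (?c p) $ i * (fourier_mode (- \<tau> p) x * fourier_mode (\<tau> k) x))"
      proof
        fix x
        have "A (trig_part S ?c N (B x)) = (\<Sum>p\<in>(\<Union>n<N. S n). fourier_mode (- \<tau> p) x *s A (?c p))"
          unfolding trig_part_def A.sum A(2) using \<tau>(1) by (intro sum.cong) auto
        then show "F N x = (\<Sum>p\<in>(\<Union>n<N. S n). A (?c p) $ i * (fourier_mode (- \<tau> p) x * fourier_mode (\<tau> k) x))"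
          by (simp add: F_def sum_distrib_left mult_ac)
      qed
      then have "torus_integral (F N)
          = (\<Sum>p\<in>(\<Union>n<N. S n). torus_integral (\<lambda>x. A (?c p) $ i * (fourier_mode (- \<tau> p) x * fourier_mode (\<tau> k) x)))"
        by (simp only:) (intro torus_integral_sum set_integrable_cube_continuous continuous_intros)
      also have "\<dots> = (\<Sum>p\<in>(\<Union>n<N. S n). if p = k then A (?c p) $ i else 0)"
        using \<tau>(2) k by (intro sum.cong refl)
          (auto simp: torus_integral_cmult torus_integral_mode_mult dest: inj_onD)
      also have "\<dots> = (if k \<in> (\<Union>n<N. S n) then A (?c k) $ i else 0)"
        using fin_UN by (simp add: sum.delta)
      finally show ?thesis .
    qed
    obtain n where n: "k \<in> S n" using k by blast
    have "torus_integral (F N) = A (?c k) $ i" if "N \<ge> Suc n" for N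
      using n that unfolding Fi by (auto simp: Suc_le_eq)
    then have "(\<lambda>N. torus_integral (F N)) \<longlonglongrightarrow> A (?c k) $ i"
      by (intro tendsto_eventually) (auto simp: eventually_sequentially)
    then have "torus_integral f = A (?c k) $ i" using lim(1) LIMSEQ_unique by blast
    moreover have "fhat u (\<tau> k) $ i = torus_integral f"
      unfolding fhat_def vec_lambda_beta
    proof (rule torus_integral_cong_AE)
      have "(\<lambda>x. complex_of_real (u x $ i)) \<in> borel_measurable lebesgue"
        by (rule measurable_compose[OF um]) (auto intro!: borel_measurable_continuous_onI continuous_intros)
      then show "(\<lambda>x. complex_of_real (u x $ i) * fourier_mode (\<tau> k) x) \<in> borel_measurable lebesgue"
        by (intro borel_measurable_times borel_measurable_fourier_mode)
      show "f \<in> borel_measurable lebesgue" by (rule lim(2))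
      show "AE x in lebesgue. complex_of_real (u x $ i) * fourier_mode (\<tau> k) x = f x"
        using eq by eventually_elim (metis cvec_nth f_def)
    qed
    ultimately show ?thesis by simp
  qed
  then show ?thesis by (simp add: vec_eq_iff)
qed

text \<open>The convolution formula with square truncations: each truncation is a finite sum, and
  bounded convergence of the partial products replaces any rearrangement of a double series.\<close>

lemma torus_integral_product_tendsto:
  assumes um: "u \<in> borel_measurable lebesgue" and rep: "AE x in lebesgue. cvec (u x) = trig_series S c x"
    and sm: "summable (\<lambda>n. \<Sum>k\<in>S n. norm (c k))"
  shows "(\<lambda>N. \<Sum>p\<in>(\<Union>n<N. S n). \<Sum>q\<in>(\<Union>n<N. S n). if p + q = k then c p $ i * c q $ j else 0)
      \<longlonglongrightarrow> torus_integral (\<lambda>x. complex_of_real (u x $ i * u x $ j) * fourier_mode k x)" (is ?lim)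
    and "set_integrable lebesgue (cbox 0 1) (\<lambda>x. complex_of_real (u x $ i * u x $ j) * fourier_mode k x)" (is ?int)
proof -
  define F where "F N x = trig_part S c N x $ i * trig_part S c N x $ j * fourier_mode k x" for N x
  define f where "f x = trig_series S c x $ i * trig_series S c x $ j * fourier_mode k x" for x
  have Fc: "continuous_on UNIV (F N)" for N
    unfolding F_def[abs_def] by (intro continuous_intros)
  have Fb: "norm (F N x) \<le> coeff_bound c * coeff_bound c" for N x
  proof -
    have *: "norm (trig_part S c N x $ l) \<le> coeff_bound c" for l
      using Finite_Cartesian_Product.norm_nth_le[of "trig_part S c N x" l] norm_trig_part_le[OF sm, of N x] by linarith
    then show ?thesis
      unfolding F_def by (simp add: norm_mult) (intro mult_mono *, auto intro: order_trans[OF norm_ge_zero *])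
  qed
  have Fl: "(\<lambda>N. F N x) \<longlonglongrightarrow> f x" for x
    unfolding F_def f_def by (intro tendsto_intros trig_part_tendsto[OF sm])
  note lim = torus_integral_LIMSEQ[of F, OF Fc Fb Fl]
  have Fi: "torus_integral (F N) = (\<Sum>p\<in>(\<Union>n<N. S n). \<Sum>q\<in>(\<Union>n<N. S n). if p + q = k then c p $ i * c q $ j else 0)" for N
  proof -
    have "F N = (\<lambda>x. \<Sum>p\<in>(\<Union>n<N. S n). \<Sum>q\<in>(\<Union>n<N. S n). (c p $ i * c q $ j) * (fourier_mode (- (p + q)) x * fourier_mode k x))"
    proof
      have m: "fourier_mode (- (p + q)) x = fourier_mode (- p) x * fourier_mode (- q) x" for p q x
        by (simp only: minus_add_distrib fourier_mode_add)
      show "F N x = (\<Sum>p\<in>(\<Union>n<N. S n). \<Sum>q\<in>(\<Union>n<N. S n). (c p $ i * c q $ j) * (fourier_mode (- (p + q)) x * fourier_mode k x))" for x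
        unfolding F_def trig_part_nth sum_product unfolding sum_distrib_right m by (simp only: mult_ac)
    qed
    then have "torus_integral (F N) = (\<Sum>p\<in>(\<Union>n<N. S n). \<Sum>q\<in>(\<Union>n<N. S n).
        torus_integral (\<lambda>x. (c p $ i * c q $ j) * (fourier_mode (- (p + q)) x * fourier_mode k x)))"
      by (simp only:) (subst torus_integral_sum | intro set_integrable_cube_continuous continuous_intros sum.cong refl)+
    also have "\<dots> = (\<Sum>p\<in>(\<Union>n<N. S n). \<Sum>q\<in>(\<Union>n<N. S n). if p + q = k then c p $ i * c q $ j else 0)"
      by (intro sum.cong refl) (simp only: torus_integral_cmult torus_integral_mode_mult, simp)
    finally show ?thesis .
  qed
  have gm: "(\<lambda>x. complex_of_real (u x $ i * u x $ j) * fourier_mode k x) \<in> borel_measurable lebesgue"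
  proof -
    have "(\<lambda>x. complex_of_real (u x $ i * u x $ j)) \<in> borel_measurable lebesgue"
      by (rule measurable_compose[OF um]) (auto intro!: borel_measurable_continuous_onI continuous_intros)
    then show ?thesis by (intro borel_measurable_times borel_measurable_fourier_mode)
  qed
  have ae: "AE x in lebesgue. complex_of_real (u x $ i * u x $ j) * fourier_mode k x = f x"
    using rep by eventually_elim (metis cvec_nth f_def of_real_mult)
  have "torus_integral (\<lambda>x. complex_of_real (u x $ i * u x $ j) * fourier_mode k x) = torus_integral f"
    by (rule torus_integral_cong_AE[OF gm lim(2) ae])
  then show ?lim using lim(1) unfolding Fi by simp
  have "integrable lebesgue (\<lambda>x. indicator (cbox 0 1) x *\<^sub>R (complex_of_real (u x $ i * u x $ j) * fourier_mode k x))
      = integrable lebesgue (\<lambda>x. indicator (cbox 0 1) x *\<^sub>R f x)"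
    by (rule integrable_cong_AE) (use gm lim(2) ae in \<open>auto intro!: borel_measurable_indicator_cube elim!: eventually_mono\<close>)
  then show ?int using lim(3) by (simp add: set_integrable_def)
qed

end

lemma frechet_derivative_fourier_mode:
  "frechet_derivative (fourier_mode k) (at x) (axis j 1)
     = - 2 * complex_of_real pi * \<i> * of_int (k $ j) * fourier_mode k x"
proof -
  have "(fourier_mode k has_derivative (\<lambda>h. fourier_mode k x * (- 2 * complex_of_real pi * \<i> * complex_of_real (freq k \<bullet> h)))) (at x)"
  proof -
    have "bounded_linear (\<lambda>h. - 2 * complex_of_real pi * \<i> * complex_of_real (freq k \<bullet> h))"
      by (rule bounded_linear_compose[OF bounded_linear_mult_right
            bounded_linear_compose[OF bounded_linear_of_real bounded_linear_inner_right]])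
    from has_derivative_compose[OF bounded_linear_imp_has_derivative[OF this]
        DERIV_exp[THEN has_field_derivative_imp_has_derivative]]
    show ?thesis unfolding fourier_mode_def[abs_def] by (simp add: mult.commute)
  qed
  from fun_cong[OF frechet_derivative_at[OF this], of "axis j 1"] show ?thesis
    by (simp add: inner_axis mult_ac)
qed

section \<open>The shells and their triads\<close>

definition tri :: "int \<times> int \<times> int \<Rightarrow> int ^ 3" where
  "tri w = vector [fst w, fst (snd w), snd (snd w)]"

lemma tri_nth [simp]: "tri (a, b, c) $ 1 = a" "tri (a, b, c) $ 2 = b" "tri (a, b, c) $ 3 = c"
  by (simp_all add: tri_def vector_3)

lemma tri_eqI: "v $ 1 = a \<Longrightarrow> v $ 2 = b \<Longrightarrow> v $ 3 = c \<Longrightarrow> v = tri (a, b, c)"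
  by (simp add: vec_eq_iff forall_3)

lemma inj_tri: "inj tri"
  by (rule injI) (auto simp: vec_eq_iff forall_3 tri_def vector_3 prod_eq_iff)

definition scale3 :: "int \<Rightarrow> int \<times> int \<times> int \<Rightarrow> int \<times> int \<times> int" where
  "scale3 s w = (s * fst w, s * fst (snd w), s * snd (snd w))"

lemma tri_diff: "tri (v - w) = tri v - tri w"
  by (simp add: vec_eq_iff forall_3 tri_def vector_3)

lemma tri_scale3: "tri (scale3 s w) = s *s tri w"
  by (simp add: vec_eq_iff forall_3 tri_def vector_3 scale3_def)

lemma bij_3_cases:
  fixes p :: "3 \<Rightarrow> 3"
  assumes "bij p"
  shows "(p 1, p 2, p 3) \<in> {(1, 2, 3), (1, 3, 2), (2, 1, 3), (2, 3, 1), (3, 1, 2), (3, 2, 1)}"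
proof -
  have "p 1 \<noteq> p 2" "p 1 \<noteq> p 3" "p 2 \<noteq> p 3"
    using assms by (auto simp: bij_def dest: injD)
  then show ?thesis
    using exhaust_3[of "p 1"] exhaust_3[of "p 2"] exhaust_3[of "p 3"]
    unfolding insert_iff prod.inject empty_iff by metis
qed

lemma bij_3:
  fixes a b c :: 3
  assumes "a \<noteq> b" "a \<noteq> c" "b \<noteq> c"
  shows "bij (\<lambda>i::3. if i = 1 then a else if i = 2 then b else c)"
proof -
  have inj: "inj (\<lambda>i::3. if i = 1 then a else if i = 2 then b else c)"
    using assms by (auto intro!: injI split: if_splits) (metis exhaust_3)+
  show ?thesis by (rule bijI[OF inj finite_UNIV_inj_surj[OF finite_class.finite_UNIV inj]])
qed

lemma perms_tri:
  "perms (tri (a, b, c)) = tri ` {(a, b, c), (a, c, b), (b, a, c), (b, c, a), (c, a, b), (c, b, a)}"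
proof
  show "perms (tri (a, b, c)) \<subseteq> tri ` {(a, b, c), (a, c, b), (b, a, c), (b, c, a), (c, a, b), (c, b, a)}"
  proof
    fix v assume "v \<in> perms (tri (a, b, c))"
    then obtain p where p: "bij p" "v = permute_vec p (tri (a, b, c))" by (auto simp: perms_def)
    have "v = tri (v $ 1, v $ 2, v $ 3)" by (rule tri_eqI) auto
    moreover have "(v $ 1, v $ 2, v $ 3) \<in> {(a, b, c), (a, c, b), (b, a, c), (b, c, a), (c, a, b), (c, b, a)}"
    proof -
      have v: "v $ 1 = tri (a, b, c) $ p 1" "v $ 2 = tri (a, b, c) $ p 2" "v $ 3 = tri (a, b, c) $ p 3"
        by (simp_all add: p(2) permute_vec_def)
      show ?thesis
        using bij_3_cases[OF p(1)] unfolding v insert_iff prod.inject empty_iff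
        by (elim disjE conjE FalseE) (simp_all only: tri_nth simp_thms)
    qed
    ultimately show "v \<in> tri ` {(a, b, c), (a, c, b), (b, a, c), (b, c, a), (c, a, b), (c, b, a)}" by blast
  qed
  have mem: "tri (tri (a, b, c) $ i, tri (a, b, c) $ j, tri (a, b, c) $ l) \<in> perms (tri (a, b, c))"
    if "i \<noteq> j" "i \<noteq> l" "j \<noteq> l" for i j l :: 3
    unfolding perms_def
    by (intro CollectI exI[of _ "\<lambda>m. if m = 1 then i else if m = 2 then j else l"] conjI bij_3[OF that])
      (auto simp: vec_eq_iff forall_3 permute_vec_def)
  show "tri ` {(a, b, c), (a, c, b), (b, a, c), (b, c, a), (c, a, b), (c, b, a)} \<subseteq> perms (tri (a, b, c))"
    using mem[of 1 2 3] mem[of 1 3 2] mem[of 2 1 3] mem[of 2 3 1] mem[of 3 1 2] mem[of 3 2 1] by auto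
qed

text \<open>Offsets from the diagonal divided by \<open>3^(n div 2)\<close>: vertices of a regular
  hexagon in the plane of zero coordinate sum, the short roots of G2 for even \<open>n\<close> and
  the long ones for odd \<open>n\<close>. Lists of triples make the incidence counts below finite
  computations.\<close>

definition hexagon :: "nat \<Rightarrow> (int \<times> int \<times> int) list" where
  "hexagon n = (if even n
     then [(1, 0, -1), (1, -1, 0), (0, 1, -1), (0, -1, 1), (-1, 1, 0), (-1, 0, 1)]
     else [(1, 1, -2), (1, -2, 1), (-2, 1, 1), (2, -1, -1), (-1, 2, -1), (-1, -1, 2)])"

definition lift :: "nat \<Rightarrow> int \<times> int \<times> int \<Rightarrow> int ^ 3" where
  "lift n w = 2 ^ n *s tri (1, 1, 1) + 3 ^ (n div 2) *s tri w"

lemma perms_lift: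
  "perms (x *s tri (1, 1, 1) + y *s tri w) = (\<lambda>v. x *s tri (1, 1, 1) + y *s v) ` perms (tri w)"
proof -
  have "permute_vec p (x *s tri (1, 1, 1) + y *s tri w) = x *s tri (1, 1, 1) + y *s permute_vec p (tri w)" for p
  proof -
    have "tri (1, 1, 1) $ i = 1" for i using exhaust_3[of i] by auto
    then show ?thesis by (simp add: vec_eq_iff permute_vec_def)
  qed
  then show ?thesis unfolding perms_def by auto
qed

lemma vector_tri: "vector [a, b, c] = tri (a, b, c)"
  by (simp add: tri_def)

lemma shell_eq: "shell n = lift n ` set (hexagon n)"
proof (cases "even n")
  case True
  then have "2 ^ (2 * (n div 2)) = (2::int) ^ n" by simp
  then show ?thesis
    using True by (simp add: shell_def k_vec_def vector_tri perms_lift perms_tri hexagon_def lift_def insert_commute)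
next
  case False
  then have e: "2 * (n div 2) + 1 = n" by presburger
  have h: "perms (h_vec (n div 2)) = (\<lambda>v. 2 ^ n *s tri (1, 1, 1) + 3 ^ (n div 2) *s v) ` perms (tri (1, 1, -2))"
    and j: "perms (j_vec (n div 2)) = (\<lambda>v. 2 ^ n *s tri (1, 1, 1) + 3 ^ (n div 2) *s v) ` perms (tri (2, -1, -1))"
    unfolding h_vec_def j_vec_def e vector_tri by (rule perms_lift)+
  show ?thesis
    using False unfolding shell_def h j by (auto simp: perms_tri hexagon_def lift_def)
qed

lemma inj_lift: "inj (lift n)"
proof (rule injI)
  fix v w assume "lift n v = lift n w"
  then have "tri v = tri w" by (simp add: lift_def vec_eq_iff)
  then show "v = w" by (rule injD[OF inj_tri])
qed

lemma distinct_hexagon: "distinct (hexagon n)"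
  by (simp add: hexagon_def)

lemma finite_shell: "finite (shell n)"
  by (simp add: shell_eq)

lemma card_shell: "card (shell n) = 6"
  unfolding shell_eq
  by (subst card_image[OF inj_on_subset[OF inj_lift subset_UNIV]]) (auto simp: distinct_card[OF distinct_hexagon], simp add: hexagon_def)

text \<open>The factor by which the offset scale grows to the next shell,
  \<open>3^(Suc n div 2) / 3^(n div 2)\<close>.\<close>

definition ratio :: "nat \<Rightarrow> int" where
  "ratio n = (if even n then 1 else 3)"

lemma hexagon_cong:
  "even n \<Longrightarrow> hexagon n = hexagon 0 \<and> hexagon (Suc n) = hexagon 1"
  "odd n \<Longrightarrow> hexagon n = hexagon 1 \<and> hexagon (Suc n) = hexagon 0"
  by (simp_all add: hexagon_def)

text \<open>Along the diagonal \<open>2^(n+1) - 2^n = 2^n\<close>, so the difference sits again at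
  the height of shell \<open>n\<close> and triads become relations between hexagon offsets.\<close>

lemma lift_Suc: "lift (Suc n) w - lift n p = lift n (scale3 (ratio n) w - p)"
proof -
  have "3 ^ (Suc n div 2) = ratio n * 3 ^ (n div 2)"
    by (cases "even n") (auto simp: ratio_def elim!: oddE evenE)
  then show ?thesis
    by (simp add: lift_def tri_diff tri_scale3 vec_eq_iff algebra_simps)
qed

lemma card_filter_image:
  assumes "inj f" "distinct xs"
  shows "card {y \<in> f ` set xs. P y} = length (filter (P \<circ> f) xs)"
proof -
  have "{y \<in> f ` set xs. P y} = f ` set (filter (P \<circ> f) xs)" by auto
  then show ?thesis
    using assms by (simp add: card_image inj_on_subset[OF assms(1) subset_UNIV] distinct_card del: set_filter)
qed

lemma shell_mem_lift: "lift n v \<in> shell n \<longleftrightarrow> v \<in> set (hexagon n)"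
  unfolding shell_eq by (simp add: inj_image_mem_iff[OF inj_lift])

text \<open>A vertex of the next hexagon, scaled by \<open>ratio\<close>, is the sum of two adjacent
  vertices of the current one, e.g. \<open>(1,1,-2) = (1,0,-1) + (0,1,-1)\<close>, and in no other
  way; the two orders are counted separately. Parity reduces the check to two hexagons.\<close>

lemma card_shell_decompositions:
  assumes "k \<in> shell (Suc n)"
  shows "card {p \<in> shell n. k - p \<in> shell n} = 2"
proof -
  obtain w where w: "w \<in> set (hexagon (Suc n))" "k = lift (Suc n) w" using assms by (auto simp: shell_eq)
  have "card {p \<in> shell n. k - p \<in> shell n} = length (filter ((\<lambda>p. k - p \<in> shell n) \<circ> lift n) (hexagon n))"
    unfolding shell_eq[of n] by (rule card_filter_image[OF inj_lift distinct_hexagon])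
  also have "(\<lambda>p. k - p \<in> shell n) \<circ> lift n = (\<lambda>p. scale3 (ratio n) w - p \<in> set (hexagon n))"
    unfolding w(2) comp_def lift_Suc shell_mem_lift ..
  also have "length (filter (\<lambda>p. scale3 (ratio n) w - p \<in> set (hexagon n)) (hexagon n)) = 2"
  proof -
    have "\<forall>w\<in>set (hexagon 1). length (filter (\<lambda>p. scale3 1 w - p \<in> set (hexagon 0)) (hexagon 0)) = 2"
      "\<forall>w\<in>set (hexagon 0). length (filter (\<lambda>p. scale3 3 w - p \<in> set (hexagon 1)) (hexagon 1)) = 2"
      by (simp_all add: hexagon_def scale3_def)
    then show ?thesis using w(1) hexagon_cong[of n] by (cases "even n") (simp_all add: ratio_def)
  qed
  finally show ?thesis .
qed

lemma lift_add_mem: "lift n w + lift n q \<in> shell (Suc n) \<longleftrightarrow> w + q \<in> scale3 (ratio n) ` set (hexagon (Suc n))"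
proof -
  have "lift n w + lift n q = lift (Suc n) r \<longleftrightarrow> w + q = scale3 (ratio n) r" for r
  proof -
    have "lift n w + lift n q = lift (Suc n) r \<longleftrightarrow> lift n w = lift (Suc n) r - lift n q"
      by (simp only: eq_diff_eq)
    also have "\<dots> \<longleftrightarrow> w = scale3 (ratio n) r - q"
      unfolding lift_Suc by (rule inj_eq[OF inj_lift])
    finally show ?thesis by (simp only: eq_diff_eq)
  qed
  then show ?thesis unfolding shell_eq by auto
qed

text \<open>The two partners are the neighbours of \<open>k\<close> on its hexagon.\<close>

lemma card_shell_complements:
  assumes "k \<in> shell n"
  shows "card {q \<in> shell n. k + q \<in> shell (Suc n)} = 2"
proof -
  obtain w where w: "w \<in> set (hexagon n)" "k = lift n w" using assms by (auto simp: shell_eq)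
  have "card {q \<in> shell n. k + q \<in> shell (Suc n)} = length (filter ((\<lambda>q. k + q \<in> shell (Suc n)) \<circ> lift n) (hexagon n))"
    unfolding shell_eq[of n] by (rule card_filter_image[OF inj_lift distinct_hexagon])
  also have "(\<lambda>q. k + q \<in> shell (Suc n)) \<circ> lift n = (\<lambda>q. w + q \<in> scale3 (ratio n) ` set (hexagon (Suc n)))"
    unfolding w(2) comp_def lift_add_mem ..
  also have "length (filter (\<lambda>q. w + q \<in> scale3 (ratio n) ` set (hexagon (Suc n))) (hexagon n)) = 2"
  proof -
    have "\<forall>w\<in>set (hexagon 0). length (filter (\<lambda>q. w + q \<in> scale3 1 ` set (hexagon 1)) (hexagon 0)) = 2"
      "\<forall>w\<in>set (hexagon 1). length (filter (\<lambda>q. w + q \<in> scale3 3 ` set (hexagon 0)) (hexagon 1)) = 2"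
      by (simp_all add: hexagon_def scale3_def)
    then show ?thesis using w(1) hexagon_cong[of n] by (cases "even n") (simp_all add: ratio_def)
  qed
  finally show ?thesis .
qed

section \<open>Lengths, polarisation vectors and triad strengths\<close>

definition coord_sum :: "int ^ 3 \<Rightarrow> int" where
  "coord_sum k = k $ 1 + k $ 2 + k $ 3"

lemma coord_sum_add: "coord_sum (k + l) = coord_sum k + coord_sum l"
  by (simp add: coord_sum_def)

lemma coord_sum_minus: "coord_sum (- k) = - coord_sum k"
  by (simp add: coord_sum_def)

lemma coord_sum_shell: "k \<in> shell n \<Longrightarrow> coord_sum k = 3 * 2 ^ n"
  unfolding shell_eq by (auto simp: hexagon_def lift_def coord_sum_def split: if_splits)

lemma shell_unique: "k \<in> shell m \<Longrightarrow> k \<in> shell n \<Longrightarrow> m = n"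
  using coord_sum_shell[of k m] coord_sum_shell[of k n] by simp

lemma neg_notin_shell: "k \<in> shell m \<Longrightarrow> - k \<notin> shell n"
proof
  assume "k \<in> shell m" "- k \<in> shell n"
  then have "3 * 2 ^ n = - (3 * 2 ^ m :: int)"
    using coord_sum_shell coord_sum_minus by metis
  moreover have "(0::int) < 2 ^ n" "(0::int) < 2 ^ m" by simp_all
  ultimately show False by linarith
qed

lemma zero_notin_shell: "0 \<notin> shell n"
  using coord_sum_shell[of 0 n] by (auto simp: coord_sum_def)

lemma freq_inner_sigma: "freq k \<bullet> sigma_vec = of_int (coord_sum k)"
  by (simp add: inner_vec_def sigma_vec_def sum_3 coord_sum_def)

lemma freq_inner_sigma_shell: "k \<in> shell n \<Longrightarrow> freq k \<bullet> sigma_vec = 3 * 2 ^ n"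
  by (simp add: freq_inner_sigma coord_sum_shell)

text \<open>Squared length on shell \<open>n\<close>: the diagonal part gives
  \<open>3 * 4^n\<close>, and the orthogonal offset gives \<open>2 * 9^m\<close> or
  \<open>6 * 9^m\<close> for \<open>n = 2m\<close> or \<open>2m + 1\<close>, which is
  \<open>2 * 3^n\<close> in both cases.\<close>

definition freq_sq :: "nat \<Rightarrow> real" where
  "freq_sq n = 3 * 4 ^ n + 2 * 3 ^ n"

lemma freq_sq_pos: "0 < freq_sq n"
  by (simp add: freq_sq_def add_pos_pos)

lemma norm_freq_shell: "k \<in> shell n \<Longrightarrow> (norm (freq k))\<^sup>2 = freq_sq n"
proof -
  assume "k \<in> shell n"
  then obtain w where w: "w \<in> set (hexagon n)" "k = lift n w" by (auto simp: shell_eq)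
  obtain a b c where abc: "w = (a, b, c)" by (cases w) auto
  have s: "a + b + c = 0" "a * a + b * b + c * c = (if even n then 2 else 6)"
    using w(1) unfolding abc by (auto simp: hexagon_def split: if_splits)
  define X Y where "X = (2::int) ^ n" and "Y = (3::int) ^ (n div 2)"
  have "(norm (freq k))\<^sup>2 = of_int ((X + Y * a) * (X + Y * a) + (X + Y * b) * (X + Y * b) + (X + Y * c) * (X + Y * c))"
    unfolding power2_norm_eq_inner w(2) abc by (simp add: inner_vec_def sum_3 lift_def X_def Y_def)
  also have "(X + Y * a) * (X + Y * a) + (X + Y * b) * (X + Y * b) + (X + Y * c) * (X + Y * c)
      = 3 * (X * X) + 2 * X * Y * (a + b + c) + Y * Y * (a * a + b * b + c * c)"
    by (simp add: algebra_simps)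
  also have "\<dots> = 3 * (X * X) + Y * Y * (if even n then 2 else 6)"
    unfolding s by simp
  also have "X * X = 4 ^ n" by (simp add: X_def power_mult_distrib[symmetric])
  also have "Y * Y * (if even n then 2 else 6) = 2 * 3 ^ n"
  proof -
    have "3 ^ n = (if even n then Y * Y else 3 * (Y * Y))"
      unfolding Y_def by (cases "even n") (auto elim!: evenE oddE simp: power_add[symmetric] mult_2)
    then show ?thesis by auto
  qed
  finally show ?thesis by (simp add: freq_sq_def)
qed

lemma sigma_inner_sigma: "sigma_vec \<bullet> sigma_vec = 3"
  by (simp add: sigma_vec_def inner_vec_def sum_3)

lemma freq_inner_sigma_perp: "freq k \<bullet> sigma_perp k = 0"
  by (cases "freq k = 0") (simp_all add: sigma_perp_def inner_diff_right power2_norm_eq_inner)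

text \<open>For an orthogonal projection the squared length equals the inner product with
  \<open>sigma_vec\<close>, here \<open>3 - 9 * 4^n / freq_sq n\<close>.\<close>

lemma norm_sigma_perp_shell:
  assumes "k \<in> shell n"
  shows "(norm (sigma_perp k))\<^sup>2 = 6 * 3 ^ n / freq_sq n"
    and "sigma_perp k \<bullet> sigma_vec = 6 * 3 ^ n / freq_sq n"
proof -
  have "sigma_perp k \<bullet> sigma_vec = 3 - (3 * 2 ^ n) * (3 * 2 ^ n) / freq_sq n"
    unfolding sigma_perp_def inner_diff_left inner_scaleR_left sigma_inner_sigma
      freq_inner_sigma_shell[OF assms] norm_freq_shell[OF assms] by simp
  also have "\<dots> = 6 * 3 ^ n / freq_sq n"
  proof -
    have "(2::real) ^ n * 2 ^ n = 4 ^ n" by (simp add: power_mult_distrib[symmetric])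
    then show ?thesis using freq_sq_pos[of n] by (simp add: field_simps) (simp add: freq_sq_def)
  qed
  finally show s: "sigma_perp k \<bullet> sigma_vec = 6 * 3 ^ n / freq_sq n" .
  have "(norm (sigma_perp k))\<^sup>2 = sigma_perp k \<bullet> sigma_perp k" by (rule power2_norm_eq_inner)
  also have "\<dots> = sigma_perp k \<bullet> (sigma_vec - ((freq k \<bullet> sigma_vec) / (norm (freq k))\<^sup>2) *\<^sub>R freq k)"
    by (simp only: sigma_perp_def)
  also have "\<dots> = sigma_perp k \<bullet> sigma_vec"
    using freq_inner_sigma_perp[of k] by (simp add: inner_diff_right inner_commute)
  finally show "(norm (sigma_perp k))\<^sup>2 = 6 * 3 ^ n / freq_sq n" using s by simp
qed

definition perp_len :: "nat \<Rightarrow> real" where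
  "perp_len n = sqrt (6 * 3 ^ n / freq_sq n)"

lemma perp_len_pos: "0 < perp_len n"
  using freq_sq_pos[of n] by (simp add: perp_len_def)

lemma norm_sigma_perp: "k \<in> shell n \<Longrightarrow> norm (sigma_perp k) = perp_len n"
  using norm_sigma_perp_shell(1)[of k n] by (simp add: perp_len_def real_sqrt_unique)

lemma sigma_perp_minus: "sigma_perp (- k) = sigma_perp k"
  by (simp add: sigma_perp_def freq_minus)

lemma dir_minus: "dir (- k) = dir k"
  by (simp add: dir_def sigma_perp_minus)

lemma norm_dir: "k \<in> shell n \<Longrightarrow> norm (dir k) = 1"
  using norm_sigma_perp[of k n] perp_len_pos[of n] by (simp add: dir_def)

lemma freq_inner_dir: "freq k \<bullet> dir k = 0"
  by (simp add: dir_def freq_inner_sigma_perp)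

text \<open>\<open>1 / sqrt q\<close> where \<open>freq_sq (Suc n) = 3 * 4^Suc n * q\<close>: what
  remains of the interaction strength after a pure power of \<open>sqrt 3\<close> is extracted. It
  tends to 1.\<close>

definition triad_weight :: "nat \<Rightarrow> real" where
  "triad_weight n = 1 / sqrt (1 + 2 / 3 * (3 / 4) ^ Suc n)"

lemma triad_weight_bounds: "0 \<le> triad_weight n" "triad_weight n \<le> 1"
proof -
  have "1 \<le> sqrt (1 + 2 / 3 * (3 / 4) ^ Suc n)" by simp
  then show "0 \<le> triad_weight n" "triad_weight n \<le> 1"
    unfolding triad_weight_def by (simp_all only: divide_le_eq_1) auto
qed

context
  fixes x y :: "int ^ 3" and m :: nat
  assumes x: "x \<in> shell m" and y: "y \<in> shell m" and xy: "x + y \<in> shell (Suc m)"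
begin

text \<open>Polarisation identity, the three lengths being known.\<close>

lemma triad_inner: "freq x \<bullet> freq y = 3 * 4 ^ m + 3 ^ m"
proof -
  have "freq_sq (Suc m) = freq_sq m + freq_sq m + 2 * (freq x \<bullet> freq y)"
    using norm_freq_shell[OF xy] norm_freq_shell[OF x] norm_freq_shell[OF y]
    unfolding freq_add by (simp add: power2_norm_eq_inner inner_add_left inner_add_right inner_commute)
  then show ?thesis by (simp add: freq_sq_def)
qed

text \<open>Equal lengths and equal coordinate sums make \<open>x - y\<close> orthogonal to
  \<open>x + y\<close> and to \<open>sigma_vec\<close>, whose span contains the polarisation of the
  sum; against it \<open>x\<close> therefore acts like half of \<open>x + y\<close>.\<close>

lemma triad_inner_sigma_perp_sum: "freq x \<bullet> sigma_perp (x + y) = 0"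
proof -
  have "freq x \<bullet> freq (x + y) = freq_sq (Suc m) / 2"
    unfolding freq_add inner_add_right triad_inner using norm_freq_shell[OF x]
    by (simp add: power2_norm_eq_inner[symmetric] freq_sq_def)
  then show ?thesis
    unfolding sigma_perp_def inner_diff_right inner_scaleR_right norm_freq_shell[OF xy]
      freq_inner_sigma_shell[OF x] freq_inner_sigma_shell[OF xy]
    using freq_sq_pos[of "Suc m"] by (simp add: field_simps)
qed

lemma triad_inner_dir_sum: "freq x \<bullet> dir (x + y) = 0"
  by (simp add: dir_def triad_inner_sigma_perp_sum)

text \<open>By the orthogonality above, the inner product of the two unnormalised polarisations
  collapses to a squared length. The factors \<open>perp_len m\<close> then cancel against
  \<open>freq_sq m\<close>, and \<open>2^m / 2 * perp_len (Suc m)\<close> survives, of order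
  \<open>sqrt 3 ^ m\<close>.\<close>

lemma triad_coefficient:
  "(freq x \<bullet> dir y) * (dir (x + y) \<bullet> dir x) = sqrt 3 ^ Suc m / (2 * sqrt 2) * triad_weight m"
proof -
  have "freq x \<bullet> sigma_perp y = 3 * 2 ^ m - 3 * 2 ^ m / freq_sq m * (3 * 4 ^ m + 3 ^ m)"
    unfolding sigma_perp_def inner_diff_right inner_scaleR_right norm_freq_shell[OF y]
      freq_inner_sigma_shell[OF x] freq_inner_sigma_shell[OF y] triad_inner ..
  also have "\<dots> = 3 * 2 ^ m * 3 ^ m / freq_sq m"
    using freq_sq_pos[of m] by (simp add: field_simps) (simp add: freq_sq_def algebra_simps)
  finally have 1: "freq x \<bullet> dir y = 3 * 2 ^ m * 3 ^ m / freq_sq m / perp_len m"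
    by (simp add: dir_def norm_sigma_perp[OF y] field_simps)
  have "sigma_perp (x + y) \<bullet> sigma_perp x
      = sigma_perp (x + y) \<bullet> sigma_vec - (freq x \<bullet> sigma_vec) / (norm (freq x))\<^sup>2 * (freq x \<bullet> sigma_perp (x + y))"
    unfolding sigma_perp_def[of x] inner_diff_right inner_scaleR_right by (simp only: inner_commute)
  also have "\<dots> = (perp_len (Suc m))\<^sup>2"
    unfolding triad_inner_sigma_perp_sum norm_sigma_perp_shell(2)[OF xy] perp_len_def
    using freq_sq_pos[of "Suc m"] by simp
  finally have 2: "dir (x + y) \<bullet> dir x = perp_len (Suc m) / perp_len m"
    using perp_len_pos[of "Suc m"]
    by (simp add: dir_def norm_sigma_perp[OF x] norm_sigma_perp[OF xy] power2_eq_square field_simps)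
  have pm: "perp_len m * perp_len m = 6 * 3 ^ m / freq_sq m"
    unfolding perp_len_def using freq_sq_pos[of m] by simp
  have "(freq x \<bullet> dir y) * (dir (x + y) \<bullet> dir x)
      = 3 * 2 ^ m * 3 ^ m / freq_sq m * perp_len (Suc m) / (perp_len m * perp_len m)"
    unfolding 1 2 by simp
  also have "\<dots> = 2 ^ m / 2 * perp_len (Suc m)"
    unfolding pm using freq_sq_pos[of m] by (simp add: field_simps)
  also have "perp_len (Suc m) = sqrt 3 ^ Suc m * sqrt 2 / 2 ^ Suc m * triad_weight m"
  proof -
    define q where "q = 1 + 2 / 3 * (3 / 4 :: real) ^ Suc m"
    have q: "0 < q" by (simp add: q_def add_pos_nonneg)
    have "freq_sq (Suc m) = 3 * 4 ^ Suc m * q"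
      by (simp add: freq_sq_def q_def power_divide field_simps)
    then have "6 * 3 ^ Suc m / freq_sq (Suc m) = 3 ^ Suc m * 2 / 4 ^ Suc m * (1 / q)"
      using q by (simp add: field_simps)
    also have "sqrt \<dots> = sqrt 3 ^ Suc m * sqrt 2 / sqrt 4 ^ Suc m * (1 / sqrt q)"
      by (simp only: real_sqrt_mult real_sqrt_divide real_sqrt_power real_sqrt_one)
    also have "sqrt 4 = (2::real)" by simp
    finally show ?thesis unfolding perp_len_def triad_weight_def q_def .
  qed
  also have "2 ^ m / 2 * (sqrt 3 ^ Suc m * sqrt 2 / 2 ^ Suc m * triad_weight m)
      = sqrt 3 ^ Suc m * (sqrt 2 / 4) * triad_weight m"
    by simp
  also have "sqrt 2 / 4 = 1 / (2 * sqrt 2)" by (simp add: field_simps)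
  finally show ?thesis by simp
qed

end

section \<open>Coefficients on the shells\<close>

definition shell_pm :: "nat \<Rightarrow> (int ^ 3) set" where
  "shell_pm n = shell n \<union> uminus ` shell n"

lemma finite_shell_pm: "finite (shell_pm n)"
  by (simp add: shell_pm_def finite_shell)

lemma shell_pm_cases:
  assumes "k \<in> shell_pm n"
  obtains "k \<in> shell n" | l where "l \<in> shell n" "k = - l"
  using assms by (auto simp: shell_pm_def)

lemma abs_coord_sum_shell_pm: "k \<in> shell_pm n \<Longrightarrow> \<bar>coord_sum k\<bar> = 3 * 2 ^ n"
  by (elim shell_pm_cases) (auto simp: coord_sum_shell coord_sum_minus)

lemma shell_pm_unique: "k \<in> shell_pm m \<Longrightarrow> k \<in> shell_pm n \<Longrightarrow> m = n"
  using abs_coord_sum_shell_pm[of k m] abs_coord_sum_shell_pm[of k n] by simp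

lemma disjoint_shell_pm: "m \<noteq> n \<Longrightarrow> shell_pm m \<inter> shell_pm n = {}"
  using shell_pm_unique by blast

lemma UN_shell_pm: "(\<Union>n. shell_pm n) = freq_set"
  by (auto simp: shell_pm_def freq_set_def)

lemma shell_subset: "k \<in> shell n \<Longrightarrow> k \<in> freq_set" "k \<in> shell n \<Longrightarrow> - k \<in> freq_set"
  by (auto simp: freq_set_def)

lemma freq_set_cases:
  assumes "k \<in> freq_set"
  obtains n where "k \<in> shell n" | n l where "l \<in> shell n" "k = - l"
  using assms by (auto simp: freq_set_def)

lemma freq_set_minus: "k \<in> freq_set \<Longrightarrow> - k \<in> freq_set"
  by (auto simp: freq_set_def)

lemma zero_notin_freq_set: "0 \<notin> freq_set"
  using zero_notin_shell by (auto simp: freq_set_def)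

lemma card_shell_pm: "card (shell_pm n) = 12"
proof -
  have "shell n \<inter> uminus ` shell n = {}" using neg_notin_shell by fastforce
  then show ?thesis
    by (simp add: shell_pm_def card_Un_disjoint finite_shell card_image card_shell)
qed

definition shell_level :: "int ^ 3 \<Rightarrow> nat" where
  "shell_level k = (THE n. k \<in> shell_pm n)"

lemma shell_level_eq: "k \<in> shell_pm n \<Longrightarrow> shell_level k = n"
  unfolding shell_level_def using shell_pm_unique by blast

lemma norm_cvec: "norm (cvec v) = norm v"
  by (simp add: norm_vec_def cvec_def)

lemma cvec_minus: "cvec (- v) = - cvec v"
  by (simp add: cvec_def vec_eq_iff)

text \<open>The Fourier coefficients of the field with real amplitudes \<open>\<psi>\<close>: the sine series yields
  \<open>\<i> \<psi>\<^sub>n v\<^sup>k\<close> on shell \<open>n\<close> and the opposite sign on the reflected shell.\<close>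

definition scoef :: "(nat \<Rightarrow> real) \<Rightarrow> int ^ 3 \<Rightarrow> complex ^ 3" where
  "scoef \<psi> k = (if k \<in> freq_set
     then (\<i> * complex_of_real (of_int (sgn (coord_sum k)) * \<psi> (shell_level k))) *s cvec (dir k) else 0)"

lemma scoef_shell: "k \<in> shell n \<Longrightarrow> scoef \<psi> k = (\<i> * complex_of_real (\<psi> n)) *s cvec (dir k)"
  using shell_level_eq[of k n] shell_subset[of k n] by (simp add: scoef_def shell_pm_def coord_sum_shell)

lemma scoef_minus: "scoef \<psi> (- k) = - scoef \<psi> k"
proof (cases "k \<in> freq_set")
  case True
  have "shell_level (- k) = shell_level k"
    using True by (auto simp: shell_pm_def shell_level_eq UN_shell_pm[symmetric]
        intro!: trans[OF shell_level_eq shell_level_eq[symmetric]])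
  then show ?thesis
    using True freq_set_minus[of k] by (simp add: scoef_def coord_sum_minus dir_minus vec_eq_iff sgn_minus)
next
  case False
  then show ?thesis using freq_set_minus[of "- k"] by (auto simp: scoef_def)
qed

lemma scoef_outside: "k \<notin> freq_set \<Longrightarrow> scoef \<psi> k = 0"
  by (simp add: scoef_def)

lemma scoef_diff: "scoef (\<lambda>n. x n - y n) k = scoef x k - scoef y k"
  by (simp add: scoef_def vec_eq_iff algebra_simps)

lemma scoef_scale: "scoef (\<lambda>n. r * x n) k = r *\<^sub>R scoef x k"
  by (simp add: scoef_def vec_eq_iff) (simp add: scaleR_conv_of_real)

lemma scoef_uminus: "scoef (\<lambda>n. - x n) k = - scoef x k"
  by (simp add: scoef_def vec_eq_iff)

lemma scoefI:
  assumes "\<And>n k. k \<in> shell n \<Longrightarrow> c k = (\<i> * complex_of_real (\<psi> n)) *s cvec (dir k)"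
    and "\<And>n k. k \<in> shell n \<Longrightarrow> c (- k) = - c k"
    and "\<And>k. k \<notin> freq_set \<Longrightarrow> c k = 0"
  shows "c = scoef \<psi>"
proof
  fix k
  show "c k = scoef \<psi> k"
  proof (cases "k \<in> freq_set")
    case True
    then show ?thesis
      by (rule freq_set_cases) (use assms(1,2) in \<open>simp_all add: scoef_shell scoef_minus\<close>)
  qed (simp add: assms(3) scoef_outside)
qed

lemma norm_scoef: "k \<in> shell_pm n \<Longrightarrow> norm (scoef \<psi> k) = \<bar>\<psi> n\<bar>"
  by (elim shell_pm_cases) (simp_all add: scoef_shell scoef_minus norm_vector_smult norm_cvec norm_dir norm_mult)

lemma Laplace_symbol_shell_pm: "k \<in> shell_pm n \<Longrightarrow> Laplace_symbol k = 4 * pi\<^sup>2 * freq_sq n"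
  by (elim shell_pm_cases) (auto simp: Laplace_symbol_def norm_freq_shell freq_minus)

section \<open>The critical norm as a weighted sequence norm\<close>

definition shell_weight :: "nat \<Rightarrow> real" where
  "shell_weight n = (4 * pi\<^sup>2 * freq_sq n) powr s_crit"

lemma s_crit_pos: "0 < s_crit"
  by (simp add: s_crit_def)

text \<open>The origin of the exponent: \<open>s_crit\<close> solves \<open>4 powr s = 3\<close>, so
  squared lengths of order \<open>4^n\<close> receive the weight \<open>3^n\<close>.\<close>

lemma four_powr_s_crit: "(4 ^ n) powr s_crit = 3 ^ n"
proof -
  have "ln (4 ^ n :: real) = 2 * real n * ln 2"
    using ln_realpow[of 2 2] by (simp add: ln_realpow)
  then have "(4 ^ n) powr s_crit = exp (real n * ln 3)"
    by (simp add: powr_def s_crit_def)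
  also have "\<dots> = 3 ^ n" by (simp add: exp_of_nat_mult)
  finally show ?thesis .
qed

text \<open>\<open>20 = 4 * 5\<close>, from \<open>freq_sq n \<le> 5 * 4^n\<close>.\<close>

definition weight_const :: real where
  "weight_const = (20 * pi\<^sup>2) powr s_crit"

lemma weight_const_nonneg: "0 \<le> weight_const"
  by (simp add: weight_const_def)

lemma shell_weight_bounds: "3 ^ n \<le> shell_weight n" "shell_weight n \<le> weight_const * 3 ^ n"
proof -
  have pi1: "1 \<le> pi\<^sup>2" using pi_gt3 by (simp add: one_le_power)
  have "4 ^ n \<le> 4 * pi\<^sup>2 * freq_sq n"
  proof -
    have "(4::real) ^ n \<le> freq_sq n" by (simp add: freq_sq_def)
    also have "\<dots> \<le> (4 * pi\<^sup>2) * freq_sq n"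
      using pi1 freq_sq_pos[of n] mult_right_mono[of 1 "4 * pi\<^sup>2" "freq_sq n"] by simp
    finally show ?thesis .
  qed
  then have "(4 ^ n) powr s_crit \<le> shell_weight n"
    unfolding shell_weight_def using s_crit_pos by (intro powr_mono2) auto
  then show "3 ^ n \<le> shell_weight n" by (simp add: four_powr_s_crit)
  have "(3::real) ^ n \<le> 4 ^ n" by (rule power_mono) auto
  then have "freq_sq n \<le> 5 * 4 ^ n" by (simp add: freq_sq_def)
  then have "4 * pi\<^sup>2 * freq_sq n \<le> (20 * pi\<^sup>2) * 4 ^ n"
    using mult_left_mono[of "freq_sq n" "5 * 4 ^ n" "4 * pi\<^sup>2"] by simp
  then have "shell_weight n \<le> ((20 * pi\<^sup>2) * 4 ^ n) powr s_crit"
    unfolding shell_weight_def using s_crit_pos freq_sq_pos[of n] by (intro powr_mono2) auto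
  also have "\<dots> = weight_const * 3 ^ n"
    by (simp add: powr_mult weight_const_def four_powr_s_crit)
  finally show "shell_weight n \<le> weight_const * 3 ^ n" .
qed

definition rescale :: "(nat \<Rightarrow> real) \<Rightarrow> nat \<Rightarrow> real" where
  "rescale \<psi> n = sqrt 3 ^ n * \<psi> n"

lemma rescale_power2: "(rescale \<psi> n)\<^sup>2 = 3 ^ n * (\<psi> n)\<^sup>2"
  by (simp add: rescale_def power_mult_distrib power_mult[symmetric]) (simp add: power_mult mult.commute[of n 2])

lemma rescale_diff: "rescale (\<lambda>n. x n - y n) n = rescale x n - rescale y n"
  by (simp add: rescale_def algebra_simps)

lemma UN_shell_pm_subset: "(\<Union>n<N. shell_pm n) \<subseteq> - {0}"
  using zero_notin_freq_set UN_shell_pm by auto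

lemma sum_shell_pm_const:
  assumes "\<And>n k. n < N \<Longrightarrow> k \<in> shell_pm n \<Longrightarrow> f k = g n"
  shows "(\<Sum>k\<in>(\<Union>n<N. shell_pm n). f k) = (\<Sum>n<N. 12 * g n :: real)"
proof -
  have "(\<Sum>k\<in>(\<Union>n<N. shell_pm n). f k) = (\<Sum>n<N. \<Sum>k\<in>shell_pm n. f k)"
    using finite_shell_pm disjoint_shell_pm by (intro sum.UNION_disjoint) auto
  also have "\<dots> = (\<Sum>n<N. \<Sum>k\<in>shell_pm n. g n)"
    using assms by (intro sum.cong refl) auto
  finally show ?thesis by (simp add: card_shell_pm)
qed

lemma finite_subset_UN_shell_pm:
  assumes "finite F" "F \<subseteq> freq_set"
  obtains N where "F \<subseteq> (\<Union>n<N. shell_pm n)"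
proof -
  have "F \<subseteq> (\<Union>n<Suc (Max (shell_level ` F)). shell_pm n)"
  proof
    fix k assume k: "k \<in> F"
    then obtain n where n: "k \<in> shell_pm n" using assms(2) UN_shell_pm by blast
    have "n \<le> Max (shell_level ` F)" using k assms(1) shell_level_eq[OF n] by auto
    then show "k \<in> (\<Union>n<Suc (Max (shell_level ` F)). shell_pm n)" using n by auto
  qed
  then show ?thesis using that by blast
qed

definition Hdot_term :: "(int ^ 3 \<Rightarrow> complex ^ 3) \<Rightarrow> int ^ 3 \<Rightarrow> real" where
  "Hdot_term c k = Laplace_symbol k powr s_crit * (norm (c k))\<^sup>2"

lemma Hdot_term_nonneg: "0 \<le> Hdot_term c k"
  by (simp add: Hdot_term_def)

lemma Hdot_term_scoef: "k \<in> shell_pm n \<Longrightarrow> Hdot_term (scoef \<psi>) k = shell_weight n * (\<psi> n)\<^sup>2"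
  by (simp add: Hdot_term_def Laplace_symbol_shell_pm norm_scoef shell_weight_def)

lemma sum_Hdot_term:
  "(\<Sum>k\<in>(\<Union>n<N. shell_pm n). Hdot_term (scoef \<psi>) k) = (\<Sum>n<N. 12 * (shell_weight n * (\<psi> n)\<^sup>2))"
  by (rule sum_shell_pm_const) (rule Hdot_term_scoef)

lemma weighted_le:
  "(rescale \<psi> n)\<^sup>2 \<le> shell_weight n * (\<psi> n)\<^sup>2" "shell_weight n * (\<psi> n)\<^sup>2 \<le> weight_const * (rescale \<psi> n)\<^sup>2"
  using mult_right_mono[OF shell_weight_bounds(1)[of n], of "(\<psi> n)\<^sup>2"]
    mult_right_mono[OF shell_weight_bounds(2)[of n], of "(\<psi> n)\<^sup>2"]
  by (simp_all add: rescale_power2 mult.assoc)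

text \<open>All 12 frequencies of a reflected shell contribute the same term, which squeezes the
  field norm between multiples of the l2 norm of the rescaled amplitudes; the lower bound simply
  discards the 12.\<close>

lemma
  assumes sm: "summable (\<lambda>n. (rescale \<psi> n)\<^sup>2)"
  shows Hdot_scoef_summable: "Hdot_term (scoef \<psi>) summable_on - {0}"
    and Hdot_scoef_le: "sqrt (\<Sum>\<^sub>\<infinity>k\<in>- {0}. Hdot_term (scoef \<psi>) k) \<le> sqrt (12 * weight_const) * l2_norm (rescale \<psi>)"
    and Hdot_scoef_ge: "l2_norm (rescale \<psi>) \<le> sqrt (\<Sum>\<^sub>\<infinity>k\<in>- {0}. Hdot_term (scoef \<psi>) k)"
proof -
  let ?B = "12 * weight_const * (\<Sum>n. (rescale \<psi> n)\<^sup>2)"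
  have fin: "sum (Hdot_term (scoef \<psi>)) F \<le> ?B" if F: "finite F" "F \<subseteq> - {0}" for F
  proof -
    obtain N where N: "F \<inter> freq_set \<subseteq> (\<Union>n<N. shell_pm n)"
      using finite_subset_UN_shell_pm[of "F \<inter> freq_set"] F by auto
    have "sum (Hdot_term (scoef \<psi>)) F = sum (Hdot_term (scoef \<psi>)) (F \<inter> freq_set)"
      using F by (intro sum.mono_neutral_right) (auto simp: Hdot_term_def scoef_outside)
    also have "\<dots> \<le> sum (Hdot_term (scoef \<psi>)) (\<Union>n<N. shell_pm n)"
      using N by (intro sum_mono2) (auto simp: finite_shell_pm Hdot_term_nonneg)
    also have "\<dots> = (\<Sum>n<N. 12 * (shell_weight n * (\<psi> n)\<^sup>2))" by (rule sum_Hdot_term)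
    also have "\<dots> \<le> (\<Sum>n<N. 12 * (weight_const * (rescale \<psi> n)\<^sup>2))"
      using weighted_le(2) by (intro sum_mono mult_left_mono) auto
    also have "\<dots> = 12 * weight_const * (\<Sum>n<N. (rescale \<psi> n)\<^sup>2)"
      by (simp add: sum_distrib_left mult_ac)
    also have "\<dots> \<le> ?B"
      using weight_const_nonneg sm by (intro mult_left_mono sum_le_suminf) auto
    finally show ?thesis .
  qed
  show s: "Hdot_term (scoef \<psi>) summable_on - {0}"
    by (rule nonneg_bdd_above_summable_on) (use fin in \<open>auto simp: Hdot_term_nonneg intro!: bdd_aboveI[of _ ?B]\<close>)
  have "(\<Sum>\<^sub>\<infinity>k\<in>- {0}. Hdot_term (scoef \<psi>) k) \<le> ?B"
    by (rule infsum_le_finite_sums[OF s fin])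
  then show "sqrt (\<Sum>\<^sub>\<infinity>k\<in>- {0}. Hdot_term (scoef \<psi>) k) \<le> sqrt (12 * weight_const) * l2_norm (rescale \<psi>)"
    unfolding l2_norm_def real_sqrt_mult[symmetric] by (rule real_sqrt_le_mono)
  have "(\<Sum>n<N. (rescale \<psi> n)\<^sup>2) \<le> (\<Sum>\<^sub>\<infinity>k\<in>- {0}. Hdot_term (scoef \<psi>) k)" for N
  proof -
    have "(\<Sum>n<N. (rescale \<psi> n)\<^sup>2) \<le> (\<Sum>n<N. 12 * (shell_weight n * (\<psi> n)\<^sup>2))"
    proof (rule sum_mono)
      fix n
      have "0 \<le> (rescale \<psi> n)\<^sup>2" by simp
      then show "(rescale \<psi> n)\<^sup>2 \<le> 12 * (shell_weight n * (\<psi> n)\<^sup>2)" using weighted_le(1)[of \<psi> n] by linarith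
    qed
    also have "\<dots> = sum (Hdot_term (scoef \<psi>)) (\<Union>n<N. shell_pm n)" by (rule sum_Hdot_term[symmetric])
    also have "\<dots> \<le> (\<Sum>\<^sub>\<infinity>k\<in>- {0}. Hdot_term (scoef \<psi>) k)"
      using UN_shell_pm_subset by (intro finite_sum_le_infsum s) (auto simp: finite_shell_pm Hdot_term_nonneg)
    finally show ?thesis .
  qed
  then show "l2_norm (rescale \<psi>) \<le> sqrt (\<Sum>\<^sub>\<infinity>k\<in>- {0}. Hdot_term (scoef \<psi>) k)"
    unfolding l2_norm_def by (intro real_sqrt_le_mono suminf_le_const sm)
qed

lemma summable_rescale_if_Hdot:
  assumes s: "Hdot_term (scoef \<psi>) summable_on - {0}"
  shows "summable (\<lambda>n. (rescale \<psi> n)\<^sup>2)"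
proof (rule bounded_imp_summable)
  fix n
  have "(\<Sum>n<Suc n. (rescale \<psi> n)\<^sup>2) \<le> (\<Sum>n<Suc n. 12 * (shell_weight n * (\<psi> n)\<^sup>2))"
  proof (rule sum_mono)
    fix n
    have "0 \<le> (rescale \<psi> n)\<^sup>2" by simp
    then show "(rescale \<psi> n)\<^sup>2 \<le> 12 * (shell_weight n * (\<psi> n)\<^sup>2)" using weighted_le(1)[of \<psi> n] by linarith
  qed
  also have "\<dots> = sum (Hdot_term (scoef \<psi>)) (\<Union>n<Suc n. shell_pm n)" by (rule sum_Hdot_term[symmetric])
  also have "\<dots> \<le> (\<Sum>\<^sub>\<infinity>k\<in>- {0}. Hdot_term (scoef \<psi>) k)"
    using UN_shell_pm_subset by (intro finite_sum_le_infsum s) (auto simp: finite_shell_pm Hdot_term_nonneg)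
  finally show "(\<Sum>k\<le>n. (rescale \<psi> k)\<^sup>2) \<le> (\<Sum>\<^sub>\<infinity>k\<in>- {0}. Hdot_term (scoef \<psi>) k)"
    by (simp only: lessThan_Suc_atMost)
qed simp

lemma summable_shell_geometric: "summable (\<lambda>n. C / sqrt 3 ^ n)"
proof -
  have "summable (\<lambda>n. (1 / sqrt 3) ^ n)" by (rule summable_geometric) simp
  then have "summable (\<lambda>n. C * (1 / sqrt 3) ^ n)" by (rule summable_mult)
  then show ?thesis by (simp add: power_divide)
qed

text \<open>The critical exponent leaves exactly the geometric factor that makes the coefficients
  absolutely summable.\<close>

lemma summable_coeffs_if_Hdot:
  assumes s: "Hdot_term c summable_on - {0}"
  shows "summable (\<lambda>n. \<Sum>k\<in>shell_pm n. norm (c k))"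
proof -
  let ?T = "\<Sum>\<^sub>\<infinity>k\<in>- {0}. Hdot_term c k"
  \<comment> \<open>A single term is below the whole sum, and its weight is at least
    \<open>3^n\<close>.\<close>
  have k: "norm (c k) \<le> sqrt ?T / sqrt 3 ^ n" if k: "k \<in> shell_pm n" for n k
  proof -
    have "k \<noteq> 0" using k zero_notin_freq_set UN_shell_pm by blast
    have "3 ^ n * (norm (c k))\<^sup>2 \<le> shell_weight n * (norm (c k))\<^sup>2"
      by (intro mult_right_mono shell_weight_bounds) simp
    also have "\<dots> = sum (Hdot_term c) {k}"
      by (simp add: Hdot_term_def Laplace_symbol_shell_pm[OF k] shell_weight_def)
    also have "\<dots> \<le> ?T"
      using \<open>k \<noteq> 0\<close> by (intro finite_sum_le_infsum s) (auto simp: Hdot_term_nonneg)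
    finally have "sqrt (3 ^ n * (norm (c k))\<^sup>2) \<le> sqrt ?T" by (rule real_sqrt_le_mono)
    then show ?thesis by (simp add: real_sqrt_mult real_sqrt_power field_simps)
  qed
  show ?thesis
  proof (rule summable_comparison_test'[OF summable_shell_geometric[of "12 * sqrt ?T"]])
    fix n
    have "(\<Sum>k\<in>shell_pm n. norm (c k)) \<le> (\<Sum>k\<in>shell_pm n. sqrt ?T / sqrt 3 ^ n)"
      by (intro sum_mono k)
    then show "norm (\<Sum>k\<in>shell_pm n. norm (c k)) \<le> 12 * sqrt ?T / sqrt 3 ^ n"
      by (simp add: card_shell_pm sum_nonneg)
  qed
qed

lemma Hdot_norm_eq: "Hdot_norm s_crit u = sqrt (\<Sum>\<^sub>\<infinity>k\<in>- {0}. Hdot_term (fhat u) k)"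
  by (simp add: Hdot_norm_def Hdot_term_def)

lemma Hdot_mem_iff: "u \<in> Hdot s_crit \<longleftrightarrow> L2_field u \<and> fhat u 0 = 0 \<and> Hdot_term (fhat u) summable_on - {0}"
  by (simp add: Hdot_def Hdot_term_def[abs_def])

lemma fhat_diff:
  assumes "L2_field u" "L2_field v"
  shows "fhat (\<lambda>x. u x - v x) k = fhat u k - fhat v k"
  using torus_integral_diff[OF L2_field_mode_integrable[OF assms(1)] L2_field_mode_integrable[OF assms(2)]]
  by (simp add: fhat_def vec_eq_iff left_diff_distrib)

lemma fhat_scaleR: "fhat (\<lambda>x. r *\<^sub>R u x) k = r *\<^sub>R fhat u k"
proof -
  have "torus_integral (\<lambda>x. complex_of_real r * (complex_of_real (u x $ i) * fourier_mode k x))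
      = complex_of_real r * torus_integral (\<lambda>x. complex_of_real (u x $ i) * fourier_mode k x)" for i
    by (rule torus_integral_cmult)
  then show ?thesis by (simp add: fhat_def vec_eq_iff mult.assoc) (simp add: scaleR_conv_of_real)
qed

lemma torus_integral_cnj: "torus_integral (\<lambda>x. cnj (f x)) = cnj (torus_integral f)"
  unfolding torus_integral_def set_lebesgue_integral_def
  by (simp flip: complex_cnj_scaleR add: integral_cnj)

lemma fhat_cnj: "fhat u (- k) $ i = cnj (fhat u k $ i)"
  unfolding fhat_def by (simp add: torus_integral_cnj[symmetric] cnj_fourier_mode)

lemmas shell_pm_partition = finite_shell_pm disjoint_shell_pm

text \<open>At the critical exponent the coefficients are absolutely summable, so such a field
  agrees almost everywhere with a pointwise convergent series; the symmetry arguments below work on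
  that series.\<close>

lemma HdotM_rep:
  assumes u: "u \<in> HdotM s_crit"
  shows "L2_field u" "Hdot_term (fhat u) summable_on - {0}"
    and "summable (\<lambda>n. \<Sum>k\<in>shell_pm n. norm (fhat u k))"
    and "AE x in lebesgue. cvec (u x) = trig_series shell_pm (fhat u) x"
proof -
  show L2: "L2_field u" and s: "Hdot_term (fhat u) summable_on - {0}"
    using u by (auto simp: HdotM_def Hdot_mem_iff)
  show sm: "summable (\<lambda>n. \<Sum>k\<in>shell_pm n. norm (fhat u k))"
    by (rule summable_coeffs_if_Hdot[OF s])
  show "AE x in lebesgue. cvec (u x) = trig_series shell_pm (fhat u) x"
  proof (intro AE_eq_trig_series shell_pm_partition L2 sm)
    show "fhat u k = 0" if "k \<notin> (\<Union>n. shell_pm n)" for k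
      using u that unfolding UN_shell_pm HdotM_def by blast
  qed
qed

lemma L2_measurable: "L2_field u \<Longrightarrow> u \<in> borel_measurable lebesgue"
  by (simp add: L2_field_def)

section \<open>Symmetries on the Fourier side\<close>

lemma fhat_odd:
  assumes u: "u \<in> HdotM s_crit" and odd: "odd_field u" and k: "k \<in> freq_set"
  shows "fhat u (- k) = - fhat u k"
proof (rule fhat_symmetry[OF shell_pm_partition L2_measurable[OF HdotM_rep(1)[OF u]] HdotM_rep(4,3)[OF u],
      where B = uminus and B' = uminus])
  show "AE x in lebesgue. cvec (u x) = - cvec (u (- x))"
    using odd unfolding odd_field_def by eventually_elim (simp add: cvec_minus)
  show "fourier_mode (- k) (- x) = fourier_mode (- (- k)) x" for k x
    by (simp add: fourier_mode_def freq_minus)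
qed (use k in \<open>auto simp: UN_shell_pm vec_eq_iff intro!: bounded_linear_minus bounded_linear_ident linearI\<close>)

lemma permute_vec_comp: "permute_vec p (permute_vec q v) = permute_vec (q \<circ> p) v"
  by (simp add: permute_vec_def)

lemma permute_vec_id: "permute_vec id v = v"
  by (simp add: permute_vec_def)

lemma permute_vec_inner:
  assumes "bij p"
  shows "permute_vec p v \<bullet> permute_vec p w = v \<bullet> (w :: real ^ 3)"
  unfolding inner_vec_def permute_vec_def
  using sum.reindex_bij_betw[OF assms, of "\<lambda>i. v $ i \<bullet> w $ i"] by simp

lemma freq_permute: "freq (permute_vec p k) = permute_vec p (freq k)"
  by (simp add: freq_def permute_vec_def)

lemma permute_vec_linear: "linear (permute_vec p :: real ^ 3 \<Rightarrow> real ^ 3)"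
  by (intro linearI) (simp_all add: permute_vec_def vec_eq_iff)

lemma freq_permute_inner:
  assumes "bij p"
  shows "freq k \<bullet> permute_vec (inv p) x = freq (permute_vec p k) \<bullet> x"
proof -
  have "permute_vec p (permute_vec (inv p) x) = x"
    using assms by (simp add: permute_vec_comp bij_is_inj permute_vec_id)
  then show ?thesis
    using permute_vec_inner[OF assms, of "freq k" "permute_vec (inv p) x"] by (simp add: freq_permute)
qed

lemma permute_freq_set:
  assumes "bij p" "k \<in> freq_set"
  shows "permute_vec p k \<in> freq_set"
proof -
  have perms: "permute_vec p l \<in> perms v" if "l \<in> perms v" for l v :: "int ^ 3"
    using that assms(1) unfolding perms_def by (auto simp: permute_vec_comp intro: bij_comp)
  have sh: "permute_vec p l \<in> shell n" if "l \<in> shell n" for l n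
    using that perms by (auto simp: shell_def split: if_splits)
  have "permute_vec p (- l) = - permute_vec p l" for l :: "int ^ 3"
    by (simp add: permute_vec_def vec_eq_iff)
  then show ?thesis
    using assms(2) by (elim freq_set_cases) (auto intro: shell_subset[OF sh])
qed

text \<open>The symmetry is read at \<open>permute_vec (inv p) x\<close>, because moving the inverse
  across the inner product leaves \<open>p\<close> acting on the frequency.\<close>

lemma fhat_permute:
  assumes u: "u \<in> HdotM s_crit" and sym: "permutation_symmetric u" and p: "bij p" and k: "k \<in> freq_set"
  shows "fhat u (permute_vec p k) = permute_vec p (fhat u k)"
proof (rule fhat_symmetry[OF shell_pm_partition L2_measurable[OF HdotM_rep(1)[OF u]] HdotM_rep(4,3)[OF u],
      where B = "permute_vec (inv p)" and B' = "permute_vec p"])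
  have "AE x in lebesgue. u (permute_vec (inv p) x) = permute_vec (inv p) (u x)"
    using sym p unfolding permutation_symmetric_def by (simp add: bij_imp_bij_inv)
  then show "AE x in lebesgue. cvec (u x) = permute_vec p (cvec (u (permute_vec (inv p) x)))"
  proof eventually_elim
    case (elim x)
    have "permute_vec p (cvec v) = cvec (permute_vec p v)" for v
      by (simp add: permute_vec_def cvec_def)
    then show ?case using p by (simp add: elim permute_vec_comp bij_is_inj permute_vec_id)
  qed
  have "linear (permute_vec p :: complex ^ 3 \<Rightarrow> complex ^ 3)"
    by (intro linearI) (simp_all add: permute_vec_def vec_eq_iff)
  then show "bounded_linear (permute_vec p :: complex ^ 3 \<Rightarrow> complex ^ 3)"
    by (simp add: linear_conv_bounded_linear)
  show "permute_vec p (a *s v) = a *s permute_vec p v" for a and v :: "complex ^ 3"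
    by (simp add: permute_vec_def vec_eq_iff)
  show "permute_vec p (permute_vec (inv p) x) = x" for x :: "real ^ 3"
    using p by (simp add: permute_vec_comp bij_is_inj permute_vec_id)
  show "fourier_mode (- k) (permute_vec (inv p) x) = fourier_mode (- permute_vec p k) x" for k x
    using freq_permute_inner[OF p, of k x] by (simp add: fourier_mode_def freq_minus)
  show "inj_on (permute_vec p) (\<Union>n. shell_pm n)"
  proof (rule inj_onI)
    fix k l :: "int ^ 3"
    assume "permute_vec p k = permute_vec p l"
    then have "permute_vec (inv p) (permute_vec p k) = permute_vec (inv p) (permute_vec p l)" by simp
    then show "k = l" using p by (simp add: permute_vec_comp bij_is_surj surj_iff[THEN iffD1] permute_vec_id)
  qed
qed (use k in \<open>auto simp: UN_shell_pm permute_vec_linear\<close>)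

text \<open>The reflection \<open>M_sigma\<close> on frequencies whose coordinate sum is divisible
  by 3, as in \<open>freq_set\<close>; elsewhere the integer division rounds and the value has no
  geometric meaning.\<close>

definition mirror :: "int ^ 3 \<Rightarrow> int ^ 3" where
  "mirror k = (\<chi> i. k $ i - 2 * (coord_sum k div 3))"

lemma M_sigma_nth: "(M_sigma *v x) $ i = x $ i - 2 / 3 * (x $ 1 + x $ 2 + x $ 3)"
  using exhaust_3[of i]
  by (auto simp: matrix_vector_mult_def M_sigma_def sigma_vec_def mat_def sum_3 algebra_simps)

lemma three_dvd_coord_sum: "k \<in> freq_set \<Longrightarrow> 3 dvd coord_sum k"
  by (elim freq_set_cases) (simp_all add: coord_sum_shell coord_sum_minus)

lemma freq_mirror:
  assumes "3 dvd coord_sum k"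
  shows "freq (mirror k) = M_sigma *v freq k"
proof -
  obtain j where j: "coord_sum k = 3 * j" using assms by blast
  then have "real_of_int (k $ 1) + of_int (k $ 2) + of_int (k $ 3) = 3 * of_int j"
    unfolding coord_sum_def by linarith
  then show ?thesis using j by (simp add: vec_eq_iff M_sigma_nth mirror_def)
qed

lemma M_sigma_inner: "v \<bullet> (M_sigma *v x) = (M_sigma *v v) \<bullet> x"
  by (simp add: inner_vec_def sum_3 M_sigma_nth field_simps)

lemma M_sigma_involution: "M_sigma *v (M_sigma *v x) = x"
  by (simp add: vec_eq_iff M_sigma_nth forall_3) (simp add: field_simps)

lemma fhat_mirror:
  assumes u: "u \<in> HdotM s_crit" and sym: "sigma_mirror_symmetric u" and k: "k \<in> freq_set"
  shows "fhat u (mirror k) = (\<chi> i. fhat u k $ i - 2 / 3 * (fhat u k $ 1 + fhat u k $ 2 + fhat u k $ 3))"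
proof -
  define A :: "complex ^ 3 \<Rightarrow> complex ^ 3" where "A z = (\<chi> i. z $ i - 2 / 3 * (z $ 1 + z $ 2 + z $ 3))" for z
  have "fhat u (mirror k) = A (fhat u k)"
  proof (rule fhat_symmetry[OF shell_pm_partition L2_measurable[OF HdotM_rep(1)[OF u]] HdotM_rep(4,3)[OF u],
        where B = "\<lambda>x. M_sigma *v x" and B' = "\<lambda>x. M_sigma *v x"])
    show "AE x in lebesgue. cvec (u x) = A (cvec (u (M_sigma *v x)))"
      using sym unfolding sigma_mirror_symmetric_def
    proof eventually_elim
      case (elim x)
      show ?case
        by (subst elim) (simp add: A_def cvec_def vec_eq_iff M_sigma_nth)
    qed
    have "linear A"
      by (intro linearI) (simp_all add: A_def vec_eq_iff complex_eq_iff field_simps)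
    then show "bounded_linear A" by (simp add: linear_conv_bounded_linear)
    show "A (a *s v) = a *s A v" for a v
      by (simp add: A_def vec_eq_iff algebra_simps)
    show "fourier_mode (- k) (M_sigma *v x) = fourier_mode (- mirror k) x" if "k \<in> (\<Union>n. shell_pm n)" for k x
    proof -
      have "freq k \<bullet> (M_sigma *v x) = freq (mirror k) \<bullet> x"
        using that unfolding UN_shell_pm by (simp add: freq_mirror three_dvd_coord_sum M_sigma_inner)
      then show ?thesis by (simp add: fourier_mode_def freq_minus)
    qed
    show "inj_on mirror (\<Union>n. shell_pm n)"
    proof (rule inj_onI)
      fix k l assume "k \<in> (\<Union>n. shell_pm n)" "l \<in> (\<Union>n. shell_pm n)" and eq: "mirror k = mirror l"
      then have "M_sigma *v freq k = M_sigma *v freq l"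
        using freq_mirror three_dvd_coord_sum UN_shell_pm by metis
      then have "freq k = freq l" by (metis M_sigma_involution)
      then show "k = l" by (simp add: freq_def vec_eq_iff)
    qed
  qed (use k in \<open>auto simp: UN_shell_pm M_sigma_involution\<close>)
  then show ?thesis by (simp add: A_def)
qed

lemma sigma_perp_permute:
  assumes "bij p"
  shows "sigma_perp (permute_vec p k) = permute_vec p (sigma_perp k)"
proof -
  have s: "permute_vec p sigma_vec = sigma_vec" by (simp add: permute_vec_def sigma_vec_def vec_eq_iff)
  have "permute_vec p (freq k) \<bullet> sigma_vec = freq k \<bullet> sigma_vec"
    using permute_vec_inner[OF assms, of "freq k" sigma_vec] by (simp add: s)
  moreover have "(norm (permute_vec p (freq k)))\<^sup>2 = (norm (freq k))\<^sup>2"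
    using permute_vec_inner[OF assms, of "freq k" "freq k"] by (simp add: power2_norm_eq_inner)
  ultimately show ?thesis
    unfolding sigma_perp_def freq_permute
    by (simp add: linear_diff[OF permute_vec_linear] linear_scale[OF permute_vec_linear] s)
qed

lemma dir_permute: "bij p \<Longrightarrow> dir (permute_vec p k) = permute_vec p (dir k)"
  using permute_vec_inner[of p "sigma_perp k" "sigma_perp k"]
  by (simp add: dir_def sigma_perp_permute linear_scale[OF permute_vec_linear] norm_eq_sqrt_inner)

text \<open>The reflection is an isometry and transports the projection along with \<open>k\<close>;
  the sign arises because it reverses \<open>sigma_vec\<close>.\<close>

lemma sigma_perp_mirror:
  assumes "3 dvd coord_sum k"
  shows "sigma_perp (mirror k) = - (M_sigma *v sigma_perp k)"
proof -
  have s: "M_sigma *v sigma_vec = - sigma_vec"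
    by (simp add: vec_eq_iff M_sigma_nth) (simp add: sigma_vec_def)
  have 1: "(M_sigma *v freq k) \<bullet> sigma_vec = - (freq k \<bullet> sigma_vec)"
    using M_sigma_inner[of "freq k" sigma_vec] by (simp add: s)
  have 2: "(norm (M_sigma *v freq k))\<^sup>2 = (norm (freq k))\<^sup>2"
    using M_sigma_inner[of "M_sigma *v freq k" "freq k"] by (simp add: power2_norm_eq_inner M_sigma_involution)
  show ?thesis
    unfolding sigma_perp_def freq_mirror[OF assms] 1 2
    by (simp add: matrix_vector_mult_diff_distrib matrix_vector_mult_scaleR s)
qed

lemma dir_mirror:
  assumes "3 dvd coord_sum k"
  shows "dir (mirror k) = - (M_sigma *v dir k)"
proof -
  have "norm (M_sigma *v sigma_perp k) = norm (sigma_perp k)"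
    using M_sigma_inner[of "M_sigma *v sigma_perp k" "sigma_perp k"]
    by (simp add: norm_eq_sqrt_inner M_sigma_involution)
  then show ?thesis
    by (simp add: dir_def sigma_perp_mirror[OF assms] matrix_vector_mult_scaleR)
qed

text \<open>Reality and oddness make each coefficient purely imaginary. Permutations carry one
  amplitude through an orbit, which is all of an even shell; an odd shell consists of two orbits,
  and the negated mirror reflection links them.\<close>

theorem symmetric_fhat:
  assumes u: "u \<in> HdotM s_crit" and odd: "odd_field u" and perm: "permutation_symmetric u"
    and mir: "sigma_mirror_symmetric u"
  obtains \<psi> where "fhat u = scoef \<psi>"
proof -
  define rep where "rep n = (if even n then k_vec (n div 2) else h_vec (n div 2))" for n
  have self: "v \<in> perms v" for v :: "int ^ 3"
    unfolding perms_def by (intro CollectI exI[of _ id]) (auto simp: permute_vec_id)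
  have rep: "rep n \<in> shell n" for n
    using self by (auto simp: rep_def shell_def)
  have imag: "\<exists>r. fhat u k = (\<i> * complex_of_real r) *s cvec (dir k)" if k: "k \<in> shell n" for k n
  proof -
    obtain c where c: "fhat u k = c *s cvec (dir k)"
      using u shell_subset(1)[OF k] by (auto simp: HdotM_def)
    have "dir k \<noteq> 0" using norm_dir[OF k] by auto
    then obtain i where i: "dir k $ i \<noteq> 0" by (auto simp: vec_eq_iff)
    \<comment> \<open>Conjugation expresses that \<open>u\<close> is real, the sign that it is
      odd.\<close>
    have "cnj (fhat u k $ i) = - fhat u k $ i"
      unfolding fhat_cnj[symmetric] using fhat_odd[OF u odd shell_subset(1)[OF k]] by simp
    then have "cnj c * complex_of_real (dir k $ i) = (- c) * complex_of_real (dir k $ i)"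
      by (simp add: c cvec_def)
    then have "cnj c = - c" using i unfolding mult_cancel_right by simp
    then have "c = \<i> * complex_of_real (Im c)" by (simp add: complex_eq_iff)
    then show ?thesis using c by metis
  qed
  have "\<forall>n. \<exists>r. fhat u (rep n) = (\<i> * complex_of_real r) *s cvec (dir (rep n))"
    using imag[OF rep] by blast
  from choice[OF this] obtain \<psi> where
    \<psi>: "\<And>n. fhat u (rep n) = (\<i> * complex_of_real (\<psi> n)) *s cvec (dir (rep n))" by blast
  define P where "P n k \<longleftrightarrow> fhat u k = (\<i> * complex_of_real (\<psi> n)) *s cvec (dir k)" for n k
  have P_permute: "P n (permute_vec p k)" if "P n k" "k \<in> freq_set" "bij p" for n k p
  proof -
    have "permute_vec p (a *s cvec v) = a *s cvec (permute_vec p v)" for a v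
      by (simp add: permute_vec_def cvec_def vec_eq_iff)
    then show ?thesis
      using that fhat_permute[OF u perm that(3,2)] by (simp add: P_def dir_permute)
  qed
  \<comment> \<open>The mirror moves a frequency to height \<open>- 2^n\<close> with its offset
    unchanged; negation restores the height and reverses the offset.\<close>
  have P_mirror: "P n (- mirror k)" if P: "P n k" and k: "k \<in> freq_set" for n k
  proof -
    note d = three_dvd_coord_sum[OF k]
    have "fhat u (mirror k) = (\<i> * complex_of_real (\<psi> n)) *s cvec (M_sigma *v dir k)"
      unfolding fhat_mirror[OF u mir k] P[unfolded P_def]
      by (simp add: vec_eq_iff cvec_def M_sigma_nth algebra_simps)
    moreover have "fhat u (- mirror k) = - fhat u (mirror k)"
    proof (cases "mirror k \<in> freq_set")
      case True
      then show ?thesis by (rule fhat_odd[OF u odd])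
    next
      case False
      then have "- mirror k \<notin> freq_set" using freq_set_minus by fastforce
      then show ?thesis using False u by (simp add: HdotM_def)
    qed
    ultimately show ?thesis
      by (simp add: P_def dir_minus dir_mirror[OF d] cvec_minus)
  qed
  have all: "P n k" if k: "k \<in> shell n" for n k
  proof -
    have Pr: "P n (rep n)" using \<psi> by (simp add: P_def)
    note rf = shell_subset(1)[OF rep]
    have perm_case: "P n k" if "k \<in> perms v" "P n v" "v \<in> freq_set" for v
      using that P_permute unfolding perms_def by blast
    show ?thesis
    proof (cases "even n")
      case True
      then show ?thesis using k perm_case[OF _ Pr rf] by (simp add: shell_def rep_def)
    next
      case False
      then consider "k \<in> perms (rep n)" | "k \<in> perms (j_vec (n div 2))"
        using k by (auto simp: shell_def rep_def)
      then show ?thesis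
      proof cases
        case 1
        then show ?thesis by (rule perm_case[OF _ Pr rf])
      next
        case 2
        \<comment> \<open>Swapping the first and third entries turns the reversed offset
          \<open>(-1, -1, 2)\<close> of \<open>h_vec\<close> into the offset
          \<open>(2, -1, -1)\<close> of \<open>j_vec\<close>.\<close>
        define q where "q = (\<lambda>i::3. if i = 1 then 3 else if i = 2 then 2 else (1::3))"
        have q: "bij q" unfolding q_def by (rule bij_3) auto
        have "coord_sum (rep n) = 3 * 2 ^ (2 * (n div 2) + 1)"
          using coord_sum_shell[OF rep, of n] False by (simp add: odd_two_times_div_two_succ)
        then have j: "j_vec (n div 2) = permute_vec q (- mirror (rep n))"
          using False by (simp add: vec_eq_iff forall_3 permute_vec_def q_def mirror_def rep_def
              h_vec_def j_vec_def vector_3)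
        have jf: "j_vec (n div 2) \<in> freq_set"
          using self[of "j_vec (n div 2)"] False by (intro shell_subset(1)[of _ n]) (simp add: shell_def)
        have mf: "- mirror (rep n) \<in> freq_set"
        proof -
          have "- mirror (rep n) = permute_vec (inv q) (j_vec (n div 2))"
            unfolding j by (simp add: permute_vec_comp bij_is_surj[OF q] surj_iff[THEN iffD1] permute_vec_id)
          then show ?thesis using permute_freq_set[OF bij_imp_bij_inv[OF q] jf] by simp
        qed
        have "P n (j_vec (n div 2))"
          unfolding j by (intro P_permute P_mirror Pr rf mf q)
        then show ?thesis using 2 jf perm_case by blast
      qed
    qed
  qed
  have "fhat u = scoef \<psi>"
  proof (rule scoefI)
    show "fhat u k = (\<i> * complex_of_real (\<psi> n)) *s cvec (dir k)" if "k \<in> shell n" for n k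
      using all[OF that] by (simp add: P_def)
    show "fhat u (- k) = - fhat u k" if "k \<in> shell n" for n k
      using fhat_odd[OF u odd shell_subset(1)[OF that]] .
    show "fhat u k = 0" if "k \<notin> freq_set" for k
      using u that by (simp add: HdotM_def)
  qed
  then show thesis by (rule that)
qed

section \<open>Fields with prescribed amplitudes\<close>

lemma L2_fieldI:
  assumes per: "\<And>x k. u (x + freq k) = u x" and um: "u \<in> borel_measurable lebesgue"
    and b: "\<And>x. norm (u x) \<le> W"
  shows "L2_field u"
  unfolding L2_field_def
proof (intro conjI um)
  show "periodic u" using per by (simp add: periodic_def)
  have Wi: "integrable lebesgue (\<lambda>x :: real^3. indicator (cbox 0 1) x *\<^sub>R W\<^sup>2)"
    using set_integrable_cube_continuous[of "\<lambda>_. W\<^sup>2"] by (simp add: set_integrable_def)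
  show "set_integrable lebesgue (cbox 0 1) (\<lambda>x. (norm (u x))\<^sup>2)"
    unfolding set_integrable_def
  proof (rule Bochner_Integration.integrable_bound[OF Wi])
    show "(\<lambda>x. indicator (cbox 0 1) x *\<^sub>R (norm (u x))\<^sup>2) \<in> borel_measurable lebesgue"
      by (intro borel_measurable_scaleR borel_measurable_indicator borel_measurable_power
          measurable_compose[OF um borel_measurable_norm]) simp_all
    have "(norm (u x))\<^sup>2 \<le> W\<^sup>2" for x
      using b[of x] by (intro power_mono) auto
    then show "AE x in lebesgue. norm (indicator (cbox 0 1) x *\<^sub>R (norm (u x))\<^sup>2)
        \<le> norm (indicator (cbox 0 1) x *\<^sub>R W\<^sup>2)"
      by (intro AE_I2) (auto simp: indicator_def)
  qed
qed

lemma fourier_mode_sin: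
  "fourier_mode (- k) x - fourier_mode k x = 2 * \<i> * complex_of_real (sin (2 * pi * (freq k \<bullet> x)))"
proof -
  define \<theta> where "\<theta> = 2 * pi * (freq k \<bullet> x)"
  have "fourier_mode (- k) x = cis \<theta>" "fourier_mode k x = cis (- \<theta>)"
    by (simp_all add: fourier_mode_def freq_minus cis_conv_exp \<theta>_def mult_ac)
  then show ?thesis by (simp add: \<theta>_def[symmetric] complex_eq_iff)
qed

lemma sum_shell_pm:
  fixes f :: "int ^ 3 \<Rightarrow> 'b::comm_monoid_add"
  shows "(\<Sum>k\<in>shell_pm n. f k) = (\<Sum>k\<in>shell n. f k + f (- k))"
proof -
  have "(\<Sum>k\<in>shell_pm n. f k) = (\<Sum>k\<in>shell n. f k) + (\<Sum>k\<in>uminus ` shell n. f k)"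
  proof -
    have "shell n \<inter> uminus ` shell n = {}" using neg_notin_shell by fastforce
    then show ?thesis
      unfolding shell_pm_def by (intro sum.union_disjoint) (auto simp: finite_shell)
  qed
  also have "(\<Sum>k\<in>uminus ` shell n. f k) = (\<Sum>k\<in>shell n. f (- k))"
    by (subst sum.reindex) auto
  finally show ?thesis by (simp add: sum.distrib)
qed

lemma trig_part_shell_pm:
  "trig_part shell_pm c N x = (\<Sum>n<N. \<Sum>k\<in>shell_pm n. fourier_mode (- k) x *s c k)"
  by (rule trig_part_eq[OF shell_pm_partition])

text \<open>Pairing \<open>k\<close> with \<open>- k\<close> produces sines: \<open>2 * \<i>\<close>
  from the exponentials times \<open>\<i>\<close> from the coefficient is the \<open>- 2\<close> of
  the expansion.\<close>

lemma cvec_partial_field: "cvec (partial_field \<psi> N x) = trig_part shell_pm (scoef \<psi>) N x"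
proof -
  have summand: "(\<Sum>k\<in>shell_pm n. fourier_mode (- k) x *s scoef \<psi> k)
      = cvec ((- 2) *\<^sub>R (\<psi> n *\<^sub>R (\<Sum>k\<in>shell n. sin (2 * pi * (freq k \<bullet> x)) *\<^sub>R dir k)))" for n
  proof -
    have "fourier_mode (- k) x *s scoef \<psi> k + fourier_mode (- (- k)) x *s scoef \<psi> (- k)
        = cvec ((- 2) *\<^sub>R (\<psi> n *\<^sub>R (sin (2 * pi * (freq k \<bullet> x)) *\<^sub>R dir k)))" if "k \<in> shell n" for k
    proof -
      have "fourier_mode (- k) x *s scoef \<psi> k + fourier_mode (- (- k)) x *s scoef \<psi> (- k)
          = (fourier_mode (- k) x - fourier_mode k x) *s scoef \<psi> k"
        by (simp add: scoef_minus vec_eq_iff algebra_simps)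
      also have "\<dots> = cvec ((- 2) *\<^sub>R (\<psi> n *\<^sub>R (sin (2 * pi * (freq k \<bullet> x)) *\<^sub>R dir k)))"
        unfolding fourier_mode_sin scoef_shell[OF that] by (simp add: vec_eq_iff cvec_def)
      finally show ?thesis .
    qed
    then have "(\<Sum>k\<in>shell_pm n. fourier_mode (- k) x *s scoef \<psi> k)
        = (\<Sum>k\<in>shell n. cvec ((- 2) *\<^sub>R (\<psi> n *\<^sub>R (sin (2 * pi * (freq k \<bullet> x)) *\<^sub>R dir k))))"
      unfolding sum_shell_pm by (intro sum.cong) auto
    then show ?thesis
      by (simp add: vec_eq_iff sum_distrib_left sum_negf[symmetric] mult.assoc del: sum_negf)
  qed
  show ?thesis
    unfolding trig_part_shell_pm summand partial_field_def
    by (simp add: vec_eq_iff sum_distrib_left sum_negf[symmetric] mult.assoc del: sum_negf)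
qed

lemma summable_scoef:
  assumes "summable (\<lambda>n. (rescale \<psi> n)\<^sup>2)"
  shows "summable (\<lambda>n. \<Sum>k\<in>shell_pm n. norm (scoef \<psi> k))"
  by (rule summable_coeffs_if_Hdot[OF Hdot_scoef_summable[OF assms]])

text \<open>For square-summable rescaled amplitudes the series is already real, its partial sums
  being sine sums; taking real parts then changes only the type.\<close>

definition shell_field :: "(nat \<Rightarrow> real) \<Rightarrow> real ^ 3 \<Rightarrow> real ^ 3" where
  "shell_field \<psi> x = (\<chi> i. Re (trig_series shell_pm (scoef \<psi>) x $ i))"

lemma
  assumes sm: "summable (\<lambda>n. (rescale \<psi> n)\<^sup>2)"
  shows L2_shell_field: "L2_field (shell_field \<psi>)"
    and fhat_shell_field: "fhat (shell_field \<psi>) = scoef \<psi>"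
proof -
  note ss = summable_scoef[OF sm]
  have c: "cvec (shell_field \<psi> x) = trig_series shell_pm (scoef \<psi>) x" for x
  proof -
    have "(\<lambda>N. trig_part shell_pm (scoef \<psi>) N x $ i) \<longlonglongrightarrow> trig_series shell_pm (scoef \<psi>) x $ i" for i
      by (intro tendsto_intros trig_part_tendsto shell_pm_partition ss)
    then have "(\<lambda>N. Im (cvec (partial_field \<psi> N x) $ i)) \<longlonglongrightarrow> Im (trig_series shell_pm (scoef \<psi>) x $ i)" for i
      unfolding cvec_partial_field by (intro tendsto_Im)
    then have "Im (trig_series shell_pm (scoef \<psi>) x $ i) = 0" for i
      by (simp add: LIMSEQ_const_iff)
    then show ?thesis by (simp add: vec_eq_iff shell_field_def complex_eq_iff)
  qed
  have um: "shell_field \<psi> \<in> borel_measurable lebesgue"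
  proof (rule borel_measurable_LIMSEQ_metric)
    show "partial_field \<psi> N \<in> borel_measurable lebesgue" for N
      unfolding partial_field_def[abs_def]
      by (intro borel_measurable_lebesgue_continuous continuous_intros)
    show "(\<lambda>N. partial_field \<psi> N x) \<longlonglongrightarrow> shell_field \<psi> x" for x
    proof (rule vec_tendstoI)
      fix i
      have "(\<lambda>N. trig_part shell_pm (scoef \<psi>) N x $ i) \<longlonglongrightarrow> trig_series shell_pm (scoef \<psi>) x $ i"
        by (intro tendsto_intros trig_part_tendsto shell_pm_partition ss)
      from tendsto_Re[OF this] show "(\<lambda>N. partial_field \<psi> N x $ i) \<longlonglongrightarrow> shell_field \<psi> x $ i"
        unfolding cvec_partial_field[symmetric] c[symmetric] by simp
    qed
  qed
  show L2: "L2_field (shell_field \<psi>)"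
  proof (rule L2_fieldI[OF _ um])
    show "shell_field \<psi> (x + freq k) = shell_field \<psi> x" for x k
      by (simp add: shell_field_def trig_series_periodic[OF shell_pm_partition ss])
    show "norm (shell_field \<psi> x) \<le> coeff_bound shell_pm (scoef \<psi>)" for x
      using norm_trig_series_le[OF shell_pm_partition ss, of x] unfolding c[symmetric] norm_cvec .
  qed
  have "fhat (shell_field \<psi>) k = (if k \<in> (\<Union>n. shell_pm n) then scoef \<psi> k else 0)" for k
    by (rule fhat_of_trig_series[OF shell_pm_partition um AE_I2 ss]) (assumption | rule c)+
  then show "fhat (shell_field \<psi>) = scoef \<psi>"
    unfolding UN_shell_pm by (auto simp: fun_eq_iff scoef_outside)
qed

definition truncate :: "nat \<Rightarrow> (nat \<Rightarrow> real) \<Rightarrow> nat \<Rightarrow> real" where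
  "truncate N \<psi> n = (if n < N then \<psi> n else 0)"

lemma summable_rescale_truncate: "summable (\<lambda>n. (rescale (truncate N \<psi>) n)\<^sup>2)"
  by (rule summable_finite[of "{..<N}"]) (auto simp: rescale_def truncate_def)

text \<open>Partial sums are fields with finitely supported amplitudes, so remainders fall under the
  same comparison of norms.\<close>

lemma partial_field_eq: "partial_field \<psi> N = shell_field (truncate N \<psi>)"
proof
  fix x
  let ?c = "scoef (truncate N \<psi>)"
  have z: "?c k = 0" if "k \<in> shell_pm n" "n \<ge> N" for n k
    using norm_scoef[OF that(1), of "truncate N \<psi>"] that(2) by (simp add: truncate_def)
  have e: "?c k = scoef \<psi> k" if "k \<in> shell_pm n" "n < N" for n k
    using that shell_level_eq[OF that(1)] by (simp add: scoef_def truncate_def)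
  have "trig_series shell_pm ?c x = (\<Sum>n<N. \<Sum>k\<in>shell_pm n. fourier_mode (- k) x *s ?c k)"
    unfolding trig_series_def by (rule suminf_finite) (auto intro!: sum.neutral simp: z not_less)
  also have "\<dots> = (\<Sum>n<N. \<Sum>k\<in>shell_pm n. fourier_mode (- k) x *s scoef \<psi> k)"
    by (intro sum.cong refl) (simp add: e)
  also have "\<dots> = cvec (partial_field \<psi> N x)"
    unfolding cvec_partial_field by (rule trig_part_shell_pm[symmetric])
  finally show "partial_field \<psi> N x = shell_field (truncate N \<psi>) x"
    by (simp add: shell_field_def vec_eq_iff)
qed

lemma fhat_diff_shell_fields:
  assumes "L2_field u" "fhat u = scoef x" "L2_field v" "fhat v = scoef y"
  shows "fhat (\<lambda>z. u z - v z) = scoef (\<lambda>n. x n - y n)"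
  using assms by (simp add: fun_eq_iff fhat_diff scoef_diff)

lemma
  assumes "fhat u = scoef \<psi>" "summable (\<lambda>n. (rescale \<psi> n)\<^sup>2)"
  shows Hdot_norm_le: "Hdot_norm s_crit u \<le> sqrt (12 * weight_const) * l2_norm (rescale \<psi>)"
    and Hdot_norm_ge: "l2_norm (rescale \<psi>) \<le> Hdot_norm s_crit u"
  using Hdot_scoef_le[OF assms(2)] Hdot_scoef_ge[OF assms(2)] by (simp_all add: Hdot_norm_eq assms(1))

lemma rescale_abs_le_Hdot_norm:
  assumes "fhat u = scoef \<psi>" "summable (\<lambda>n. (rescale \<psi> n)\<^sup>2)"
  shows "\<bar>rescale \<psi> n\<bar> \<le> Hdot_norm s_crit u"
  by (rule order_trans[OF abs_le_l2_norm[OF assms(2)] Hdot_norm_ge[OF assms]])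

lemma summable_rescale_diff:
  assumes "summable (\<lambda>n. (rescale x n)\<^sup>2)" "summable (\<lambda>n. (rescale y n)\<^sup>2)"
  shows "summable (\<lambda>n. (rescale (\<lambda>n. x n - y n) n)\<^sup>2)"
  unfolding rescale_diff by (rule summable_l2_diff[OF assms])

text \<open>The definite description asks for existence and uniqueness. Existence: the squared l2
  norm of the remainder is the tail of a convergent series. Uniqueness: for \<open>N > n\<close> the
  remainder norm bounds the difference of the rescaled amplitudes at \<open>n\<close>, which is
  therefore 0.\<close>

lemma psi_coeffs_eq:
  assumes L2: "L2_field u" and c: "fhat u = scoef \<psi>" and sm: "summable (\<lambda>n. (rescale \<psi> n)\<^sup>2)"
  shows "psi_coeffs s_crit u = \<psi>"
proof -
  let ?d = "\<lambda>\<phi> N n. \<psi> n - truncate N \<phi> n"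
  let ?H = "\<lambda>\<phi> N. Hdot_norm s_crit (\<lambda>x. u x - partial_field \<phi> N x)"
  have ds: "summable (\<lambda>n. (rescale (?d \<phi> N) n)\<^sup>2)" for \<phi> N
    by (rule summable_rescale_diff[OF sm summable_rescale_truncate])
  have fh: "fhat (\<lambda>x. u x - partial_field \<phi> N x) = scoef (?d \<phi> N)" for \<phi> N
    unfolding partial_field_eq
    by (rule fhat_diff_shell_fields[OF L2 c L2_shell_field fhat_shell_field]) (rule summable_rescale_truncate)+
  have "(\<lambda>N. l2_norm (rescale (?d \<psi> N))) \<longlonglongrightarrow> 0"
  proof -
    have eq: "(\<Sum>n. (rescale (?d \<psi> N) n)\<^sup>2) = (\<Sum>n. (rescale \<psi> n)\<^sup>2) - (\<Sum>n<N. (rescale \<psi> n)\<^sup>2)" for N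
    proof -
      have "(\<lambda>n. (rescale (?d \<psi> N) n)\<^sup>2) = (\<lambda>n. (rescale \<psi> n)\<^sup>2 - (rescale (truncate N \<psi>) n)\<^sup>2)"
        by (auto simp: fun_eq_iff rescale_def truncate_def)
      moreover have "(\<Sum>n. (rescale (truncate N \<psi>) n)\<^sup>2) = (\<Sum>n<N. (rescale \<psi> n)\<^sup>2)"
        by (subst suminf_finite[of "{..<N}"]) (auto simp: rescale_def truncate_def)
      ultimately show ?thesis
        using suminf_diff[OF sm summable_rescale_truncate[of N \<psi>]] by simp
    qed
    have "(\<lambda>N. (\<Sum>n. (rescale \<psi> n)\<^sup>2) - (\<Sum>n<N. (rescale \<psi> n)\<^sup>2))
        \<longlonglongrightarrow> (\<Sum>n. (rescale \<psi> n)\<^sup>2) - (\<Sum>n. (rescale \<psi> n)\<^sup>2)"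
      by (intro tendsto_intros summable_LIMSEQ sm)
    then have "(\<lambda>N. sqrt ((\<Sum>n. (rescale \<psi> n)\<^sup>2) - (\<Sum>n<N. (rescale \<psi> n)\<^sup>2))) \<longlonglongrightarrow> sqrt 0"
      by (intro tendsto_intros) simp
    then show ?thesis unfolding l2_norm_def eq by simp
  qed
  then have lim: "(\<lambda>N. sqrt (12 * weight_const) * l2_norm (rescale (?d \<psi> N))) \<longlonglongrightarrow> 0"
    by (rule tendsto_mult_right_zero)
  have ex: "?H \<psi> \<longlonglongrightarrow> 0"
  proof (rule tendsto_sandwich[OF _ _ tendsto_const lim])
    show "\<forall>\<^sub>F N in sequentially. 0 \<le> ?H \<psi> N"
      using Hdot_norm_ge[OF fh ds] l2_norm_nonneg[OF ds] by (intro always_eventually allI) (rule order_trans)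
    show "\<forall>\<^sub>F N in sequentially. ?H \<psi> N \<le> sqrt (12 * weight_const) * l2_norm (rescale (?d \<psi> N))"
      using Hdot_norm_le[OF fh ds] by (intro always_eventually allI)
  qed
  moreover have "\<phi> = \<psi>" if lim: "?H \<phi> \<longlonglongrightarrow> 0" for \<phi>
  proof
    fix n
    have "\<bar>rescale (?d \<phi> N) n\<bar> \<le> ?H \<phi> N" for N
      by (rule rescale_abs_le_Hdot_norm[OF fh ds])
    then have "\<bar>rescale \<psi> n - rescale \<phi> n\<bar> \<le> ?H \<phi> N" if "N \<ge> Suc n" for N
      using that by (auto simp: rescale_def truncate_def right_diff_distrib Suc_le_eq dest!: meta_spec[of _ N] split: if_splits)
    then have "\<bar>rescale \<psi> n - rescale \<phi> n\<bar> \<le> 0"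
      using lim by (intro LIMSEQ_le_const) blast+
    then show "\<phi> n = \<psi> n" by (simp add: rescale_def)
  qed
  ultimately show ?thesis unfolding psi_coeffs_def by (rule the_equality)
qed

lemma shell_field_HdotM:
  assumes "summable (\<lambda>n. (rescale \<psi> n)\<^sup>2)"
  shows "shell_field \<psi> \<in> HdotM s_crit"
  using L2_shell_field[OF assms] Hdot_scoef_summable[OF assms] zero_notin_freq_set
  by (auto simp: HdotM_def Hdot_mem_iff fhat_shell_field[OF assms] scoef_outside) (auto simp: scoef_def)

section \<open>The nonlinear interaction\<close>

text \<open>The larger summand is below \<open>2^n\<close> and at least half of it, so it is exactly
  half.\<close>

lemma two_power_sum_eq:
  fixes a b n :: nat
  assumes "(2::int) ^ a + 2 ^ b = 2 ^ n"
  shows "a = b \<and> n = Suc a"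
proof -
  have main: "a = b \<and> n = Suc a" if "a \<le> b" and e: "(2::int) ^ a + 2 ^ b = 2 ^ n" for a b
  proof -
    have lt: "(2::int) ^ b < 2 ^ n" using e by (smt (verit) zero_less_power)
    then have "b < n" by simp
    have le: "(2::int) ^ a \<le> 2 ^ b" using \<open>a \<le> b\<close> by simp
    then have "(2::int) ^ n \<le> 2 ^ Suc b" using e unfolding power_Suc by linarith
    then have "n \<le> Suc b" by (simp only: power_increasing_iff)
    then have n: "n = Suc b" using \<open>b < n\<close> by simp
    then have "(2::int) ^ a = 2 ^ b" using e by simp
    then show ?thesis using n by simp
  qed
  show ?thesis
    using main[of a b] main[of b a] assms by (cases "a \<le> b") (auto simp: add.commute)
qed

text \<open>Since every frequency on shell \<open>n\<close> has coordinate sum \<open>3 * 2^n\<close> up to sign, resonance of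
  three frequencies forces consecutive shells.\<close>

lemma triad_shells:
  assumes k: "k \<in> shell n" and p: "p \<in> freq_set" and q: "k - p \<in> freq_set"
  obtains (low) m where "n = Suc m" "p \<in> shell m" "k - p \<in> shell m"
  | (up) l where "p = - l" "l \<in> shell n" "k + l \<in> shell (Suc n)"
  | (up') l where "p = k + l" "l \<in> shell n" "k + l \<in> shell (Suc n)"
proof -
  have ck: "coord_sum k = 3 * 2 ^ n" by (rule coord_sum_shell[OF k])
  have cq: "coord_sum p + coord_sum (k - p) = 3 * 2 ^ n"
    unfolding coord_sum_add[symmetric] using ck by simp
  from p show ?thesis
  proof (cases rule: freq_set_cases)
    case (1 a)
    from q show ?thesis
    proof (cases rule: freq_set_cases)
      case (1 b)
      have "(2::int) ^ a + 2 ^ b = 2 ^ n"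
        using cq coord_sum_shell[OF \<open>p \<in> shell a\<close>] coord_sum_shell[OF 1] by simp
      then show ?thesis using two_power_sum_eq[of a b n] low[of a] 1 \<open>p \<in> shell a\<close> by blast
    next
      case (2 b l)
      have "(2::int) ^ n + 2 ^ b = 2 ^ a"
        using cq coord_sum_shell[OF \<open>p \<in> shell a\<close>] coord_sum_shell[OF 2(1)] 2(2) coord_sum_minus[of l] by simp
      then have "n = b" "a = Suc n" using two_power_sum_eq by blast+
      moreover have "p = k + l" using 2(2) by (simp add: algebra_simps)
      ultimately show ?thesis using up'[of l] 2 \<open>p \<in> shell a\<close> by simp
    qed
  next
    case (2 a l)
    from q show ?thesis
    proof (cases rule: freq_set_cases)
      case (1 b)
      have "(2::int) ^ n + 2 ^ a = 2 ^ b"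
        using cq coord_sum_shell[OF 2(1)] 2(2) coord_sum_minus[of l] coord_sum_shell[OF 1] by simp
      then have "n = a" "b = Suc n" using two_power_sum_eq by blast+
      then show ?thesis using up[of l] 1 2 by simp
    next
      case (2 b l')
      \<comment> \<open>Two reflected frequencies would have a negative total coordinate
        sum.\<close>
      have "- (2 ^ a) - 2 ^ b = (2::int) ^ n"
        using cq coord_sum_shell[OF \<open>l \<in> shell a\<close>] \<open>p = - l\<close> coord_sum_minus[of l]
          coord_sum_shell[OF 2(1)] 2(2) coord_sum_minus[of l'] by simp
      moreover have "(0::int) < 2 ^ a" "(0::int) < 2 ^ b" "(0::int) < 2 ^ n" by simp_all
      ultimately show ?thesis by linarith
    qed
  qed
qed

text \<open>The same nonlinearity in the unscaled amplitudes, in which the field equation is read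
  off.\<close>

definition shell_rhs :: "(nat \<Rightarrow> real) \<Rightarrow> nat \<Rightarrow> real" where
  "shell_rhs \<psi> n = shell_nl triad_weight (rescale \<psi>) n / sqrt 3 ^ n"

lemma rescale_shell_rhs: "rescale (shell_rhs \<psi>) = shell_nl triad_weight (rescale \<psi>)"
  by (simp add: fun_eq_iff rescale_def shell_rhs_def)

lemma shell_rhs_eq:
  "shell_rhs \<psi> n = sqrt 2 * pi * ((case n of 0 \<Rightarrow> 0 | Suc m \<Rightarrow> sqrt 3 ^ n * triad_weight m * (\<psi> m)\<^sup>2)
     - sqrt 3 ^ Suc n * triad_weight n * \<psi> n * \<psi> (Suc n))"
proof (cases n)
  case 0
  then show ?thesis by (simp add: shell_rhs_def shell_nl_def rescale_def)
next
  case (Suc m)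
  have e: "(sqrt 3 * s) * (sqrt 3 * s * w * (x * x)) = 3 * w * ((s * x) * (s * x))" for s w x :: real
  proof -
    have "(sqrt 3 * s) * (sqrt 3 * s * w * (x * x)) = (sqrt 3 * sqrt 3) * w * ((s * x) * (s * x))"
      by (simp only: mult_ac)
    then show ?thesis by simp
  qed
  have "shell_nl triad_weight (rescale \<psi>) n = sqrt 3 ^ n * (sqrt 2 * pi * (sqrt 3 ^ n * triad_weight m * (\<psi> m)\<^sup>2
      - sqrt 3 ^ Suc n * triad_weight n * \<psi> n * \<psi> (Suc n)))"
    unfolding shell_nl_def rescale_def Suc nat.case power_Suc power2_eq_square right_diff_distrib e[symmetric]
    by (simp only: mult_ac)
  then show ?thesis by (simp add: shell_rhs_def Suc)
qed

definition triad_amp :: "nat \<Rightarrow> real" where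
  "triad_amp n = sqrt 3 ^ Suc n / (2 * sqrt 2) * triad_weight n"

text \<open>The share of the ordered pair \<open>(p, k - p)\<close>, with \<open>p\<close> advecting
  \<open>k - p\<close>, in the \<open>dir k\<close> component of the advection at \<open>k\<close>,
  before the factor \<open>2 * pi * \<i>\<close> brought by the derivative.\<close>

definition interaction :: "(nat \<Rightarrow> real) \<Rightarrow> int ^ 3 \<Rightarrow> int ^ 3 \<Rightarrow> complex" where
  "interaction \<psi> k p = (\<Sum>j\<in>UNIV. of_int (k $ j) * scoef \<psi> p $ j)
     * (\<Sum>i\<in>UNIV. complex_of_real (dir k $ i) * scoef \<psi> (k - p) $ i)"

lemma interaction_eq:
  assumes "scoef \<psi> p = a *s cvec (dir x)" "scoef \<psi> (k - p) = b *s cvec (dir y)"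
  shows "interaction \<psi> k p = a * b * complex_of_real ((freq k \<bullet> dir x) * (dir k \<bullet> dir y))"
proof -
  have "(\<Sum>j\<in>UNIV. of_int (k $ j) * scoef \<psi> p $ j) = a * complex_of_real (freq k \<bullet> dir x)"
    "(\<Sum>i\<in>UNIV. complex_of_real (dir k $ i) * scoef \<psi> (k - p) $ i) = b * complex_of_real (dir k \<bullet> dir y)"
    unfolding assms by (simp_all add: inner_vec_def sum_distrib_left mult_ac)
  then show ?thesis by (simp add: interaction_def)
qed

text \<open>Three families of ordered pairs occur. Pairs from the shell below sum to
  \<open>k\<close> and give the square. A reflected \<open>- q\<close> advecting
  \<open>k + q\<close> couples shell \<open>n\<close> to the next one. In the opposite order the
  contribution vanishes, \<open>k\<close> being orthogonal to the polarisation of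
  \<open>k + q\<close>. The truncation must contain shell \<open>Suc n\<close>, hence the shift by
  two.\<close>

lemma sum_interactions:
  assumes k: "k \<in> shell n" and N: "Suc (Suc n) \<le> N"
  defines "F \<equiv> \<Union>m<N. shell_pm m"
  shows "(\<Sum>p\<in>F. if k - p \<in> F then interaction \<psi> k p else 0)
    = complex_of_real ((case n of 0 \<Rightarrow> 0 | Suc m \<Rightarrow> - 2 * triad_amp m * (\<psi> m)\<^sup>2)
        + 2 * triad_amp n * \<psi> n * \<psi> (Suc n))"
proof -
  have F: "F \<subseteq> freq_set" "finite F" using UN_shell_pm by (auto simp: F_def finite_shell_pm)
  have shF: "p \<in> F \<and> - p \<in> F" if "p \<in> shell m" "m \<le> Suc n" for p m
  proof -
    have "p \<in> shell_pm m \<and> - p \<in> shell_pm m" using that(1) by (auto simp: shell_pm_def)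
    moreover have "m < N" using that(2) N by linarith
    ultimately show ?thesis unfolding F_def by blast
  qed
  define L where "L = (case n of 0 \<Rightarrow> {} | Suc m \<Rightarrow> {p \<in> shell m. k - p \<in> shell m})"
  define Q where "Q = {q \<in> shell n. k + q \<in> shell (Suc n)}"
  have Lm: "n = Suc m \<Longrightarrow> p \<in> L \<longleftrightarrow> p \<in> shell m \<and> k - p \<in> shell m" for m p
    by (simp add: L_def)
  have L0: "n = 0 \<Longrightarrow> L = {}" by (simp add: L_def)
  have fL: "finite L" and fQ: "finite Q"
    unfolding L_def Q_def by (auto simp: finite_shell split: nat.split)
  have D: "{p \<in> F. k - p \<in> F} = L \<union> uminus ` Q \<union> (+) k ` Q"
  proof (intro equalityI subsetI)
    fix p assume "p \<in> {p \<in> F. k - p \<in> F}"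
    then have "p \<in> freq_set" "k - p \<in> freq_set" using F by auto
    then show "p \<in> L \<union> uminus ` Q \<union> (+) k ` Q"
      by (rule triad_shells[OF k]) (auto simp: Q_def Lm)
  next
    fix p assume "p \<in> L \<union> uminus ` Q \<union> (+) k ` Q"
    then consider (l) "p \<in> L" | (q) q where "q \<in> Q" "p = - q" | (q') q where "q \<in> Q" "p = k + q" by blast
    then show "p \<in> {p \<in> F. k - p \<in> F}"
    proof cases
      case l
      then obtain m where m: "n = Suc m" using L0 by (cases n) auto
      then show ?thesis using l shF[of p m] shF[of "k - p" m] by (simp add: Lm)
    next
      case q
      then show ?thesis using shF[of q n] shF[of "k + q" "Suc n"] by (simp add: Q_def)
    next
      case q'
      then show ?thesis using shF[of q n] shF[of "k + q" "Suc n"] by (simp add: Q_def)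
    qed
  qed
  \<comment> \<open>Shell index and sign separate the three families, so the sum splits without
    overlap.\<close>
  have dis1: "L \<inter> uminus ` Q = {}"
  proof -
    have "- q \<notin> shell m" if "q \<in> Q" for q m using that neg_notin_shell by (auto simp: Q_def)
    then show ?thesis by (cases n) (auto simp: L_def)
  qed
  have dis2: "(L \<union> uminus ` Q) \<inter> (+) k ` Q = {}"
  proof -
    have "k + q \<notin> uminus ` Q" if q: "q \<in> Q" for q
    proof
      assume "k + q \<in> uminus ` Q"
      then obtain r where "r \<in> Q" "k + q = - r" by blast
      then show False using q neg_notin_shell[of r n "Suc n"] by (simp add: Q_def)
    qed
    moreover have "k + q \<notin> L" if q: "q \<in> Q" for q
    proof (cases n)
      case (Suc m)
      have "k + q \<notin> shell m" using q shell_unique[of "k + q" "Suc n" m] Suc by (auto simp: Q_def)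
      then show ?thesis using Suc by (simp add: L_def)
    qed (simp add: L_def)
    ultimately show ?thesis by auto
  qed
  have "(\<Sum>p\<in>F. if k - p \<in> F then interaction \<psi> k p else 0) = (\<Sum>p\<in>{p \<in> F. k - p \<in> F}. interaction \<psi> k p)"
    using F(2) by (simp add: sum.If_cases Int_def)
  also have "\<dots> = (\<Sum>p\<in>L. interaction \<psi> k p) + (\<Sum>p\<in>uminus ` Q. interaction \<psi> k p) + (\<Sum>p\<in>(+) k ` Q. interaction \<psi> k p)"
    unfolding D using fL fQ dis1 dis2 by (simp add: sum.union_disjoint)
  also have "(\<Sum>p\<in>L. interaction \<psi> k p) = complex_of_real (case n of 0 \<Rightarrow> 0 | Suc m \<Rightarrow> - 2 * triad_amp m * (\<psi> m)\<^sup>2)"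
  proof (cases n)
    case 0
    then show ?thesis by (simp add: L0)
  next
    case (Suc m)
    have "interaction \<psi> k p = complex_of_real (- triad_amp m * (\<psi> m)\<^sup>2)" if p: "p \<in> L" for p
    proof -
      have pm: "p \<in> shell m" "k - p \<in> shell m" using p Suc by (simp_all add: Lm)
      have km: "(k - p) + p \<in> shell (Suc m)" using k Suc by simp
      \<comment> \<open>\<open>p\<close> is orthogonal to its own polarisation, so
        \<open>k - p\<close> may stand for \<open>k\<close>; this is the form treated by
        \<open>triad_coefficient\<close>.\<close>
      have "freq k \<bullet> dir p = freq (k - p) \<bullet> dir p"
        using freq_inner_dir[of p] by (simp add: freq_diff inner_diff_left)
      then have "(freq k \<bullet> dir p) * (dir k \<bullet> dir (k - p)) = triad_amp m"
        using triad_coefficient[OF pm(2,1) km] by (simp add: triad_amp_def)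
      then show ?thesis
        using interaction_eq[OF scoef_shell[OF pm(1)] scoef_shell[OF pm(2)], of \<psi>]
        by (simp add: power2_eq_square algebra_simps)
    qed
    moreover have "card L = 2" using card_shell_decompositions[of k m] k by (simp add: L_def Suc)
    ultimately show ?thesis by (simp add: Suc)
  qed
  also have "(\<Sum>p\<in>uminus ` Q. interaction \<psi> k p) = (\<Sum>q\<in>Q. interaction \<psi> k (- q))"
    by (subst sum.reindex) auto
  also have "\<dots> = complex_of_real (2 * triad_amp n * \<psi> n * \<psi> (Suc n))"
  proof -
    have "interaction \<psi> k (- q) = complex_of_real (triad_amp n * \<psi> n * \<psi> (Suc n))" if q: "q \<in> Q" for q
    proof -
      have qn: "q \<in> shell n" "k + q \<in> shell (Suc n)" using q by (simp_all add: Q_def)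
      have 1: "scoef \<psi> (- q) = (- (\<i> * complex_of_real (\<psi> n))) *s cvec (dir q)"
        by (simp add: scoef_minus scoef_shell[OF qn(1)] vec_eq_iff)
      have 2: "scoef \<psi> (k - (- q)) = (\<i> * complex_of_real (\<psi> (Suc n))) *s cvec (dir (k + q))"
        by (simp add: scoef_shell[OF qn(2)])
      have "(freq k \<bullet> dir q) * (dir k \<bullet> dir (k + q)) = triad_amp n"
        using triad_coefficient[OF k qn] by (simp add: triad_amp_def inner_commute)
      then show ?thesis
        using interaction_eq[OF 1 2] by (simp add: algebra_simps)
    qed
    moreover have "card Q = 2" using card_shell_complements[OF k] by (simp add: Q_def)
    ultimately show ?thesis by simp
  qed
  also have "(\<Sum>p\<in>(+) k ` Q. interaction \<psi> k p) = (\<Sum>q\<in>Q. interaction \<psi> k (k + q))"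
    by (subst sum.reindex) auto
  also have "\<dots> = 0"
  proof (rule sum.neutral, rule ballI)
    fix q assume q: "q \<in> Q"
    have qn: "q \<in> shell n" "k + q \<in> shell (Suc n)" using q by (simp_all add: Q_def)
    have 1: "scoef \<psi> (k - (k + q)) = (- (\<i> * complex_of_real (\<psi> n))) *s cvec (dir q)"
      by (simp add: scoef_minus scoef_shell[OF qn(1)] vec_eq_iff)
    have "freq k \<bullet> dir (k + q) = 0" by (rule triad_inner_dir_sum[OF k qn])
    then show "interaction \<psi> k (k + q) = 0"
      using interaction_eq[OF scoef_shell[OF qn(2)] 1] by simp
  qed
  finally show ?thesis by simp
qed

text \<open>Two minus signs cancel, one from the weak form of the divergence and one from
  differentiating the kernel.\<close>

lemma advection_hat_nth:
  assumes um: "u \<in> borel_measurable lebesgue" and rep: "AE x in lebesgue. cvec (u x) = trig_series shell_pm c x"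
    and sm: "summable (\<lambda>n. \<Sum>k\<in>shell_pm n. norm (c k))"
  shows "advection_hat u k $ i = 2 * complex_of_real pi * \<i> *
    (\<Sum>j\<in>UNIV. of_int (k $ j) * torus_integral (\<lambda>x. complex_of_real (u x $ j * u x $ i) * fourier_mode k x))"
proof -
  note pint = torus_integral_product_tendsto(2)[OF shell_pm_partition um rep sm]
  have "advection_hat u k $ i = - torus_integral (\<lambda>x. \<Sum>j\<in>UNIV.
      (- 2 * complex_of_real pi * \<i> * of_int (k $ j)) * (complex_of_real (u x $ j * u x $ i) * fourier_mode k x))"
    unfolding advection_hat_def advection_def frechet_derivative_fourier_mode vec_lambda_beta
    by (simp only: mult_ac)
  also have "\<dots> = - (\<Sum>j\<in>UNIV. (- 2 * complex_of_real pi * \<i> * of_int (k $ j)) *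
      torus_integral (\<lambda>x. complex_of_real (u x $ j * u x $ i) * fourier_mode k x))"
    by (subst torus_integral_sum) (auto simp only: torus_integral_cmult intro!: set_integrable_mult_right pint)
  finally show ?thesis
    by (simp add: sum_distrib_left sum_negf mult_ac)
qed

lemma advection_hat_minus:
  assumes um: "u \<in> borel_measurable lebesgue" and rep: "AE x in lebesgue. cvec (u x) = trig_series shell_pm c x"
    and sm: "summable (\<lambda>n. \<Sum>k\<in>shell_pm n. norm (c k))"
  shows "advection_hat u (- k) $ i = cnj (advection_hat u k $ i)"
proof -
  have "torus_integral (\<lambda>x. complex_of_real (u x $ j * u x $ i) * fourier_mode (- k) x)
      = cnj (torus_integral (\<lambda>x. complex_of_real (u x $ j * u x $ i) * fourier_mode k x))" for j
    by (simp add: torus_integral_cnj[symmetric] cnj_fourier_mode)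
  then show ?thesis
    unfolding advection_hat_nth[OF um rep sm] by (simp add: sum_negf)
qed

text \<open>The truncated convolutions are constant once shell \<open>Suc n\<close> is included, so
  the limit is a finite computation.\<close>

lemma proj_advection_shell:
  assumes um: "u \<in> borel_measurable lebesgue" and rep: "AE x in lebesgue. cvec (u x) = trig_series shell_pm (scoef \<psi>) x"
    and sm: "summable (\<lambda>n. (rescale \<psi> n)\<^sup>2)" and k: "k \<in> shell n"
  shows "(\<Sum>i\<in>UNIV. complex_of_real (dir k $ i) * advection_hat u k $ i) = - \<i> * complex_of_real (shell_rhs \<psi> n)"
proof -
  note ss = summable_scoef[OF sm]
  define I where "I i j = torus_integral (\<lambda>x. complex_of_real (u x $ j * u x $ i) * fourier_mode k x)" for i j
  define F where "F N = (\<Union>n<N. shell_pm n)" for N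
  define A where "A N i j = (\<Sum>p\<in>F N. \<Sum>q\<in>F N. if p + q = k then scoef \<psi> p $ j * scoef \<psi> q $ i else 0)" for N i j
  have fF: "finite (F N)" for N by (auto simp: F_def finite_shell_pm)
  have "(\<lambda>N. A N i j) \<longlonglongrightarrow> I i j" for i j
    unfolding A_def I_def F_def by (rule torus_integral_product_tendsto(1)[OF shell_pm_partition um rep ss])
  then have lim: "(\<lambda>N. \<Sum>i\<in>UNIV. complex_of_real (dir k $ i) * (2 * complex_of_real pi * \<i> * (\<Sum>j\<in>UNIV. of_int (k $ j) * A N i j)))
      \<longlonglongrightarrow> (\<Sum>i\<in>UNIV. complex_of_real (dir k $ i) * (2 * complex_of_real pi * \<i> * (\<Sum>j\<in>UNIV. of_int (k $ j) * I i j)))"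
    by (intro tendsto_intros)
  have "(\<Sum>i\<in>UNIV. complex_of_real (dir k $ i) * (2 * complex_of_real pi * \<i> * (\<Sum>j\<in>UNIV. of_int (k $ j) * A N i j)))
      = - \<i> * complex_of_real (shell_rhs \<psi> n)" if N: "Suc (Suc n) \<le> N" for N
  proof -
    have A: "A N i j = (\<Sum>p\<in>F N. if k - p \<in> F N then scoef \<psi> p $ j * scoef \<psi> (k - p) $ i else 0)" for i j
      unfolding A_def
    proof (rule sum.cong[OF refl])
      fix p
      have "(\<Sum>q\<in>F N. if p + q = k then scoef \<psi> p $ j * scoef \<psi> q $ i else 0)
          = (\<Sum>q\<in>F N. if q = k - p then scoef \<psi> p $ j * scoef \<psi> q $ i else 0)"
        by (intro sum.cong refl if_cong) (auto simp: algebra_simps)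
      then show "(\<Sum>q\<in>F N. if p + q = k then scoef \<psi> p $ j * scoef \<psi> q $ i else 0)
          = (if k - p \<in> F N then scoef \<psi> p $ j * scoef \<psi> (k - p) $ i else 0)"
        using fF by (simp add: sum.delta)
    qed
    have "(\<Sum>i\<in>UNIV. complex_of_real (dir k $ i) * (2 * complex_of_real pi * \<i> * (\<Sum>j\<in>UNIV. of_int (k $ j) * A N i j)))
        = 2 * complex_of_real pi * \<i> * (\<Sum>i\<in>UNIV. \<Sum>j\<in>UNIV. \<Sum>p\<in>F N. if k - p \<in> F N
            then (of_int (k $ j) * scoef \<psi> p $ j) * (complex_of_real (dir k $ i) * scoef \<psi> (k - p) $ i) else 0)"
      unfolding A sum_distrib_left by (intro sum.cong refl) auto
    also have "(\<Sum>i\<in>UNIV. \<Sum>j\<in>UNIV. \<Sum>p\<in>F N. if k - p \<in> F N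
            then (of_int (k $ j) * scoef \<psi> p $ j) * (complex_of_real (dir k $ i) * scoef \<psi> (k - p) $ i) else 0)
        = (\<Sum>p\<in>F N. \<Sum>j\<in>UNIV. \<Sum>i\<in>UNIV. if k - p \<in> F N
            then (of_int (k $ j) * scoef \<psi> p $ j) * (complex_of_real (dir k $ i) * scoef \<psi> (k - p) $ i) else 0)"
      unfolding sum_3 by (simp add: sum.distrib add_ac)
    also have "\<dots> = (\<Sum>p\<in>F N. if k - p \<in> F N then interaction \<psi> k p else 0)"
      unfolding interaction_def sum_product by (intro sum.cong refl) auto
    also have "\<dots> = complex_of_real ((case n of 0 \<Rightarrow> 0 | Suc m \<Rightarrow> - 2 * triad_amp m * (\<psi> m)\<^sup>2)
        + 2 * triad_amp n * \<psi> n * \<psi> (Suc n))"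
      unfolding F_def by (rule sum_interactions[OF k N])
    also have "2 * complex_of_real pi * \<i> * \<dots> = - \<i> * complex_of_real (shell_rhs \<psi> n)"
    proof -
      \<comment> \<open>\<open>2 * triad_amp\<close> carries the factor \<open>1 / sqrt 2\<close>,
        and \<open>2 * pi / sqrt 2\<close> is the \<open>sqrt 2 * pi\<close> of the shell
        model.\<close>
      define r where "r = 1 / sqrt 2"
      have s2: "2 * pi * r = sqrt 2 * pi" by (simp add: r_def field_simps)
      have t: "2 * triad_amp m = r * (sqrt 3 ^ Suc m * triad_weight m)" for m
        by (simp add: triad_amp_def r_def)
      have t': "- 2 * triad_amp m = - (r * (sqrt 3 ^ Suc m * triad_weight m))" for m
        using t[of m] by simp
      have "2 * pi * ((case n of 0 \<Rightarrow> 0 | Suc m \<Rightarrow> - 2 * triad_amp m * (\<psi> m)\<^sup>2) + 2 * triad_amp n * \<psi> n * \<psi> (Suc n))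
          = 2 * pi * r * ((case n of 0 \<Rightarrow> 0 | Suc m \<Rightarrow> - (sqrt 3 ^ n * triad_weight m * (\<psi> m)\<^sup>2))
              + sqrt 3 ^ Suc n * triad_weight n * \<psi> n * \<psi> (Suc n))"
        unfolding t t' by (cases n) (simp_all add: algebra_simps)
      also have "\<dots> = - shell_rhs \<psi> n"
        unfolding s2 shell_rhs_eq by (cases n) (simp_all add: algebra_simps)
      finally show ?thesis by (simp add: complex_eq_iff)
    qed
    finally show ?thesis .
  qed
  then have "(\<lambda>N. \<Sum>i\<in>UNIV. complex_of_real (dir k $ i) * (2 * complex_of_real pi * \<i> * (\<Sum>j\<in>UNIV. of_int (k $ j) * A N i j)))
      \<longlonglongrightarrow> - \<i> * complex_of_real (shell_rhs \<psi> n)"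
    by (intro tendsto_eventually) (auto simp: eventually_sequentially)
  from LIMSEQ_unique[OF this lim] show ?thesis
    unfolding advection_hat_nth[OF um rep ss] I_def by simp
qed

text \<open>The minus sign anticipates moving the nonlinearity to the other side, so that amplitudes
  evolve by \<open>+ shell_rhs\<close>. Reality of the field supplies the coefficients on the
  reflected shells.\<close>

theorem proj_M_advection:
  assumes L2: "L2_field u" and c: "fhat u = scoef \<psi>" and sm: "summable (\<lambda>n. (rescale \<psi> n)\<^sup>2)"
  shows "proj_M (advection_hat u) = scoef (\<lambda>n. - shell_rhs \<psi> n)"
proof -
  have um: "u \<in> borel_measurable lebesgue" by (rule L2_measurable[OF L2])
  note ss = summable_scoef[OF sm]
  have rep: "AE x in lebesgue. cvec (u x) = trig_series shell_pm (scoef \<psi>) x"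
    unfolding c[symmetric]
  proof (rule AE_eq_trig_series[OF shell_pm_partition L2])
    show "fhat u k = 0" if "k \<notin> (\<Union>n. shell_pm n)" for k
      using that unfolding UN_shell_pm c by (rule scoef_outside)
    show "summable (\<lambda>n. \<Sum>k\<in>shell_pm n. norm (fhat u k))" unfolding c by (rule ss)
  qed
  show ?thesis
  proof (rule scoefI)
    fix n k assume k: "k \<in> shell n"
    show "proj_M (advection_hat u) k = (\<i> * complex_of_real (- shell_rhs \<psi> n)) *s cvec (dir k)"
      using proj_advection_shell[OF um rep sm k] shell_subset(1)[OF k] by (simp add: proj_M_def)
    have "(\<Sum>i\<in>UNIV. complex_of_real (dir k $ i) * advection_hat u (- k) $ i)
        = cnj (\<Sum>i\<in>UNIV. complex_of_real (dir k $ i) * advection_hat u k $ i)"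
      by (simp add: advection_hat_minus[OF um rep ss])
    also have "\<dots> = \<i> * complex_of_real (shell_rhs \<psi> n)"
      unfolding proj_advection_shell[OF um rep sm k] by simp
    finally show "proj_M (advection_hat u) (- k) = - proj_M (advection_hat u) k"
      using proj_advection_shell[OF um rep sm k] shell_subset[OF k]
      by (simp add: proj_M_def dir_minus vec_eq_iff)
  qed (simp add: proj_M_def)
qed

section \<open>Solutions and shell flows\<close>

text \<open>The dictionary between a field and its amplitudes. It covers symmetric solutions and
  fields built from amplitudes alike, so both directions of translation share the lemmas
  below.\<close>

definition shell_state :: "(real ^ 3 \<Rightarrow> real ^ 3) \<Rightarrow> (nat \<Rightarrow> real) \<Rightarrow> bool" where
  "shell_state u \<psi> \<longleftrightarrow> L2_field u \<and> fhat u = scoef \<psi> \<and> summable (\<lambda>n. (rescale \<psi> n)\<^sup>2)"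

lemma shell_state_symmetric:
  assumes u: "u \<in> HdotM s_crit" and "odd_field u" "permutation_symmetric u" "sigma_mirror_symmetric u"
  shows "shell_state u (psi_coeffs s_crit u)"
proof -
  obtain \<psi> where \<psi>: "fhat u = scoef \<psi>" using symmetric_fhat[OF assms] .
  have sm: "summable (\<lambda>n. (rescale \<psi> n)\<^sup>2)"
    using HdotM_rep(2)[OF u] unfolding \<psi> by (rule summable_rescale_if_Hdot)
  show ?thesis
    using HdotM_rep(1)[OF u] \<psi> sm psi_coeffs_eq[OF HdotM_rep(1)[OF u] \<psi> sm] by (simp add: shell_state_def)
qed

lemma shell_state_shell_field: "summable (\<lambda>n. (rescale \<psi> n)\<^sup>2) \<Longrightarrow> shell_state (shell_field \<psi>) \<psi>"
  by (simp add: shell_state_def L2_shell_field fhat_shell_field)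

lemma proj_M_advection_state: "shell_state u \<psi> \<Longrightarrow> proj_M (advection_hat u) = scoef (\<lambda>n. - shell_rhs \<psi> n)"
  unfolding shell_state_def by (blast intro: proj_M_advection)

lemma
  assumes "shell_state u \<psi>" "shell_state v \<phi>"
  shows Hdot_norm_diff_ge: "l2_norm (\<lambda>n. rescale \<psi> n - rescale \<phi> n) \<le> Hdot_norm s_crit (\<lambda>x. u x - v x)"
    and Hdot_norm_diff_le: "Hdot_norm s_crit (\<lambda>x. u x - v x)
      \<le> sqrt (12 * weight_const) * l2_norm (\<lambda>n. rescale \<psi> n - rescale \<phi> n)"
proof -
  have f: "fhat (\<lambda>x. u x - v x) = scoef (\<lambda>n. \<psi> n - \<phi> n)"
    using assms by (intro fhat_diff_shell_fields) (auto simp: shell_state_def)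
  have s: "summable (\<lambda>n. (rescale (\<lambda>n. \<psi> n - \<phi> n) n)\<^sup>2)"
    using assms by (intro summable_rescale_diff) (auto simp: shell_state_def)
  have r: "rescale (\<lambda>n. \<psi> n - \<phi> n) = (\<lambda>n. rescale \<psi> n - rescale \<phi> n)"
    by (simp add: fun_eq_iff rescale_diff)
  show "l2_norm (\<lambda>n. rescale \<psi> n - rescale \<phi> n) \<le> Hdot_norm s_crit (\<lambda>x. u x - v x)"
    "Hdot_norm s_crit (\<lambda>x. u x - v x) \<le> sqrt (12 * weight_const) * l2_norm (\<lambda>n. rescale \<psi> n - rescale \<phi> n)"
    using Hdot_norm_ge[OF f s] Hdot_norm_le[OF f s] unfolding r .
qed

lemma fhat_difference_quotient:
  assumes "shell_state u \<psi>" "shell_state v \<phi>" "shell_state w \<xi>"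
  shows "fhat (\<lambda>x. (u x - v x) /\<^sub>R h - w x) = scoef (\<lambda>n. inverse h * (\<psi> n - \<phi> n) - \<xi> n)"
proof
  fix k
  have uv: "L2_field (\<lambda>x. u x - v x)"
  proof -
    have L: "L2_field u" "L2_field v" using assms by (auto simp: shell_state_def)
    have per: "periodic (\<lambda>x. u x - v x)" using L by (simp add: L2_field_def periodic_def)
    have m: "(\<lambda>x. u x - v x) \<in> borel_measurable lebesgue"
      using L by (intro borel_measurable_diff L2_measurable)
    have "set_integrable lebesgue (cbox 0 1) (\<lambda>x. 2 * (norm (u x))\<^sup>2 + 2 * (norm (v x))\<^sup>2)"
      using L by (intro set_integral_add set_integrable_mult_right) (auto simp: L2_field_def)
    then have "set_integrable lebesgue (cbox 0 1) (\<lambda>x. (norm (u x - v x))\<^sup>2)"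
      unfolding set_integrable_def
    proof (rule Bochner_Integration.integrable_bound)
      show "(\<lambda>x. indicator (cbox 0 1) x *\<^sub>R (norm (u x - v x))\<^sup>2) \<in> borel_measurable lebesgue"
        by (intro borel_measurable_scaleR borel_measurable_indicator borel_measurable_power
            measurable_compose[OF m borel_measurable_norm]) simp_all
      have "(norm (a - b))\<^sup>2 \<le> 2 * (norm a)\<^sup>2 + 2 * (norm b)\<^sup>2" for a b :: "real ^ 3"
      proof -
        have "0 \<le> (norm (a + b))\<^sup>2" by simp
        then show ?thesis by (simp add: power2_norm_eq_inner inner_diff_left inner_diff_right inner_add_left inner_add_right inner_commute)
      qed
      then show "AE x in lebesgue. norm (indicator (cbox 0 1) x *\<^sub>R (norm (u x - v x))\<^sup>2)
          \<le> norm (indicator (cbox 0 1) x *\<^sub>R (2 * (norm (u x))\<^sup>2 + 2 * (norm (v x))\<^sup>2))"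
        by (intro AE_I2) (auto simp: indicator_def)
    qed
    then show ?thesis using per m by (simp add: L2_field_def)
  qed
  have sc: "L2_field (\<lambda>x. (u x - v x) /\<^sub>R h)"
    using uv by (auto simp: L2_field_def periodic_def power_mult_distrib)
  have "fhat (\<lambda>x. (u x - v x) /\<^sub>R h - w x) k = inverse h *\<^sub>R fhat (\<lambda>x. u x - v x) k - fhat w k"
    using fhat_diff[OF sc, of w k] fhat_scaleR[of "inverse h" "\<lambda>x. u x - v x" k] assms(3)
    by (simp add: shell_state_def)
  also have "fhat (\<lambda>x. u x - v x) = scoef (\<lambda>n. \<psi> n - \<phi> n)"
    using assms by (intro fhat_diff_shell_fields) (auto simp: shell_state_def)
  also have "fhat w = scoef \<xi>" using assms by (simp add: shell_state_def)
  finally show "fhat (\<lambda>x. (u x - v x) /\<^sub>R h - w x) k = scoef (\<lambda>n. inverse h * (\<psi> n - \<phi> n) - \<xi> n) k"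
    by (simp only: scoef_diff[of "\<lambda>n. inverse h * (\<psi> n - \<phi> n)" \<xi>] scoef_scale)
qed

lemma rescale_quotient:
  "rescale (\<lambda>n. inverse h * (\<psi> n - \<phi> n) - \<xi> n) = (\<lambda>n. inverse h * (rescale \<psi> n - rescale \<phi> n) - rescale \<xi> n)"
  by (simp add: fun_eq_iff rescale_def algebra_simps)

lemma summable_l2_scale: "summable (\<lambda>n. (x n)\<^sup>2) \<Longrightarrow> summable (\<lambda>n. (r * x n)\<^sup>2)"
  for x :: "nat \<Rightarrow> real"
  by (simp add: power_mult_distrib)

lemma summable_shell_nl:
  assumes x: "summable (\<lambda>n. (x n)\<^sup>2)"
  shows "summable (\<lambda>n. (shell_nl triad_weight x n)\<^sup>2)"
  by (rule l2_normI(1), rule order_trans[OF L2_set_le_sum_abs])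
    (rule sum_shell_nl_le[where \<beta> = triad_weight, OF triad_weight_bounds x])

lemma shell_state_rhs:
  assumes "shell_state u \<psi>"
  shows "summable (\<lambda>n. (rescale (shell_rhs \<psi>) n)\<^sup>2)"
  unfolding rescale_shell_rhs using assms by (intro summable_shell_nl) (auto simp: shell_state_def)

lemma continuous_HdotM_iff:
  assumes st: "\<And>t. t \<in> time_dom T \<Longrightarrow> shell_state (u t) (\<psi> t)"
  shows "continuous_HdotM s_crit T u \<longleftrightarrow> (\<forall>t\<in>time_dom T. u t \<in> HdotM s_crit \<and>
     ((\<lambda>\<tau>. l2_norm (\<lambda>n. rescale (\<psi> \<tau>) n - rescale (\<psi> t) n)) \<longlongrightarrow> 0) (at t within time_dom T))"
proof -
  have "((\<lambda>\<tau>. Hdot_norm s_crit (\<lambda>x. u \<tau> x - u t x)) \<longlongrightarrow> 0) (at t within time_dom T) \<longleftrightarrow>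
     ((\<lambda>\<tau>. l2_norm (\<lambda>n. rescale (\<psi> \<tau>) n - rescale (\<psi> t) n)) \<longlongrightarrow> 0) (at t within time_dom T)"
    (is "?H \<longleftrightarrow> ?L") if t: "t \<in> time_dom T" for t
  proof
    have ev: "\<forall>\<^sub>F \<tau> in at t within time_dom T. \<tau> \<in> time_dom T"
      by (auto simp: eventually_at intro: exI[of _ 1])
    have nn: "0 \<le> l2_norm (\<lambda>n. rescale (\<psi> \<tau>) n - rescale (\<psi> t) n)" if "\<tau> \<in> time_dom T" for \<tau>
      using st[OF that] st[OF t] by (intro l2_norm_nonneg summable_l2_diff) (auto simp: shell_state_def)
    have ge: "\<forall>\<^sub>F \<tau> in at t within time_dom T.
        l2_norm (\<lambda>n. rescale (\<psi> \<tau>) n - rescale (\<psi> t) n) \<le> Hdot_norm s_crit (\<lambda>x. u \<tau> x - u t x)"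
      by (rule eventually_mono[OF ev]) (rule Hdot_norm_diff_ge[OF st st[OF t]])
    have le: "\<forall>\<^sub>F \<tau> in at t within time_dom T. Hdot_norm s_crit (\<lambda>x. u \<tau> x - u t x)
        \<le> sqrt (12 * weight_const) * l2_norm (\<lambda>n. rescale (\<psi> \<tau>) n - rescale (\<psi> t) n)"
      by (rule eventually_mono[OF ev]) (rule Hdot_norm_diff_le[OF st st[OF t]])
    have nn0: "\<forall>\<^sub>F \<tau> in at t within time_dom T. 0 \<le> l2_norm (\<lambda>n. rescale (\<psi> \<tau>) n - rescale (\<psi> t) n)"
      by (rule eventually_mono[OF ev nn])
    show ?L if ?H
      by (rule tendsto_sandwich[OF nn0 ge tendsto_const that])
    show ?H if ?L
      using nn0 ge by (intro tendsto_sandwich[OF _ le tendsto_const tendsto_mult_right_zero[OF that]]) (auto elim: eventually_elim2)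
  qed
  then show ?thesis unfolding continuous_HdotM_def by blast
qed

lemma l2_tendsto_component:
  assumes lim: "((\<lambda>\<tau>. l2_norm (\<lambda>n. a \<tau> n - a t n)) \<longlongrightarrow> 0) (at t within D)"
    and sm: "\<And>\<tau>. \<tau> \<in> D \<Longrightarrow> summable (\<lambda>n. (a \<tau> n)\<^sup>2)" and t: "t \<in> D"
  shows "((\<lambda>\<tau>. a \<tau> n) \<longlongrightarrow> a t n) (at (t::real) within D)"
proof -
  have "\<bar>a \<tau> n - a t n\<bar> \<le> l2_norm (\<lambda>n. a \<tau> n - a t n)" if "\<tau> \<in> D" for \<tau>
    by (rule abs_le_l2_norm[of "\<lambda>n. a \<tau> n - a t n"]) (intro summable_l2_diff sm that t)
  then have "((\<lambda>\<tau>. a \<tau> n - a t n) \<longlongrightarrow> 0) (at t within D)"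
    by (intro tendsto_rabs_zero_cancel[OF tendsto_sandwich[OF _ _ tendsto_const lim]])
      (auto simp: eventually_at intro: exI[of _ 1])
  then show ?thesis by (simp add: LIM_zero_iff)
qed

section \<open>Solutions and shell flows, in both directions\<close>

theorem Euler_imp_flow:
  assumes st: "\<And>t. t \<in> time_dom T \<Longrightarrow> shell_state (u t) (\<psi> t)" and sol: "Euler_solution s_crit T u"
  shows "shell_flow triad_weight (\<lambda>_. 0) T (\<lambda>t. rescale (\<psi> t))"
proof -
  obtain u' where u': "continuous_HdotM s_crit T u'" "has_time_derivative s_crit T u u'"
      "\<And>t k. t \<in> time_dom T \<Longrightarrow> fhat (u' t) k + proj_M (advection_hat (u t)) k = 0"
    and c: "continuous_HdotM s_crit T u"
    using sol unfolding Euler_solution_def by blast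
  show ?thesis
    unfolding shell_flow_def
  proof (intro ballI conjI allI)
    fix t n assume t: "t \<in> time_dom T"
    show "summable (\<lambda>n. (rescale (\<psi> t) n)\<^sup>2)" using st[OF t] by (simp add: shell_state_def)
    show "((\<lambda>\<tau>. l2_norm (\<lambda>n. rescale (\<psi> \<tau>) n - rescale (\<psi> t) n)) \<longlongrightarrow> 0) (at t within time_dom T)"
      using iffD1[OF continuous_HdotM_iff[of T u \<psi>, OF st] c] t by blast
    \<comment> \<open>The equation determines the coefficients of the time derivative, so
      \<open>u' t\<close> has amplitudes too.\<close>
    have st': "shell_state (u' t) (shell_rhs (\<psi> t))"
    proof -
      have "fhat (u' t) k = scoef (shell_rhs (\<psi> t)) k" for k
        using u'(3)[OF t, of k] unfolding proj_M_advection_state[OF st[OF t]] scoef_uminus by simp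
      moreover have "u' t \<in> HdotM s_crit" using u'(1) t by (simp add: continuous_HdotM_def)
      ultimately show ?thesis
        using HdotM_rep(1) shell_state_rhs[OF st[OF t]] by (auto simp: shell_state_def)
    qed
    let ?q = "\<lambda>\<tau>. inverse (\<tau> - t) * (rescale (\<psi> \<tau>) n - rescale (\<psi> t) n) - shell_nl triad_weight (rescale (\<psi> t)) n"
    have lim: "((\<lambda>\<tau>. Hdot_norm s_crit (\<lambda>x. (u \<tau> x - u t x) /\<^sub>R (\<tau> - t) - u' t x)) \<longlongrightarrow> 0) (at t within time_dom T)"
      using u'(2) t by (simp add: has_time_derivative_def)
    \<comment> \<open>The field norm dominates every rescaled component, so norm convergence of the
      quotient yields the scalar derivative.\<close>
    have le: "\<bar>?q \<tau>\<bar> \<le> Hdot_norm s_crit (\<lambda>x. (u \<tau> x - u t x) /\<^sub>R (\<tau> - t) - u' t x)" if \<tau>: "\<tau> \<in> time_dom T" for \<tau>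
    proof -
      have "summable (\<lambda>n. (rescale (\<lambda>n. inverse (\<tau> - t) * (\<psi> \<tau> n - \<psi> t n) - shell_rhs (\<psi> t) n) n)\<^sup>2)"
        unfolding rescale_quotient using st[OF \<tau>] st[OF t] st'
        by (intro summable_l2_diff summable_l2_scale) (auto simp: shell_state_def)
      from rescale_abs_le_Hdot_norm[OF fhat_difference_quotient[OF st[OF \<tau>] st[OF t] st'] this, of n]
      show ?thesis by (simp add: rescale_quotient rescale_shell_rhs)
    qed
    have "(?q \<longlongrightarrow> 0) (at t within time_dom T)"
      by (rule tendsto_rabs_zero_cancel, rule tendsto_sandwich[OF _ _ tendsto_const lim])
        (use le in \<open>auto simp: eventually_at intro: exI[of _ 1]\<close>)
    then show "((\<lambda>\<tau>. rescale (\<psi> \<tau>) n) has_real_derivative - 0 * rescale (\<psi> t) n + shell_nl triad_weight (rescale (\<psi> t)) n) (at t within time_dom T)"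
      by (simp add: has_field_derivative_iff LIM_zero_iff divide_inverse mult.commute)
  qed
qed

definition dissipation :: "real \<Rightarrow> real \<Rightarrow> nat \<Rightarrow> real" where
  "dissipation \<nu> \<alpha> n = \<nu> * (4 * pi\<^sup>2 * freq_sq n) powr \<alpha>"

lemma heat_symbol_shell: "k \<in> shell_pm n \<Longrightarrow> heat_symbol \<nu> \<alpha> t k = exp (- dissipation \<nu> \<alpha> n * t)"
  by (simp add: heat_symbol_def dissipation_def Laplace_symbol_shell_pm mult_ac)

lemma scoef_scaleR: "k \<in> shell_pm n \<Longrightarrow> scoef \<psi> k = \<psi> n *\<^sub>R scoef (\<lambda>_. 1) k"
  by (cases "k \<in> freq_set") (simp_all add: scoef_def vec_eq_iff shell_level_eq, simp add: scaleR_conv_of_real)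

text \<open>At a fixed frequency everything is a real multiple of one nonzero vector, so the vector
  Duhamel formula is equivalent to a scalar one. Multiplying by the growing exponential and by
  \<open>sqrt 3 ^ n\<close> gives the form used for shell flows; the equivalence serves both
  directions.\<close>

lemma
  assumes st: "\<And>\<tau>. \<tau> \<in> {0..t} \<Longrightarrow> shell_state (u \<tau>) (\<psi> \<tau>)" and t: "0 \<le> t"
    and cont: "\<And>n. continuous_on {0..t} (\<lambda>\<tau>. rescale (\<psi> \<tau>) n)" and k: "k \<in> shell_pm n"
  shows NS_integrable: "(\<lambda>\<tau>. heat_symbol \<nu> \<alpha> (t - \<tau>) k *\<^sub>R proj_M (advection_hat (u \<tau>)) k) absolutely_integrable_on {0..t}"
    and NS_coefficient: "fhat (u t) k = heat_symbol \<nu> \<alpha> t k *\<^sub>R fhat (u 0) k -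
         integral {0..t} (\<lambda>\<tau>. heat_symbol \<nu> \<alpha> (t - \<tau>) k *\<^sub>R proj_M (advection_hat (u \<tau>)) k)
       \<longleftrightarrow> exp (dissipation \<nu> \<alpha> n * t) * rescale (\<psi> t) n = rescale (\<psi> 0) n +
         integral {0..t} (\<lambda>\<tau>. exp (dissipation \<nu> \<alpha> n * \<tau>) * shell_nl triad_weight (rescale (\<psi> \<tau>)) n)"
proof -
  define l where "l = dissipation \<nu> \<alpha> n"
  define w where "w = scoef (\<lambda>_. 1) k"
  define N where "N = (\<lambda>\<tau>. shell_nl triad_weight (rescale (\<psi> \<tau>)) n)"
  have w0: "w \<noteq> 0" using norm_scoef[OF k, of "\<lambda>_. 1"] by (auto simp: w_def)
  have Nc: "continuous_on {0..t} N" unfolding N_def by (rule continuous_on_shell_nl[OF cont])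
  define g where "g = (\<lambda>\<tau>. - (exp (- l * t) / sqrt 3 ^ n * (exp (l * \<tau>) * N \<tau>)))"
  have gc: "continuous_on {0..t} g" unfolding g_def by (intro continuous_intros Nc)
  have eq: "heat_symbol \<nu> \<alpha> (t - \<tau>) k *\<^sub>R proj_M (advection_hat (u \<tau>)) k = g \<tau> *\<^sub>R w" if "\<tau> \<in> {0..t}" for \<tau>
  proof -
    have "exp (- l * (t - \<tau>)) = exp (- l * t) * exp (l * \<tau>)"
      by (simp add: exp_add[symmetric] algebra_simps)
    then show ?thesis
      unfolding proj_M_advection_state[OF st[OF that]] heat_symbol_shell[OF k] w_def scoef_scaleR[OF k, of "\<lambda>n. - shell_rhs (\<psi> \<tau>) n"]
      by (simp add: g_def l_def shell_rhs_def N_def)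
  qed
  have "(\<lambda>\<tau>. g \<tau> *\<^sub>R w) absolutely_integrable_on {0..t}"
    by (intro absolutely_integrable_continuous_real continuous_intros gc)
  then show "(\<lambda>\<tau>. heat_symbol \<nu> \<alpha> (t - \<tau>) k *\<^sub>R proj_M (advection_hat (u \<tau>)) k) absolutely_integrable_on {0..t}"
    by (subst set_integrable_cong[OF refl refl eq])
  have "integral {0..t} (\<lambda>\<tau>. heat_symbol \<nu> \<alpha> (t - \<tau>) k *\<^sub>R proj_M (advection_hat (u \<tau>)) k)
      = integral {0..t} (\<lambda>\<tau>. g \<tau> *\<^sub>R w)"
    by (rule integral_cong) (rule eq)
  also have "\<dots> = integral {0..t} g *\<^sub>R w"
    by (intro integral_unique has_integral_scaleR_left integrable_integral integrable_continuous_real gc)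
  also have "integral {0..t} g = - (exp (- l * t) / sqrt 3 ^ n * integral {0..t} (\<lambda>\<tau>. exp (l * \<tau>) * N \<tau>))"
    unfolding g_def by simp
  finally have int: "integral {0..t} (\<lambda>\<tau>. heat_symbol \<nu> \<alpha> (t - \<tau>) k *\<^sub>R proj_M (advection_hat (u \<tau>)) k)
      = (- (exp (- l * t) / sqrt 3 ^ n * integral {0..t} (\<lambda>\<tau>. exp (l * \<tau>) * N \<tau>))) *\<^sub>R w" .
  have f: "fhat (u \<tau>) k = \<psi> \<tau> n *\<^sub>R w" if "\<tau> \<in> {0..t}" for \<tau>
    using st[OF that] scoef_scaleR[OF k, of "\<psi> \<tau>"] by (simp add: shell_state_def w_def)
  have "fhat (u t) k = heat_symbol \<nu> \<alpha> t k *\<^sub>R fhat (u 0) k -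
         integral {0..t} (\<lambda>\<tau>. heat_symbol \<nu> \<alpha> (t - \<tau>) k *\<^sub>R proj_M (advection_hat (u \<tau>)) k)
     \<longleftrightarrow> \<psi> t n *\<^sub>R w = (exp (- l * t) * \<psi> 0 n + exp (- l * t) / sqrt 3 ^ n * integral {0..t} (\<lambda>\<tau>. exp (l * \<tau>) * N \<tau>)) *\<^sub>R w"
    unfolding int using f[of t] f[of 0] t heat_symbol_shell[OF k, of \<nu> \<alpha> t]
    by (simp add: l_def scaleR_add_left)
  also have "\<dots> \<longleftrightarrow> \<psi> t n = exp (- l * t) * \<psi> 0 n + exp (- l * t) / sqrt 3 ^ n * integral {0..t} (\<lambda>\<tau>. exp (l * \<tau>) * N \<tau>)"
    using w0 by (simp only: scaleR_cancel_right) simp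
  also have "\<dots> \<longleftrightarrow> exp (l * t) * rescale (\<psi> t) n = rescale (\<psi> 0) n + integral {0..t} (\<lambda>\<tau>. exp (l * \<tau>) * N \<tau>)"
  proof -
    have e: "exp (- l * t) * exp (l * t) = 1" by (simp add: exp_add[symmetric])
    have "x = E * y + E / s * z \<longleftrightarrow> E' * (s * x) = s * y + z"
      if "s \<noteq> 0" "E * E' = 1" for x y z s E E' :: real
    proof -
      have E0: "E \<noteq> 0" using that(2) by auto
      then have E': "E' = 1 / E" using that(2) by (simp add: eq_divide_eq mult.commute)
      show ?thesis unfolding E' using E0 that(1) by (auto simp: field_simps)
    qed
    from this[OF _ e] show ?thesis unfolding rescale_def by simp
  qed
  finally show "fhat (u t) k = heat_symbol \<nu> \<alpha> t k *\<^sub>R fhat (u 0) k -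
         integral {0..t} (\<lambda>\<tau>. heat_symbol \<nu> \<alpha> (t - \<tau>) k *\<^sub>R proj_M (advection_hat (u \<tau>)) k)
       \<longleftrightarrow> exp (dissipation \<nu> \<alpha> n * t) * rescale (\<psi> t) n = rescale (\<psi> 0) n +
         integral {0..t} (\<lambda>\<tau>. exp (dissipation \<nu> \<alpha> n * \<tau>) * shell_nl triad_weight (rescale (\<psi> \<tau>)) n)"
    by (simp add: l_def N_def)
qed

text \<open>The time domain is half open while the Duhamel calculus uses closed intervals; near
  \<open>t\<close> the filters coincide once the interval ends after \<open>t\<close>.\<close>

lemma at_within_time_dom:
  assumes "t \<in> time_dom T"
  obtains s where "s \<in> time_dom T" "t < s" "at t within time_dom T = at t within {0..s}"
proof -
  obtain s where s: "ereal t < ereal s" "ereal s < T"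
    using assms ereal_dense2[of "ereal t" T] by auto
  then have sD: "s \<in> time_dom T" using assms by auto
  have "at t within time_dom T = at t within {0..s}"
    by (rule at_within_nhd[of t "{..<s}"]) (use s sD atLeastAtMost_subset_time_dom[OF sD] in auto)
  then show thesis using that sD s by auto
qed

theorem NS_imp_flow:
  assumes st: "\<And>t. t \<in> time_dom T \<Longrightarrow> shell_state (u t) (\<psi> t)" and sol: "NS_solution \<nu> \<alpha> s_crit T u"
  shows "shell_flow triad_weight (dissipation \<nu> \<alpha>) T (\<lambda>t. rescale (\<psi> t))"
proof -
  have c: "continuous_HdotM s_crit T u" using sol by (simp add: NS_solution_def)
  have lim: "((\<lambda>\<tau>. l2_norm (\<lambda>n. rescale (\<psi> \<tau>) n - rescale (\<psi> t) n)) \<longlongrightarrow> 0) (at t within time_dom T)"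
    if "t \<in> time_dom T" for t
    using iffD1[OF continuous_HdotM_iff[of T u \<psi>, OF st] c] that by blast
  have sm: "summable (\<lambda>n. (rescale (\<psi> t) n)\<^sup>2)" if "t \<in> time_dom T" for t
    using st[OF that] by (simp add: shell_state_def)
  have cont: "continuous_on (time_dom T) (\<lambda>t. rescale (\<psi> t) n)" for n
    unfolding continuous_on_def
    using l2_tendsto_component[where a = "\<lambda>t. rescale (\<psi> t)", OF lim sm] by blast
  show ?thesis
    unfolding shell_flow_def
  proof (intro ballI conjI allI lim sm)
    fix t n assume t: "t \<in> time_dom T"
    obtain s where s: "s \<in> time_dom T" "t < s" "at t within time_dom T = at t within {0..s}"
      using at_within_time_dom[OF t] .
    have sub: "{0..s} \<subseteq> time_dom T" by (rule atLeastAtMost_subset_time_dom[OF s(1)])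
    \<comment> \<open>Any one frequency of the shell determines its amplitude.\<close>
    obtain k where k: "k \<in> shell_pm n"
    proof -
      have "shell n \<noteq> {}" using card_shell[of n] by auto
      then show thesis using that by (auto simp: shell_pm_def)
    qed
    show "((\<lambda>\<tau>. rescale (\<psi> \<tau>) n) has_real_derivative - dissipation \<nu> \<alpha> n * rescale (\<psi> t) n
        + shell_nl triad_weight (rescale (\<psi> t)) n) (at t within time_dom T)"
      unfolding s(3)
    proof (rule deriv_of_duhamel)
      show "continuous_on {0..s} (\<lambda>\<tau>. shell_nl triad_weight (rescale (\<psi> \<tau>)) n)"
        by (intro continuous_on_shell_nl continuous_on_subset[OF cont sub])
      show "t \<in> {0..s}" using t s by auto
      fix r assume r: "r \<in> {0..s}"
      then have rD: "r \<in> time_dom T" and rsub: "{0..r} \<subseteq> time_dom T" using sub by auto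
      have "fhat (u r) k = heat_symbol \<nu> \<alpha> r k *\<^sub>R fhat (u 0) k -
         integral {0..r} (\<lambda>\<tau>. heat_symbol \<nu> \<alpha> (r - \<tau>) k *\<^sub>R proj_M (advection_hat (u \<tau>)) k)"
        using sol rD unfolding NS_solution_def by blast
      then show "exp (dissipation \<nu> \<alpha> n * r) * rescale (\<psi> r) n = rescale (\<psi> 0) n +
         integral {0..r} (\<lambda>\<tau>. exp (dissipation \<nu> \<alpha> n * \<tau>) * shell_nl triad_weight (rescale (\<psi> \<tau>)) n)"
        using r rsub by (subst (asm) NS_coefficient[OF st _ continuous_on_subset[OF cont rsub] k]) auto
    qed
  qed
qed

text \<open>An Euler solution must be differentiable in the field norm, whereas a flow provides
  scalar derivatives. The gap is closed in l1: the nonlinearity is continuous from l2 into l1, and a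
  mean value inequality bounds the defect of the difference quotient in l1, hence in l2.\<close>

theorem flow_imp_Euler:
  assumes st: "\<And>t. t \<in> time_dom T \<Longrightarrow> shell_state (u t) (\<psi> t)"
    and M: "\<And>t. t \<in> time_dom T \<Longrightarrow> u t \<in> HdotM s_crit"
    and flow: "shell_flow triad_weight (\<lambda>_. 0) T (\<lambda>t. rescale (\<psi> t))"
  shows "Euler_solution s_crit T u"
proof -
  define a where "a = (\<lambda>t. rescale (\<psi> t))"
  define u' where "u' = (\<lambda>t. shell_field (shell_rhs (\<psi> t)))"
  have sm: "summable (\<lambda>n. (a t n)\<^sup>2)" if "t \<in> time_dom T" for t
    using st[OF that] by (simp add: shell_state_def a_def)
  have lim: "((\<lambda>\<tau>. l2_norm (\<lambda>n. a \<tau> n - a t n)) \<longlongrightarrow> 0) (at t within time_dom T)" if "t \<in> time_dom T" for t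
    using flow that by (simp add: shell_flow_def a_def)
  have deriv: "((\<lambda>\<tau>. a \<tau> n) has_real_derivative shell_nl triad_weight (a t) n) (at t within time_dom T)"
    if "t \<in> time_dom T" for t n
  proof -
    have "((\<lambda>\<tau>. rescale (\<psi> \<tau>) n) has_real_derivative - 0 * rescale (\<psi> t) n + shell_nl triad_weight (rescale (\<psi> t)) n)
        (at t within time_dom T)"
      using flow that unfolding shell_flow_def by blast
    then show ?thesis by (simp add: a_def)
  qed
  have st': "shell_state (u' t) (shell_rhs (\<psi> t))" if "t \<in> time_dom T" for t
    unfolding u'_def by (rule shell_state_shell_field[OF shell_state_rhs[OF st[OF that]]])
  have ev: "\<forall>\<^sub>F \<tau> in at t within time_dom T. \<tau> \<in> time_dom T" for t
    by (auto simp: eventually_at intro: exI[of _ 1])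
  \<comment> \<open>A modulus of continuity at \<open>a t\<close>: the norm at the nearby time is
    replaced by \<open>l2_norm (a t) + d\<close>, leaving a function of \<open>d\<close> that
    vanishes at 0.\<close>
  define C where "C t d = 4 * sqrt 2 * pi * d * (2 * l2_norm (a t) + d)" for t d
  have nl1: "(\<Sum>n<N. \<bar>shell_nl triad_weight (a \<tau>) n - shell_nl triad_weight (a t) n\<bar>) \<le> C t (l2_norm (\<lambda>n. a \<tau> n - a t n))"
    if t: "t \<in> time_dom T" and \<tau>: "\<tau> \<in> time_dom T" for t \<tau> N
  proof -
    note d = summable_l2_diff[OF sm[OF \<tau>] sm[OF t]]
    have "l2_norm (a \<tau>) \<le> l2_norm (\<lambda>n. a \<tau> n - a t n) + l2_norm (a t)"
      using l2_norm_triangle[OF d sm[OF t]] by simp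
    then have "l2_norm (a \<tau>) + l2_norm (a t) \<le> 2 * l2_norm (a t) + l2_norm (\<lambda>n. a \<tau> n - a t n)" by simp
    then have "4 * sqrt 2 * pi * l2_norm (\<lambda>n. a \<tau> n - a t n) * (l2_norm (a \<tau>) + l2_norm (a t)) \<le> C t (l2_norm (\<lambda>n. a \<tau> n - a t n))"
      unfolding C_def using l2_norm_nonneg[OF d] by (intro mult_left_mono) auto
    then show ?thesis
      using sum_shell_nl_diff_le[where \<beta> = triad_weight, OF triad_weight_bounds sm[OF \<tau>] sm[OF t], of N] by linarith
  qed
  have C0: "((\<lambda>\<tau>. C t (l2_norm (\<lambda>n. a \<tau> n - a t n))) \<longlongrightarrow> 0) (at t within time_dom T)" if t: "t \<in> time_dom T" for t
  proof -
    have "((\<lambda>\<tau>. C t (l2_norm (\<lambda>n. a \<tau> n - a t n))) \<longlongrightarrow> C t 0) (at t within time_dom T)"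
      unfolding C_def by (intro tendsto_intros lim t)
    then show ?thesis by (simp add: C_def)
  qed
  have cont_u: "continuous_HdotM s_crit T u"
    by (rule iffD2[OF continuous_HdotM_iff[of T u \<psi>, OF st]]) (use M lim in \<open>auto simp: a_def\<close>)
  have cont_u': "continuous_HdotM s_crit T u'"
  proof (rule iffD2[OF continuous_HdotM_iff[of T u' "\<lambda>t. shell_rhs (\<psi> t)", OF st']], assumption, intro ballI conjI)
    fix t assume t: "t \<in> time_dom T"
    show "u' t \<in> HdotM s_crit"
      unfolding u'_def by (rule shell_field_HdotM[OF shell_state_rhs[OF st[OF t]]])
    have le: "l2_norm (\<lambda>n. shell_nl triad_weight (a \<tau>) n - shell_nl triad_weight (a t) n) \<le> C t (l2_norm (\<lambda>n. a \<tau> n - a t n))"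
      if "\<tau> \<in> time_dom T" for \<tau>
      by (rule l2_normI(2), rule order_trans[OF L2_set_le_sum_abs nl1[OF t that]])
    have nn: "0 \<le> l2_norm (\<lambda>n. shell_nl triad_weight (a \<tau>) n - shell_nl triad_weight (a t) n)"
      if "\<tau> \<in> time_dom T" for \<tau>
      by (intro l2_norm_nonneg summable_l2_diff summable_shell_nl sm that t)
    show "((\<lambda>\<tau>. l2_norm (\<lambda>n. rescale (shell_rhs (\<psi> \<tau>)) n - rescale (shell_rhs (\<psi> t)) n)) \<longlongrightarrow> 0) (at t within time_dom T)"
      unfolding rescale_shell_rhs a_def[THEN fun_cong, symmetric]
      by (rule tendsto_sandwich[OF eventually_mono[OF ev nn] eventually_mono[OF ev le] tendsto_const C0[OF t]])
  qed
  have "has_time_derivative s_crit T u u'"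
    unfolding has_time_derivative_def
  proof
    fix t assume t: "t \<in> time_dom T"
    define q where "q = (\<lambda>\<tau> n. inverse (\<tau> - t) * (a \<tau> n - a t n) - shell_nl triad_weight (a t) n)"
    have qs: "summable (\<lambda>n. (q \<tau> n)\<^sup>2)" if "\<tau> \<in> time_dom T" for \<tau>
      unfolding q_def by (intro summable_l2_diff summable_l2_scale summable_shell_nl sm that t)
    have small: "\<forall>\<^sub>F \<tau> in at t within time_dom T. l2_norm (q \<tau>) \<le> \<eta>" if \<eta>: "0 < \<eta>" for \<eta>
    proof -
      have "\<forall>\<^sub>F \<tau> in at t within time_dom T. C t (l2_norm (\<lambda>n. a \<tau> n - a t n)) < \<eta>"
        using order_tendstoD(2)[OF C0[OF t] \<eta>] .
      then obtain d where d: "0 < d"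
          "\<And>\<tau>. \<tau> \<in> time_dom T \<Longrightarrow> \<tau> \<noteq> t \<Longrightarrow> dist \<tau> t < d \<Longrightarrow> C t (l2_norm (\<lambda>n. a \<tau> n - a t n)) < \<eta>"
        unfolding eventually_at by blast
      define B where "B = time_dom T \<inter> ball t d"
      have Bc: "convex B"
      proof -
        have "convex (time_dom T)"
          unfolding is_interval_convex_1[symmetric] is_interval_1
          by (auto intro: le_less_trans[where y = "ereal _"])
        then show ?thesis unfolding B_def by (intro convex_Int convex_ball)
      qed
      have tB: "t \<in> B" using t d by (simp add: B_def)
      have nlB: "(\<Sum>n<N. \<bar>shell_nl triad_weight (a s) n - shell_nl triad_weight (a t) n\<bar>) \<le> \<eta>" if s: "s \<in> B" for s N
      proof (cases "s = t")
        case True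
        then show ?thesis using \<eta> by simp
      next
        case False
        then show ?thesis
          using nl1[OF t, of s N] d(2)[of s] s by (force simp: B_def dist_commute)
      qed
      have qB: "l2_norm (q \<tau>) \<le> \<eta>" if \<tau>: "\<tau> \<in> B" "\<tau> \<noteq> t" for \<tau>
      proof (rule l2_normI(2), rule order_trans[OF L2_set_le_sum_abs])
        fix N
        \<comment> \<open>Freezing the signs of the defect at \<open>\<tau>\<close> makes its l1 sum
          the increment of one scalar function \<open>g\<close>, to which the mean value inequality
          applies with a bound independent of \<open>N\<close>.\<close>
        define e where "e = (\<lambda>n. sgn (a \<tau> n - a t n - (\<tau> - t) * shell_nl triad_weight (a t) n))"
        define g where "g = (\<lambda>s. \<Sum>n<N. e n * (a s n - s * shell_nl triad_weight (a t) n))"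
        define g' where "g' = (\<lambda>s. \<Sum>n<N. e n * (shell_nl triad_weight (a s) n - shell_nl triad_weight (a t) n))"
        have dg: "(g has_real_derivative g' s) (at s within B)" if "s \<in> B" for s
        proof -
          have "((\<lambda>\<tau>. a \<tau> n) has_real_derivative shell_nl triad_weight (a s) n) (at s within B)" for n
            by (rule DERIV_subset[OF deriv]) (use that in \<open>auto simp: B_def\<close>)
          then show ?thesis
            unfolding g_def g'_def by (intro DERIV_sum) (auto intro!: derivative_eq_intros)
        qed
        have g'b: "norm (g' s) \<le> \<eta>" if "s \<in> B" for s
        proof -
          have "norm (g' s) \<le> (\<Sum>n<N. \<bar>shell_nl triad_weight (a s) n - shell_nl triad_weight (a t) n\<bar>)"
            unfolding g'_def by (rule order_trans[OF norm_sum], rule sum_mono) (auto simp: e_def abs_mult abs_sgn_eq)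
          then show ?thesis using nlB[OF that, of N] by linarith
        qed
        have "norm (g \<tau> - g t) \<le> \<eta> * norm (\<tau> - t)"
          by (rule field_differentiable_bound[OF Bc dg g'b \<tau>(1) tB])
        moreover have "g \<tau> - g t = (\<Sum>n<N. \<bar>a \<tau> n - a t n - (\<tau> - t) * shell_nl triad_weight (a t) n\<bar>)"
          unfolding g_def sum_subtractf[symmetric]
          by (intro sum.cong refl) (simp add: e_def abs_sgn algebra_simps)
        ultimately have "(\<Sum>n<N. \<bar>a \<tau> n - a t n - (\<tau> - t) * shell_nl triad_weight (a t) n\<bar>) \<le> \<eta> * \<bar>\<tau> - t\<bar>" by simp
        moreover have "(\<Sum>n<N. \<bar>q \<tau> n\<bar>) = (\<Sum>n<N. \<bar>a \<tau> n - a t n - (\<tau> - t) * shell_nl triad_weight (a t) n\<bar>) / \<bar>\<tau> - t\<bar>"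
          unfolding sum_divide_distrib
        proof (rule sum.cong[OF refl])
          fix n
          have "q \<tau> n = (a \<tau> n - a t n - (\<tau> - t) * shell_nl triad_weight (a t) n) / (\<tau> - t)"
            using \<tau>(2) by (simp add: q_def field_simps)
          then show "\<bar>q \<tau> n\<bar> = \<bar>a \<tau> n - a t n - (\<tau> - t) * shell_nl triad_weight (a t) n\<bar> / \<bar>\<tau> - t\<bar>"
            by (simp add: abs_divide)
        qed
        ultimately show "(\<Sum>n<N. \<bar>q \<tau> n\<bar>) \<le> \<eta>" using \<tau>(2) by (simp add: divide_le_eq)
      qed
      show ?thesis
        unfolding eventually_at using d(1) qB by (intro exI[of _ d]) (auto simp: B_def dist_commute)
    qed
    have q0: "((\<lambda>\<tau>. l2_norm (q \<tau>)) \<longlongrightarrow> 0) (at t within time_dom T)"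
    proof (rule tendstoI)
      fix \<epsilon> :: real assume "0 < \<epsilon>"
      then have "\<forall>\<^sub>F \<tau> in at t within time_dom T. l2_norm (q \<tau>) \<le> \<epsilon> / 2" by (intro small) simp
      then show "\<forall>\<^sub>F \<tau> in at t within time_dom T. dist (l2_norm (q \<tau>)) 0 < \<epsilon>"
        using ev[of t]
      proof eventually_elim
        case (elim \<tau>)
        then show ?case using \<open>0 < \<epsilon>\<close> l2_norm_nonneg[OF qs[OF elim(2)]] by (simp add: dist_real_def)
      qed
    qed
    let ?H = "\<lambda>\<tau>. Hdot_norm s_crit (\<lambda>x. (u \<tau> x - u t x) /\<^sub>R (\<tau> - t) - u' t x)"
    have H: "0 \<le> ?H \<tau>" "?H \<tau> \<le> sqrt (12 * weight_const) * l2_norm (q \<tau>)" if \<tau>: "\<tau> \<in> time_dom T" for \<tau>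
    proof -
      have r: "rescale (\<lambda>n. inverse (\<tau> - t) * (\<psi> \<tau> n - \<psi> t n) - shell_rhs (\<psi> t) n) = q \<tau>"
        by (simp add: rescale_quotient rescale_shell_rhs q_def a_def)
      note f = fhat_difference_quotient[OF st[OF \<tau>] st[OF t] st'[OF t], of "\<tau> - t"]
      show "0 \<le> ?H \<tau>"
        using Hdot_norm_ge[OF f] l2_norm_nonneg[OF qs[OF \<tau>]] qs[OF \<tau>] unfolding r by linarith
      show "?H \<tau> \<le> sqrt (12 * weight_const) * l2_norm (q \<tau>)"
        using Hdot_norm_le[OF f] qs[OF \<tau>] unfolding r by simp
    qed
    show "(?H \<longlongrightarrow> 0) (at t within time_dom T)"
      by (rule tendsto_sandwich[OF eventually_mono[OF ev H(1)] eventually_mono[OF ev H(2)] tendsto_const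
            tendsto_mult_right_zero[OF q0]])
  qed
  moreover have "fhat (u' t) k + proj_M (advection_hat (u t)) k = 0" if t: "t \<in> time_dom T" for t k
    using st'[OF t] unfolding shell_state_def proj_M_advection_state[OF st[OF t]] scoef_uminus by simp
  ultimately show ?thesis
    unfolding Euler_solution_def using cont_u cont_u' by blast
qed

theorem flow_imp_NS:
  assumes st: "\<And>t. t \<in> time_dom T \<Longrightarrow> shell_state (u t) (\<psi> t)"
    and M: "\<And>t. t \<in> time_dom T \<Longrightarrow> u t \<in> HdotM s_crit"
    and flow: "shell_flow triad_weight (dissipation \<nu> \<alpha>) T (\<lambda>t. rescale (\<psi> t))"
  shows "NS_solution \<nu> \<alpha> s_crit T u"
proof -
  have deriv: "((\<lambda>\<tau>. rescale (\<psi> \<tau>) n) has_real_derivative - dissipation \<nu> \<alpha> n * rescale (\<psi> t) n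
      + shell_nl triad_weight (rescale (\<psi> t)) n) (at t within time_dom T)" if "t \<in> time_dom T" for t n
    using flow that unfolding shell_flow_def by blast
  have cont: "continuous_on (time_dom T) (\<lambda>t. rescale (\<psi> t) n)" for n
    unfolding continuous_on_eq_continuous_within using DERIV_continuous[OF deriv] by blast
  have cont_u: "continuous_HdotM s_crit T u"
    by (rule iffD2[OF continuous_HdotM_iff[of T u \<psi>, OF st]]) (use M flow in \<open>auto simp: shell_flow_def\<close>)
  have "(\<lambda>\<tau>. heat_symbol \<nu> \<alpha> (t - \<tau>) k *\<^sub>R proj_M (advection_hat (u \<tau>)) k) absolutely_integrable_on {0..t} \<and>
       fhat (u t) k = heat_symbol \<nu> \<alpha> t k *\<^sub>R fhat (u 0) k -
         integral {0..t} (\<lambda>\<tau>. heat_symbol \<nu> \<alpha> (t - \<tau>) k *\<^sub>R proj_M (advection_hat (u \<tau>)) k)"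
    if t: "t \<in> time_dom T" for t k
  proof -
    have sub: "{0..t} \<subseteq> time_dom T" by (rule atLeastAtMost_subset_time_dom[OF t])
    have t0: "0 \<le> t" using t by simp
    have st': "shell_state (u \<tau>) (\<psi> \<tau>)" if "\<tau> \<in> {0..t}" for \<tau> using st sub that by blast
    show ?thesis
    proof (cases "k \<in> freq_set")
      case True
      then obtain n where k: "k \<in> shell_pm n" using UN_shell_pm by blast
      have "exp (dissipation \<nu> \<alpha> n * t) * rescale (\<psi> t) n = exp (dissipation \<nu> \<alpha> n * 0) * rescale (\<psi> 0) n +
         integral {0..t} (\<lambda>\<tau>. exp (dissipation \<nu> \<alpha> n * \<tau>) * shell_nl triad_weight (rescale (\<psi> \<tau>)) n)"
        by (rule duhamel_of_deriv[where f = "\<lambda>t. rescale (\<psi> t) n", OF t0]) (use DERIV_subset[OF deriv sub] sub in blast)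
      then show ?thesis
        using NS_integrable[where u = u and \<psi> = \<psi>, OF st' t0 continuous_on_subset[OF cont sub] k]
          NS_coefficient[where u = u and \<psi> = \<psi>, OF st' t0 continuous_on_subset[OF cont sub] k] by simp
    next
      case False
      have "proj_M (advection_hat (u \<tau>)) k = 0" for \<tau> using False by (simp add: proj_M_def)
      moreover have "fhat (u \<tau>) k = 0" if "\<tau> \<in> {0..t}" for \<tau>
        using st'[OF that] False by (simp add: shell_state_def scoef_outside)
      ultimately show ?thesis using t0 by (simp add: absolutely_integrable_on_def)
    qed
  qed
  then show ?thesis unfolding NS_solution_def using cont_u by blast
qed

section \<open>The estimate and the blow-up criterion\<close>

lemma seq_norm_1: "seq_norm 1 \<psi> = l2_norm (rescale \<psi>)"
proof -
  have "sqrt 3 powr (2 * 1 * real n) = 3 ^ n" for n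
  proof -
    have "sqrt 3 powr (2 * 1 * real n) = sqrt 3 powr real (2 * n)" by simp
    also have "\<dots> = (sqrt 3 ^ 2) ^ n" by (subst powr_realpow) (simp_all add: power_mult)
    finally show ?thesis by simp
  qed
  then show ?thesis by (simp add: seq_norm_def l2_norm_def rescale_power2)
qed

theorem theorem2p3:
  fixes u :: "real \<Rightarrow> real ^ 3 \<Rightarrow> real ^ 3" and Tmax :: ereal and \<nu> \<alpha> :: real
    and \<psi> :: "real \<Rightarrow> nat \<Rightarrow> real"
  assumes solution: "maximal_solution (Euler_solution s_crit) Tmax u \<or>
      (\<nu> > 0 \<and> \<alpha> > 0 \<and> maximal_solution (NS_solution \<nu> \<alpha> s_crit) Tmax u)"
    and symmetric: "\<And>t. t \<in> time_dom Tmax \<Longrightarrow>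
      odd_field (u t) \<and> permutation_symmetric (u t) \<and> sigma_mirror_symmetric (u t)"
    and coeffs: "\<And>t. t \<in> time_dom Tmax \<Longrightarrow> \<psi> t = psi_coeffs s_crit (u t)"
  shows "(\<forall>t\<in>time_dom Tmax. (seq_norm 1 (\<psi> t))\<^sup>2 \<le> (seq_norm 1 (\<psi> 0))\<^sup>2 *
           exp (4 * sqrt 2 * pi * (LINT \<tau>:{0..t}|lebesgue. (SUP n. sqrt 3 ^ n * \<psi> \<tau> n)))) \<and>
         (Tmax < \<infinity> \<longrightarrow>
           (\<integral>\<^sup>+\<tau>\<in>time_dom Tmax. ennreal (SUP n. sqrt 3 ^ n * \<psi> \<tau> n) \<partial>lebesgue) = \<infinity>)"
proof -
  note tw = triad_weight_bounds
  \<comment> \<open>Both equations are abstracted to a notion of solution with nonnegative rates and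
    translations to and from shell flows; the argument below no longer distinguishes them.\<close>
  obtain is_sol lam where maximal: "maximal_solution is_sol Tmax u"
    and lam: "\<And>n. 0 \<le> lam n"
    and cont: "\<And>T v. is_sol T v \<Longrightarrow> continuous_HdotM s_crit T v"
    and to_flow: "\<And>T v \<phi>. (\<And>t. t \<in> time_dom T \<Longrightarrow> shell_state (v t) (\<phi> t)) \<Longrightarrow> is_sol T v \<Longrightarrow>
      shell_flow triad_weight lam T (\<lambda>t. rescale (\<phi> t))"
    and of_flow: "\<And>T v \<phi>. (\<And>t. t \<in> time_dom T \<Longrightarrow> shell_state (v t) (\<phi> t)) \<Longrightarrow>
      (\<And>t. t \<in> time_dom T \<Longrightarrow> v t \<in> HdotM s_crit) \<Longrightarrow>
      shell_flow triad_weight lam T (\<lambda>t. rescale (\<phi> t)) \<Longrightarrow> is_sol T v"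
    using solution
  proof
    assume "maximal_solution (Euler_solution s_crit) Tmax u"
    then show thesis
    proof (rule that)
      show "continuous_HdotM s_crit T v" if "Euler_solution s_crit T v" for T v
        using that by (simp add: Euler_solution_def)
      show "shell_flow triad_weight (\<lambda>_. 0) T (\<lambda>t. rescale (\<phi> t))"
        if "\<And>t. t \<in> time_dom T \<Longrightarrow> shell_state (v t) (\<phi> t)" "Euler_solution s_crit T v" for T v \<phi>
        by (rule Euler_imp_flow[OF that])
      show "Euler_solution s_crit T v" if "\<And>t. t \<in> time_dom T \<Longrightarrow> shell_state (v t) (\<phi> t)"
        "\<And>t. t \<in> time_dom T \<Longrightarrow> v t \<in> HdotM s_crit"
        "shell_flow triad_weight (\<lambda>_. 0) T (\<lambda>t. rescale (\<phi> t))" for T v \<phi>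
        by (rule flow_imp_Euler[OF that])
    qed simp
  next
    assume "\<nu> > 0 \<and> \<alpha> > 0 \<and> maximal_solution (NS_solution \<nu> \<alpha> s_crit) Tmax u"
    then have NS: "0 < \<nu>" "maximal_solution (NS_solution \<nu> \<alpha> s_crit) Tmax u" by auto
    show thesis
    proof (rule that[OF NS(2)])
      show "continuous_HdotM s_crit T v" if "NS_solution \<nu> \<alpha> s_crit T v" for T v
        using that by (simp add: NS_solution_def)
      show "shell_flow triad_weight (dissipation \<nu> \<alpha>) T (\<lambda>t. rescale (\<phi> t))"
        if "\<And>t. t \<in> time_dom T \<Longrightarrow> shell_state (v t) (\<phi> t)" "NS_solution \<nu> \<alpha> s_crit T v" for T v \<phi>
        by (rule NS_imp_flow[OF that])
      show "NS_solution \<nu> \<alpha> s_crit T v" if "\<And>t. t \<in> time_dom T \<Longrightarrow> shell_state (v t) (\<phi> t)"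
        "\<And>t. t \<in> time_dom T \<Longrightarrow> v t \<in> HdotM s_crit"
        "shell_flow triad_weight (dissipation \<nu> \<alpha>) T (\<lambda>t. rescale (\<phi> t))" for T v \<phi>
        by (rule flow_imp_NS[OF that])
      show "0 \<le> dissipation \<nu> \<alpha> n" for n
        using NS(1) by (simp add: dissipation_def)
    qed
  qed
  have sol: "is_sol Tmax u" and Tpos: "0 < Tmax" using maximal by (auto simp: maximal_solution_def)
  have uM: "u t \<in> HdotM s_crit" if "t \<in> time_dom Tmax" for t
    using cont[OF sol] that by (simp add: continuous_HdotM_def)
  have st: "shell_state (u t) (\<psi> t)" if "t \<in> time_dom Tmax" for t
    unfolding coeffs[OF that] using shell_state_symmetric[OF uM[OF that]] symmetric[OF that] by blast
  define a where "a = (\<lambda>t. rescale (\<psi> t))"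
  define g where "g = (\<lambda>t. SUP n. a t n)"
  have flow: "shell_flow triad_weight lam Tmax a"
    unfolding a_def by (rule to_flow[OF st sol])
  note gc = flow_SUP_continuous[where \<beta> = triad_weight, OF tw lam flow, folded g_def]
  have g0: "0 \<le> g t" if "t \<in> time_dom Tmax" for t
    unfolding g_def by (rule flow_SUP_nonneg[where \<beta> = triad_weight, OF tw lam flow that])
  have gi: "set_integrable lebesgue {0..t} g" if "t \<in> time_dom Tmax" for t
    using absolutely_integrable_continuous_real[OF continuous_on_subset[OF gc atLeastAtMost_subset_time_dom[OF that]]] .
  have g_eq: "(SUP n. sqrt 3 ^ n * \<psi> \<tau> n) = g \<tau>" for \<tau>
    by (simp add: g_def a_def rescale_def)
  have nrm: "(seq_norm 1 (\<psi> t))\<^sup>2 = (\<Sum>n. (a t n)\<^sup>2)" if "t \<in> time_dom Tmax" for t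
    using st[OF that] by (simp add: seq_norm_1 a_def l2_norm_power2 shell_state_def)
  have D0: "0 \<in> time_dom Tmax" using Tpos by (simp add: zero_ereal_def)
  have bound: "(\<Sum>n. (a t n)\<^sup>2) \<le> (\<Sum>n. (a 0 n)\<^sup>2) * exp (4 * sqrt 2 * pi * (LINT \<tau>:{0..t}|lebesgue. g \<tau>))"
    if t: "t \<in> time_dom Tmax" for t
  proof -
    have "(LINT \<tau>:{0..t}|lebesgue. g \<tau>) = integral {0..t} g"
      by (rule set_lebesgue_integral_eq_integral(2)[OF gi[OF t]])
    then show ?thesis
      using flow_energy_le[where \<beta> = triad_weight, OF tw lam flow t] by (simp add: g_def)
  qed
  have "(\<integral>\<^sup>+\<tau>\<in>time_dom Tmax. ennreal (g \<tau>) \<partial>lebesgue) = \<infinity>" if fin: "Tmax < \<infinity>"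
  proof (rule ccontr)
    assume "(\<integral>\<^sup>+\<tau>\<in>time_dom Tmax. ennreal (g \<tau>) \<partial>lebesgue) \<noteq> \<infinity>"
    then obtain I where I: "0 \<le> I" "(\<integral>\<^sup>+\<tau>\<in>time_dom Tmax. ennreal (g \<tau>) \<partial>lebesgue) = ennreal I"
      by (cases "\<integral>\<^sup>+\<tau>\<in>time_dom Tmax. ennreal (g \<tau>) \<partial>lebesgue") auto
    obtain T where T: "Tmax = ereal T" "0 < T"
      using fin Tpos by (cases Tmax) auto
    \<comment> \<open>Since the supremum is nonnegative, the finite total \<open>I\<close> bounds
      its integral over every \<open>{0..t}\<close>, and the energy estimate then bounds the l2 norm
      by this constant up to \<open>Tmax\<close>.\<close>
    define R where "R = sqrt ((\<Sum>n. (a 0 n)\<^sup>2) * exp (4 * sqrt 2 * pi * I))"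
    have R: "l2_norm (a t) \<le> R" if t: "t \<in> time_dom (ereal T)" for t
    proof -
      have tD: "t \<in> time_dom Tmax" using t T by simp
      have sub: "{0..t} \<subseteq> time_dom Tmax" by (rule atLeastAtMost_subset_time_dom[OF tD])
      have "ennreal (LINT \<tau>:{0..t}|lebesgue. g \<tau>) = (\<integral>\<^sup>+\<tau>. ennreal (indicator {0..t} \<tau> *\<^sub>R g \<tau>) \<partial>lebesgue)"
        unfolding set_lebesgue_integral_def
      proof (rule nn_integral_eq_integral[symmetric])
        show "integrable lebesgue (\<lambda>\<tau>. indicator {0..t} \<tau> *\<^sub>R g \<tau>)"
          using gi[OF tD] by (simp add: set_integrable_def)
        have "0 \<le> g \<tau>" if "\<tau> \<in> {0..t}" for \<tau> using g0 sub that by blast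
        then show "AE \<tau> in lebesgue. 0 \<le> indicator {0..t} \<tau> *\<^sub>R g \<tau>"
          by (intro AE_I2) (simp add: indicator_def)
      qed
      also have "\<dots> \<le> (\<integral>\<^sup>+\<tau>\<in>time_dom Tmax. ennreal (g \<tau>) \<partial>lebesgue)"
        by (rule nn_integral_mono) (use sub in \<open>auto simp: indicator_def\<close>)
      finally have "(LINT \<tau>:{0..t}|lebesgue. g \<tau>) \<le> I" using I by (simp add: ennreal_le_iff)
      then have "exp (4 * sqrt 2 * pi * (LINT \<tau>:{0..t}|lebesgue. g \<tau>)) \<le> exp (4 * sqrt 2 * pi * I)"
        by simp
      moreover have "0 \<le> (\<Sum>n. (a 0 n)\<^sup>2)"
        using st[OF D0] by (intro suminf_nonneg) (auto simp: a_def shell_state_def)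
      ultimately have "(\<Sum>n. (a t n)\<^sup>2) \<le> (\<Sum>n. (a 0 n)\<^sup>2) * exp (4 * sqrt 2 * pi * I)"
        using bound[OF tD] by (meson mult_left_mono order_trans)
      then show ?thesis unfolding l2_norm_def R_def by (rule real_sqrt_le_mono)
    qed
    obtain T' b where b: "T < T'" "shell_flow triad_weight lam (ereal T') b"
        "\<And>t. t \<in> time_dom (ereal T) \<Longrightarrow> b t = a t"
      using flow_extend[where \<beta> = triad_weight, OF tw lam T(2) flow[unfolded T(1)] R] by blast
    define \<phi> where "\<phi> = (\<lambda>t n. b t n / sqrt 3 ^ n)"
    \<comment> \<open>Keeping \<open>u\<close> itself up to \<open>Tmax\<close> makes agreement
      immediate; only later times use the sine series. Both pieces have amplitudes
      \<open>\<phi>\<close>, so the joined field is governed by the single flow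
      \<open>b\<close>.\<close>
    define v where "v t = (if t \<in> time_dom Tmax then u t else shell_field (\<phi> t))" for t
    have \<phi>b: "rescale (\<phi> t) = b t" for t by (simp add: fun_eq_iff rescale_def \<phi>_def)
    have \<phi>\<psi>: "\<phi> t = \<psi> t" if "t \<in> time_dom Tmax" for t
      using b(3)[of t] that T by (simp add: fun_eq_iff \<phi>_def a_def rescale_def)
    have sm: "summable (\<lambda>n. (rescale (\<phi> t) n)\<^sup>2)" if "t \<in> time_dom (ereal T')" for t
      using b(2) that unfolding \<phi>b shell_flow_def by blast
    have "is_sol (ereal T') v"
    proof (rule of_flow)
      fix t assume t: "t \<in> time_dom (ereal T')"
      show "shell_state (v t) (\<phi> t)"
        using st[of t] \<phi>\<psi>[of t] shell_state_shell_field[OF sm[OF t]] by (simp add: v_def)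
      show "v t \<in> HdotM s_crit"
        using uM[of t] shell_field_HdotM[OF sm[OF t]] by (simp add: v_def)
    next
      show "shell_flow triad_weight lam (ereal T') (\<lambda>t. rescale (\<phi> t))"
        unfolding \<phi>b using b(2) by simp
    qed
    moreover have "Tmax < ereal T'" using b(1) T by simp
    moreover have "\<forall>t\<in>time_dom Tmax. AE x in lebesgue. v t x = u t x" by (simp add: v_def)
    ultimately show False using maximal unfolding maximal_solution_def by blast
  qed
  then show ?thesis using bound D0 by (simp only: g_eq) (auto simp: nrm)
qed

end
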